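(* Let $\mathcal{M}$ be a separable II$_1$ factor, let $\mathcal{A}\subseteq\mathcal{M}$ be a semiregular masa, let $\{p_i^k\}$ be a family of projections in $\mathcal{A}$ together with matrix units $\{v^k_{ij}\}$ forming a coherent dyadic system for $\mathcal{A}$ (as defined in the context), let $\pi_k:M_{2^k}(\mathbb{C})\to\mathcal{M}$ be the corresponding $*$-monomorphisms, and let $x\in\mathcal{A}^+$ be the operator associated to $\{p_i^k\}$. Let $k\ge 1$ and $A\in M_{2^k}(\mathbb{C})$. Then the sequence $(a_n)_{n\in\mathbb{N}}\subseteq\mathcal{M}$ given by $a_1=\pi_k(A)$ and $$a_{n+1}=\pi_{k+n}(A(n+1))=\pi_{k+n}(W_{n+k-1})\,\pi_{k+n}(I_2\otimes A(n))\,\pi_{k+n}(W_{n+k-1})^*$$ converges strongly to an operator $a\in\mathcal{M}$. Moreover: (i) if $A$ is a projection (respectively self-adjoint, positive), then so is $a$; (ii) if $A_{jj}=d_j$ for $j=1,\dots,2^k$ and $f:[0,1]\to\mathbb{C}$ is the piecewise linear function given by $$f(t)=d_{2j-1}+2^{k-1}\left(t-\frac{j-1}{2^{k-1}}\right)(d_{2j}-d_{2j-1}),\qquad t\in\left[\frac{j-1}{2^{k-1}},\frac{j}{2^{k-1}}\right),\quad j=1,\dots,2^{k-1},$$ then $E_{\mathcal{A}}(a)=f(x)$; (iii) if $B\in M_{2^k}(\mathbb{C})$ and $b=\lim_n\pi_{n+k-1}(B(n))$ (strong limit), then $\|b-a\|_2^2=\frac{1}{2^k}\|B-A\|_2^2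$.
   Context: $\mathcal{M}$ is a II$_1$ factor with normalized faithful normal trace $\tau$; separable means with separable predual. A masa is a maximal abelian self-adjoint subalgebra; $E_{\mathcal{A}}$ is the unique trace-preserving conditional expectation of $\mathcal{M}$ onto $\mathcal{A}$. The normalizer of $\mathcal{A}$ is $\mathcal{N}_{\mathcal{A}}=\{u\in\mathcal{M}\text{ unitary}: u^*\mathcal{A}u=\mathcal{A}\}$, and $\mathcal{A}$ is semiregular if $(\mathcal{N}_{\mathcal{A}})''$ is a factor. Coherent dyadic system: for every $k\in\mathbb{N}$ there are given unitaries $\{u_i^k\}_{i=1}^{2^k}\subset\mathcal{N}_{\mathcal{A}}$ and projections $\{p_i^k\}_{i=1}^{2^k}\subset\mathcal{A}$ such that $v^k_{ij}=u_i^k p_1^k(u_j^k)^*$, $1\le i,j\le 2^k$, is a $2^k$-system of matrix units in $\mathcal{M}$ (so $v^k_{ij}v^k_{rs}=\delta_{jr}v^k_{is}$, $(v^k_{ij})^*=v^k_{ji}$, $\sum_i v^k_{ii}=1$) with $v^k_{jj}=p^k_j$, such that $v^{k+1}_{2i-1,2j-1}+v^{k+1}_{2i,2j}=v^k_{ij}$ for $1\le i,j\le 2^k$, and such that the family $\{p_j^k\}_{j,k}$ generates $\mathcal{A}$ as a von Neumann algebra. (Such systems are known to exist for every semiregular masa of a separable II$_1$ factor.) The $*$-monomorphism $\pi_k:M_{2^k}(\mathbb{C})\to\mathcal{M}$ is $\pi_k((a_{ij}))=\sum_{i,j}a_{ij}v^k_{ij}$. Associated operator: the operators $x_k=\sum_{i=1}^{2^k}\frac{i}{2^k}p_i^k\in\mathcal{A}^+$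 form a non-increasing bounded sequence; $x=\lim_k x_k$ (strong operator topology) is the operator associated to $\{p_i^k\}$. Its spectral measure $p^x$ satisfies $p^x([(i-1)2^{-k},i2^{-k}))=p_i^k$, and $\tau\circ p^x$ is Lebesgue measure on $[0,1]$. Here $f(x)$ denotes Borel functional calculus (the value of $f$ at $t=1$ is irrelevant). Tensor convention: $X\otimes Y$ denotes the block matrix whose $(i,j)$ block is $y_{ij}X$. Thus, for $C=(c_{ij})\in M_m(\mathbb{C})$, $I_2\otimes C\in M_{2m}(\mathbb{C})$ is the matrix whose $(i,j)$ $2\times2$ block is $c_{ij}I_2$. Unitaries: $$W_1=\begin{pmatrix}1&0&0&0\\0&\frac1{\sqrt2}&-\frac1{\sqrt2}&0\\0&\frac1{\sqrt2}&\frac1{\sqrt2}&0\\0&0&0&1\end{pmatrix},\qquad W_{n+1}=W_n\otimes I_2=\begin{pmatrix}W_n&0\\0&W_n\end{pmatrix}=\bigoplus_{j=1}^{2^n}W_1,$$ so $W_n\in M_{2^{n+1}}(\mathbb{C})$. For $A\in M_{2^k}(\mathbb{C})$ define $A(1)=A$ and $A(n+1)=W_{k+n-1}(I_2\otimes A(n))W_{k+n-1}^*$ for $n\ge1$, so $A(n)\in M_{2^{k+n-1}}(\mathbb{C})$; $B(n)$ is defined in the same way from $B$. In $\mathcal{M}$, $\|y\|_2=\tau(y^*y)^{1/2}$; for matrices, $\|C\|_2$ is the unnormalized Hilbert–Schmidt (Frobenius) norm, $\|C\|_2^2=\sum_{i,j}|c_{ij}|^2$. *)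

theory Defs
  imports
    "HOL-Analysis.Analysis"
    "Jordan_Normal_Form.Schur_Decomposition"
begin

section \<open>Complex Hilbert spaces and bounded operators\<close>

class scaleC =
  fixes scaleC :: "complex \<Rightarrow> 'a \<Rightarrow> 'a"  (infixr "*\<^sub>C" 75)

text \<open>The inner product is conjugate-linear in its first argument.\<close>

class chilbert = real_normed_vector + complete_space + scaleC +
  fixes cinner :: "'a \<Rightarrow> 'a \<Rightarrow> complex"
  assumes scaleC_add_right: "c *\<^sub>C (x + y) = c *\<^sub>C x + c *\<^sub>C y"
    and scaleC_add_left: "(c + d) *\<^sub>C x = c *\<^sub>C x + d *\<^sub>C x"
    and scaleC_scaleC: "c *\<^sub>C (d *\<^sub>C x) = (c * d) *\<^sub>C x"
    and scaleR_scaleC: "r *\<^sub>R x = complex_of_real r *\<^sub>C x"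
    and cinner_commute: "cinner x y = cnj (cinner y x)"
    and cinner_add_right: "cinner x (y + z) = cinner x y + cinner x z"
    and cinner_scaleC_right: "cinner x (c *\<^sub>C y) = c * cinner x y"
    and cinner_self: "cinner x x = complex_of_real ((norm x)\<^sup>2)"

text \<open>\<open>'h cop\<close> is the algebra of bounded complex-linear operators on \<open>'h\<close>;
  its multiplication is composition.\<close>

typedef (overloaded) 'h cop =
  "{f :: 'h::chilbert \<Rightarrow> 'h. bounded_linear f \<and> (\<forall>c x. f (c *\<^sub>C x) = c *\<^sub>C f x)}"
  morphisms app Cop
  by (rule exI[of _ "\<lambda>x. x"]) (simp add: bounded_linear_ident)

setup_lifting type_definition_cop

lemma scaleC_zero: "c *\<^sub>C (0 :: 'h::chilbert) = 0"
  using scaleC_add_right[of c 0 0] by simp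

lemma scaleC_minus: "c *\<^sub>C (- x) = - (c *\<^sub>C x)" for x :: "'h::chilbert"
  using scaleC_add_right[of c x "- x"] by (simp add: scaleC_zero eq_neg_iff_add_eq_0 add.commute)

lemma scaleC_diff: "c *\<^sub>C (x - y) = c *\<^sub>C x - c *\<^sub>C y" for x :: "'h::chilbert"
  using scaleC_add_right[of c x "- y"] by (simp add: scaleC_minus)

lemma bounded_linear_scaleC: "bounded_linear (\<lambda>x :: 'h::chilbert. c *\<^sub>C x)"
proof (rule bounded_linear_intro[where K = "cmod c"])
  fix x y :: 'h and r :: real
  show "c *\<^sub>C (x + y) = c *\<^sub>C x + c *\<^sub>C y"
    by (rule scaleC_add_right)
  show "c *\<^sub>C (r *\<^sub>R x) = r *\<^sub>R (c *\<^sub>C x)"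
    by (simp add: scaleR_scaleC scaleC_scaleC mult.commute)
  have "complex_of_real ((norm (c *\<^sub>C x))\<^sup>2) = cinner (c *\<^sub>C x) (c *\<^sub>C x)"
    by (simp add: cinner_self)
  also have "\<dots> = c * cnj (cinner x (c *\<^sub>C x))"
    by (metis cinner_scaleC_right cinner_commute)
  also have "\<dots> = complex_of_real ((cmod c * norm x)\<^sup>2)"
    by (simp add: cinner_scaleC_right cinner_self complex_norm_square power_mult_distrib
        del: of_real_power)
  finally have "(norm (c *\<^sub>C x))\<^sup>2 = (cmod c * norm x)\<^sup>2"
    using of_real_eq_iff by blast
  then show "norm (c *\<^sub>C x) \<le> norm x * cmod c"
    by (simp add: mult.commute)
qed

instantiation cop :: (chilbert) "{ring, monoid_mult, scaleC}"
begin

lift_definition zero_cop :: "'a cop" is "\<lambda>_. 0"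
  by (simp add: scaleC_zero)

lift_definition one_cop :: "'a cop" is "\<lambda>x. x"
  by (simp add: bounded_linear_ident)

lift_definition plus_cop :: "'a cop \<Rightarrow> 'a cop \<Rightarrow> 'a cop" is "\<lambda>S T x. S x + T x"
  by (simp add: bounded_linear_add scaleC_add_right)

lift_definition uminus_cop :: "'a cop \<Rightarrow> 'a cop" is "\<lambda>T x. - T x"
  by (simp add: bounded_linear_minus scaleC_minus)

lift_definition minus_cop :: "'a cop \<Rightarrow> 'a cop \<Rightarrow> 'a cop" is "\<lambda>S T x. S x - T x"
  by (simp add: bounded_linear_sub scaleC_diff)

lift_definition times_cop :: "'a cop \<Rightarrow> 'a cop \<Rightarrow> 'a cop" is "\<lambda>S T x. S (T x)"
  by (simp add: bounded_linear_compose)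

lift_definition scaleC_cop :: "complex \<Rightarrow> 'a cop \<Rightarrow> 'a cop" is "\<lambda>c T x. c *\<^sub>C T x"
  by (auto intro: bounded_linear_compose[OF bounded_linear_scaleC]
      simp: scaleC_scaleC mult.commute)

instance
proof
  fix R S T :: "'a cop"
  show "R * (S + T) = R * S + R * T"
    by transfer (simp add: bounded_linear.axioms linear_add bounded_linear.linear)
qed (transfer; simp add: fun_eq_iff)+

end

definition adj :: "'h::chilbert cop \<Rightarrow> 'h cop" where
  "adj T = (THE S. \<forall>\<xi> \<eta>. cinner (app S \<xi>) \<eta> = cinner \<xi> (app T \<eta>))"

definition self_adjoint :: "'h::chilbert cop \<Rightarrow> bool" where
  "self_adjoint T \<longleftrightarrow> adj T = T"

definition projection :: "'h::chilbert cop \<Rightarrow> bool" where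
  "projection T \<longleftrightarrow> T * T = T \<and> adj T = T"

definition positive_op :: "'h::chilbert cop \<Rightarrow> bool" where
  "positive_op T \<longleftrightarrow> (\<forall>\<xi>. 0 \<le> cinner \<xi> (app T \<xi>))"

definition unitary :: "'h::chilbert cop \<Rightarrow> bool" where
  "unitary T \<longleftrightarrow> adj T * T = 1 \<and> T * adj T = 1"

definition strong_lim :: "(nat \<Rightarrow> 'h::chilbert cop) \<Rightarrow> 'h cop \<Rightarrow> bool" where
  "strong_lim X L \<longleftrightarrow> (\<forall>\<xi>. (\<lambda>n. app (X n) \<xi>) \<longlonglongrightarrow> app L \<xi>)"

section \<open>Von Neumann algebras\<close>

definition star_subalgebra :: "'h::chilbert cop set \<Rightarrow> bool" where
  "star_subalgebra S \<longleftrightarrow> 0 \<in> S \<and>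
    (\<forall>a\<in>S. \<forall>b\<in>S. a + b \<in> S \<and> a * b \<in> S) \<and>
    (\<forall>a\<in>S. \<forall>c. c *\<^sub>C a \<in> S) \<and> (\<forall>a\<in>S. adj a \<in> S)"

definition commutant :: "'h::chilbert cop set \<Rightarrow> 'h cop set" where
  "commutant S = {T. \<forall>s\<in>S. T * s = s * T}"

definition von_neumann_algebra :: "'h::chilbert cop set \<Rightarrow> bool" where
  "von_neumann_algebra M \<longleftrightarrow> star_subalgebra M \<and> commutant (commutant M) = M"

definition factor :: "'h::chilbert cop set \<Rightarrow> bool" where
  "factor M \<longleftrightarrow> von_neumann_algebra M \<and> M \<inter> commutant M = range (\<lambda>c. c *\<^sub>C 1)"

text \<open>Type \<open>II\<^sub>1\<close>: the unit is a finite projection (it is not equivalent to a proper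
  subprojection) and there are no minimal projections.\<close>

definition II1_factor :: "'h::chilbert cop set \<Rightarrow> bool" where
  "II1_factor M \<longleftrightarrow> factor M \<and>
    (\<forall>w\<in>M. adj w * w = 1 \<longrightarrow> w * adj w = 1) \<and>
    (\<forall>e\<in>M. projection e \<and> e \<noteq> 0 \<longrightarrow>
      (\<exists>q\<in>M. projection q \<and> e * q = q \<and> q \<noteq> 0 \<and> q \<noteq> e))"

text \<open>Elements of the predual: the ultraweakly continuous linear functionals on \<open>M\<close>,
  i.e. those given by a pair of square-summable sequences of vectors. Functionals on \<open>M\<close>
  are represented by functions on all operators whose values outside \<open>M\<close> are ignored.\<close>

definition normal_functional :: "'h::chilbert cop set \<Rightarrow> ('h cop \<Rightarrow> complex) \<Rightarrow> bool" where
  "normal_functional M \<phi> \<longleftrightarrow> (\<exists>\<xi> \<eta> :: nat \<Rightarrow> 'h.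
    summable (\<lambda>n. (norm (\<xi> n))\<^sup>2) \<and> summable (\<lambda>n. (norm (\<eta> n))\<^sup>2) \<and>
    (\<forall>T\<in>M. (\<lambda>n. cinner (\<xi> n) (app T (\<eta> n))) sums \<phi> T))"

text \<open>Norm density of a countable set, the norm being that of the dual of \<open>M\<close>.\<close>

definition separable_predual :: "'h::chilbert cop set \<Rightarrow> bool" where
  "separable_predual M \<longleftrightarrow> (\<exists>D. countable D \<and> (\<forall>\<psi>\<in>D. normal_functional M \<psi>) \<and>
    (\<forall>\<phi>. normal_functional M \<phi> \<longrightarrow> (\<forall>\<epsilon>>0. \<exists>\<psi>\<in>D.
      \<forall>T\<in>M. onorm (app T) \<le> 1 \<longrightarrow> cmod (\<phi> T - \<psi> T) \<le> \<epsilon>)))"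

definition faithful_normal_trace :: "'h::chilbert cop set \<Rightarrow> ('h cop \<Rightarrow> complex) \<Rightarrow> bool" where
  "faithful_normal_trace M \<tau> \<longleftrightarrow>
    (\<forall>S\<in>M. \<forall>T\<in>M. \<tau> (S + T) = \<tau> S + \<tau> T) \<and>
    (\<forall>T\<in>M. \<forall>c. \<tau> (c *\<^sub>C T) = c * \<tau> T) \<and>
    (\<forall>T\<in>M. positive_op T \<longrightarrow> 0 \<le> \<tau> T) \<and>
    (\<forall>S\<in>M. \<forall>T\<in>M. \<tau> (S * T) = \<tau> (T * S)) \<and>
    \<tau> 1 = 1 \<and>
    (\<forall>T\<in>M. positive_op T \<and> \<tau> T = 0 \<longrightarrow> T = 0) \<and>
    normal_functional M \<tau>"

definition norm2 :: "('h::chilbert cop \<Rightarrow> complex) \<Rightarrow> 'h cop \<Rightarrow> real" where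
  "norm2 \<tau> y = sqrt (Re (\<tau> (adj y * y)))"

section \<open>Masas\<close>

definition abelian_star_subalgebra :: "'h::chilbert cop set \<Rightarrow> bool" where
  "abelian_star_subalgebra S \<longleftrightarrow> star_subalgebra S \<and> (\<forall>a\<in>S. \<forall>b\<in>S. a * b = b * a)"

definition masa :: "'h::chilbert cop set \<Rightarrow> 'h cop set \<Rightarrow> bool" where
  "masa M A \<longleftrightarrow> abelian_star_subalgebra A \<and> A \<subseteq> M \<and>
    (\<forall>C. abelian_star_subalgebra C \<and> A \<subseteq> C \<and> C \<subseteq> M \<longrightarrow> C = A)"

definition normalizer :: "'h::chilbert cop set \<Rightarrow> 'h cop set \<Rightarrow> 'h cop set" where
  "normalizer M A = {u\<in>M. unitary u \<and> (\<lambda>a. adj u * a * u) ` A = A}"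

definition semiregular_masa :: "'h::chilbert cop set \<Rightarrow> 'h cop set \<Rightarrow> bool" where
  "semiregular_masa M A \<longleftrightarrow> masa M A \<and> factor (commutant (commutant (normalizer M A)))"

definition trace_preserving_cond_exp ::
    "'h::chilbert cop set \<Rightarrow> ('h cop \<Rightarrow> complex) \<Rightarrow> 'h cop set \<Rightarrow> ('h cop \<Rightarrow> 'h cop) \<Rightarrow> bool" where
  "trace_preserving_cond_exp M \<tau> A E \<longleftrightarrow>
    (\<forall>T\<in>M. E T \<in> A) \<and> (\<forall>a\<in>A. E a = a) \<and>
    (\<forall>S\<in>M. \<forall>T\<in>M. E (S + T) = E S + E T) \<and>
    (\<forall>T\<in>M. \<forall>c. E (c *\<^sub>C T) = c *\<^sub>C E T) \<and>
    (\<forall>T\<in>M. positive_op T \<longrightarrow> positive_op (E T)) \<and>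
    (\<forall>a\<in>A. \<forall>b\<in>A. \<forall>T\<in>M. E (a * T * b) = a * E T * b) \<and>
    (\<forall>T\<in>M. \<tau> (E T) = \<tau> T)"

section \<open>Coherent dyadic systems\<close>

text \<open>\<open>u k i\<close> and \<open>p k i\<close> stand for $u_i^k$ and $p_i^k$, with $k \geq 1$ and
  $1 \leq i \leq 2^k$; other values are ignored.\<close>

definition dyadic_unit ::
    "(nat \<Rightarrow> nat \<Rightarrow> 'h::chilbert cop) \<Rightarrow> (nat \<Rightarrow> nat \<Rightarrow> 'h cop) \<Rightarrow> nat \<Rightarrow> nat \<Rightarrow> nat \<Rightarrow> 'h cop" where
  "dyadic_unit u p k i j = u k i * p k 1 * adj (u k j)"

definition matrix_units :: "nat \<Rightarrow> (nat \<Rightarrow> nat \<Rightarrow> 'h::chilbert cop) \<Rightarrow> bool" where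
  "matrix_units N v \<longleftrightarrow>
    (\<forall>i\<in>{1..N}. \<forall>j\<in>{1..N}. \<forall>r\<in>{1..N}. \<forall>s\<in>{1..N}.
      v i j * v r s = (if j = r then v i s else 0)) \<and>
    (\<forall>i\<in>{1..N}. \<forall>j\<in>{1..N}. adj (v i j) = v j i) \<and>
    (\<Sum>i=1..N. v i i) = 1"

definition coherent_dyadic_system ::
    "'h::chilbert cop set \<Rightarrow> 'h cop set \<Rightarrow> (nat \<Rightarrow> nat \<Rightarrow> 'h cop) \<Rightarrow> (nat \<Rightarrow> nat \<Rightarrow> 'h cop) \<Rightarrow> bool" where
  "coherent_dyadic_system M A u p \<longleftrightarrow>
    (\<forall>k\<ge>1.
      (\<forall>i\<in>{1..2^k}. u k i \<in> normalizer M A \<and> p k i \<in> A \<and> projection (p k i)) \<and>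
      matrix_units (2^k) (dyadic_unit u p k) \<and>
      (\<forall>j\<in>{1..2^k}. dyadic_unit u p k j j = p k j) \<and>
      (\<forall>i\<in>{1..2^k}. \<forall>j\<in>{1..2^k}.
        dyadic_unit u p (k+1) (2*i-1) (2*j-1) + dyadic_unit u p (k+1) (2*i) (2*j)
          = dyadic_unit u p k i j)) \<and>
    commutant (commutant {p k j | k j. k \<ge> 1 \<and> j \<in> {1..2^k}}) = A"

text \<open>The library's matrices are indexed from 0, the matrix units from 1.\<close>

definition dyadic_embedding ::
    "(nat \<Rightarrow> nat \<Rightarrow> 'h::chilbert cop) \<Rightarrow> (nat \<Rightarrow> nat \<Rightarrow> 'h cop) \<Rightarrow> nat \<Rightarrow> complex mat \<Rightarrow> 'h cop" where
  "dyadic_embedding u p k C =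
    (\<Sum>i=1..2^k. \<Sum>j=1..2^k. (C $$ (i-1, j-1)) *\<^sub>C dyadic_unit u p k i j)"

definition associated_operator :: "(nat \<Rightarrow> nat \<Rightarrow> 'h::chilbert cop) \<Rightarrow> 'h cop \<Rightarrow> bool" where
  "associated_operator p x \<longleftrightarrow>
    strong_lim (\<lambda>k. \<Sum>i=1..2^k. complex_of_real (real i / 2^k) *\<^sub>C p k i) x"

section \<open>Borel functional calculus\<close>

definition projection_valued_measure :: "(real set \<Rightarrow> 'h::chilbert cop) \<Rightarrow> bool" where
  "projection_valued_measure P \<longleftrightarrow>
    (\<forall>S\<in>sets borel. projection (P S)) \<and> P UNIV = 1 \<and>
    (\<forall>F :: nat \<Rightarrow> real set. range F \<subseteq> sets borel \<and> disjoint_family F \<longrightarrow>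
      (\<forall>\<xi>. (\<lambda>n. app (P (F n)) \<xi>) sums app (P (\<Union>n. F n)) \<xi>))"

definition vector_measure :: "(real set \<Rightarrow> 'h::chilbert cop) \<Rightarrow> 'h \<Rightarrow> real measure" where
  "vector_measure P \<xi> = measure_of UNIV (sets borel) (\<lambda>S. ennreal (Re (cinner \<xi> (app (P S) \<xi>))))"

text \<open>\<open>T = \<integral> f dP\<close> in the weak sense; the diagonal of the form determines \<open>T\<close> by
  polarization.\<close>

definition has_spectral_integral ::
    "(real set \<Rightarrow> 'h::chilbert cop) \<Rightarrow> (real \<Rightarrow> complex) \<Rightarrow> 'h cop \<Rightarrow> bool" where
  "has_spectral_integral P f T \<longleftrightarrow> (\<forall>\<xi>. integrable (vector_measure P \<xi>) f \<and>
    cinner \<xi> (app T \<xi>) = integral\<^sup>L (vector_measure P \<xi>) f)"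

definition spectral_measure :: "'h::chilbert cop \<Rightarrow> (real set \<Rightarrow> 'h cop) \<Rightarrow> bool" where
  "spectral_measure x P \<longleftrightarrow>
    projection_valued_measure P \<and> has_spectral_integral P complex_of_real x"

text \<open>\<open>T = f(x)\<close> for self-adjoint \<open>x\<close>. Only the values of \<open>f\<close> almost everywhere with
  respect to the spectral measure of \<open>x\<close> matter.\<close>

definition has_borel_calculus ::
    "'h::chilbert cop \<Rightarrow> (real \<Rightarrow> complex) \<Rightarrow> 'h cop \<Rightarrow> bool" where
  "has_borel_calculus x f T \<longleftrightarrow> (\<exists>P. spectral_measure x P \<and> has_spectral_integral P f T)"

section \<open>Matrices\<close>

text \<open>Block convention: the \<open>(i, j)\<close> block of \<open>tensor X Y\<close> is $y_{ij} X$.\<close>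

definition tensor :: "complex mat \<Rightarrow> complex mat \<Rightarrow> complex mat" where
  "tensor X Y = Matrix.mat (dim_row X * dim_row Y) (dim_col X * dim_col Y)
    (\<lambda>(r, c). Y $$ (r div dim_row X, c div dim_col X) * X $$ (r mod dim_row X, c mod dim_col X))"

text \<open>\<open>Wmat n\<close> is meaningful for \<open>n \<ge> 1\<close> only, and so is \<open>mat_iter k A n\<close>, which stands for
  \<open>A(n)\<close>; the values at 0 are dummies.\<close>

fun Wmat :: "nat \<Rightarrow> complex mat" where
  "Wmat 0 = 1\<^sub>m 2"
| "Wmat (Suc 0) = mat_of_rows_list 4
    [[1, 0, 0, 0],
     [0, complex_of_real (1 / sqrt 2), - complex_of_real (1 / sqrt 2), 0],
     [0, complex_of_real (1 / sqrt 2), complex_of_real (1 / sqrt 2), 0],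
     [0, 0, 0, 1]]"
| "Wmat (Suc (Suc n)) = tensor (Wmat (Suc n)) (1\<^sub>m 2)"

primrec mat_iter :: "nat \<Rightarrow> complex mat \<Rightarrow> nat \<Rightarrow> complex mat" where
  "mat_iter k A 0 = A"
| "mat_iter k A (Suc n) = (if n = 0 then A
    else Wmat (k + n - 1) * tensor (1\<^sub>m 2) (mat_iter k A n) * mat_adjoint (Wmat (k + n - 1)))"

definition mat_self_adjoint :: "complex mat \<Rightarrow> bool" where
  "mat_self_adjoint A \<longleftrightarrow> mat_adjoint A = A"

definition mat_projection :: "complex mat \<Rightarrow> bool" where
  "mat_projection A \<longleftrightarrow> A * A = A \<and> mat_adjoint A = A"

definition mat_positive :: "complex mat \<Rightarrow> bool" where
  "mat_positive A \<longleftrightarrow> (\<forall>z\<in>carrier_vec (dim_row A). 0 \<le> (A *\<^sub>v z) \<bullet>c z)"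

definition frobenius_norm :: "complex mat \<Rightarrow> real" where
  "frobenius_norm C = sqrt (\<Sum>i<dim_row C. \<Sum>j<dim_col C. (cmod (C $$ (i, j)))\<^sup>2)"

end

theory Submission
  imports Defs
begin

text \<open>
  Write \<open>\<pi>_k\<close> for the embedding of level \<open>k\<close>. Since \<open>\<pi>_(k+1) (I_2 \<otimes> C) = \<pi>_k C\<close>, each \<open>a_(n+1)\<close> is the conjugate of
  \<open>a_n\<close> by a unitary, which rotates by 45 degrees in the middle two coordinates of every 4 by 4 block. A \<open>2 \<times> 2\<close> block
  with rows \<open>(a, b)\<close> and \<open>(c, d)\<close> is replaced by four such blocks; the sum of \<open>|a - d|^2 + |b|^2 + |c|^2\<close> over all
  blocks is invariant and controls the Frobenius norm of \<open>A(n+1) - I_2 \<otimes> A(n)\<close>. As the trace normalizes by the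
  size of the matrix, the increments \<open>a_(n+1) - a_n\<close> decay geometrically in the trace norm. A bounded
  sequence that is Cauchy in the trace norm converges strongly: by weak compactness, normality and
  faithfulness, bounded positive elements of small trace are weakly small.

  On the diagonal, \<open>(a, d)\<close> becomes \<open>(a, (a+d)/2, (a+d)/2, d)\<close>, so that at every level the diagonal consists of
  one-sided limits of the same piecewise linear function \<open>f\<close>. The expectations of the \<open>a_n\<close> therefore
  converge in norm to \<open>f(x)\<close>, and duality with respect to the trace identifies the limit with the
  expectation of \<open>a\<close>. The spectral measure of \<open>x\<close> is obtained from the dyadic projections as a limit of
  martingales, with the trace norm as the only analytic tool.
\<close>

subsection \<open>Complex Hilbert spaces\<close>

text \<open>The algebra acts on an arbitrary Hilbert space, in which the given vectors are unrelated
  to the trace; a small trace norm says nothing directly about \<open>app T x\<close>. This is why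
  strong convergence is drawn from a compactness argument, and only on operator-norm bounded sets.
  The iterates stay in such a set because every step is a unitary conjugation. The unitary depends
  on the level alone, not on the matrix, so iterations started from \<open>A\<close> and
  \<open>B\<close> keep the trace norm of their difference: this is (iii). Functional calculus is
  expressed by the existence of a spectral measure, so a projection-valued measure has to be
  exhibited on all Borel sets and not only on dyadic intervals. On \<open>S\<close> it is the limit
  of diagonal operators whose coefficients are the relative Lebesgue measures of \<open>S\<close> in
  the dyadic intervals. Its trace is Lebesgue measure on the unit interval, which turns countable
  additivity into continuity of Lebesgue measure at the empty set. Both \<open>x\<close> and the
  expectation of \<open>a\<close> are then integrals against it, by one lemma on uniform limits of
  dyadic step functions.\<close>

lemma cinner_add_left: "cinner (x + y) z = cinner x z + cinner y z" for x :: "'h::chilbert"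
  by (metis cinner_commute cinner_add_right complex_cnj_add)

lemma cinner_scaleC_left: "cinner (c *\<^sub>C x) y = cnj c * cinner x y" for x :: "'h::chilbert"
  by (metis cinner_commute cinner_scaleC_right complex_cnj_mult)

lemma cinner_zero_right [simp]: "cinner x 0 = 0" for x :: "'h::chilbert"
  using cinner_add_right[of x 0 0] by simp

lemma cinner_zero_left [simp]: "cinner 0 x = 0" for x :: "'h::chilbert"
  by (metis cinner_commute cinner_zero_right complex_cnj_zero)

lemma cinner_minus_right: "cinner x (- y) = - cinner x y" for x :: "'h::chilbert"
  by (metis cinner_add_right cinner_zero_right add.right_inverse add_eq_0_iff)

lemma cinner_minus_left: "cinner (- x) y = - cinner x y" for x :: "'h::chilbert"
  by (metis cinner_commute cinner_minus_right complex_cnj_minus)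

lemma cinner_diff_right: "cinner x (y - z) = cinner x y - cinner x z" for x :: "'h::chilbert"
  using cinner_add_right[of x y "- z"] by (simp add: cinner_minus_right)

lemma cinner_diff_left: "cinner (x - y) z = cinner x z - cinner y z" for x :: "'h::chilbert"
  using cinner_add_left[of x "- y" z] by (simp add: cinner_minus_left)

lemma cinner_sum_right: "cinner x (sum f S) = (\<Sum>i\<in>S. cinner x (f i))" for x :: "'h::chilbert"
  by (induction S rule: infinite_finite_induct) (auto simp: cinner_add_right)

lemma Re_cinner_self: "Re (cinner x x) = (norm x)\<^sup>2" for x :: "'h::chilbert"
  by (simp add: cinner_self)

lemma Re_cinner_commute: "Re (cinner x y) = Re (cinner y x)" for x :: "'h::chilbert"
  by (metis cinner_commute complex_cnj(1) complex.sel(1) cnj.simps(1))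

lemma norm_scaleC: "norm (c *\<^sub>C x) = cmod c * norm x" for x :: "'h::chilbert"
proof -
  have "complex_of_real ((norm (c *\<^sub>C x))\<^sup>2) = c * (cnj c * complex_of_real ((norm x)\<^sup>2))"
    unfolding cinner_self[symmetric] by (simp only: cinner_scaleC_left cinner_scaleC_right)
  also have "\<dots> = complex_of_real ((cmod c * norm x)\<^sup>2)"
    by (simp add: complex_norm_square power_mult_distrib del: of_real_power)
  finally show ?thesis
    by (metis norm_ge_zero mult_nonneg_nonneg of_real_eq_iff power2_eq_imp_eq)
qed

lemma scaleC_one: "1 *\<^sub>C x = x" for x :: "'h::chilbert"
  using scaleR_scaleC[of 1 x] by simp

lemma scaleC_zero_left: "0 *\<^sub>C x = 0" for x :: "'h::chilbert"
  using scaleR_scaleC[of 0 x] by simp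

lemma norm_add_sq: "(norm (x + y))\<^sup>2 = (norm x)\<^sup>2 + (norm y)\<^sup>2 + 2 * Re (cinner x y)"
  for x :: "'h::chilbert"
  unfolding Re_cinner_self[symmetric]
  by (simp add: cinner_add_left cinner_add_right Re_cinner_commute[of y x])

lemma norm_diff_sq: "(norm (x - y))\<^sup>2 = (norm x)\<^sup>2 + (norm y)\<^sup>2 - 2 * Re (cinner x y)"
  for x :: "'h::chilbert"
  using norm_add_sq[of x "- y"] by (simp add: cinner_minus_right)

lemma parallelogram: "(norm (x + y))\<^sup>2 + (norm (x - y))\<^sup>2 = 2 * (norm x)\<^sup>2 + 2 * (norm y)\<^sup>2"
  for x :: "'h::chilbert"
  by (simp add: norm_add_sq norm_diff_sq)

lemma Re_cinner_le: "Re (cinner x y) \<le> norm x * norm y" for x :: "'h::chilbert"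
proof -
  have "(norm (x + y))\<^sup>2 \<le> (norm x + norm y)\<^sup>2"
    by (simp add: norm_triangle_ineq)
  then show ?thesis
    by (simp add: norm_add_sq power2_sum)
qed

text \<open>The triangle inequality only controls the real part; rotating \<open>y\<close> by the
  phase of the inner product makes that product real and nonnegative.\<close>

lemma cinner_norm_le: "cmod (cinner x y) \<le> norm x * norm y" for x :: "'h::chilbert"
proof (cases "cinner x y = 0")
  case False
  define c where "c = cnj (cinner x y) / complex_of_real (cmod (cinner x y))"
  have c: "cmod c = 1"
    using False by (simp add: c_def norm_divide)
  have "cinner x (c *\<^sub>C y) = complex_of_real (cmod (cinner x y))"
    using False unfolding cinner_scaleC_right c_def
    by (simp add: complex_norm_square[symmetric] power2_eq_square mult.commute
        flip: complex_norm_square)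
  then have "cmod (cinner x y) \<le> norm x * norm (c *\<^sub>C y)"
    using Re_cinner_le[of x "c *\<^sub>C y"] by simp
  then show ?thesis
    by (simp add: norm_scaleC c)
qed auto

lemma bounded_linear_cinner_right: "bounded_linear (cinner x)" for x :: "'h::chilbert"
  by (rule bounded_linear_intro[where K = "norm x"])
    (simp_all add: cinner_add_right scaleR_scaleC cinner_scaleC_right scaleR_conv_of_real
      cinner_norm_le mult.commute[of "norm _" "norm x"])

lemma tendsto_cinner:
  fixes f g :: "'a \<Rightarrow> 'h::chilbert"
  assumes "(f \<longlongrightarrow> x) F" "(g \<longlongrightarrow> y) F"
  shows "((\<lambda>n. cinner (f n) (g n)) \<longlongrightarrow> cinner x y) F"
proof -
  have "bounded_bilinear (cinner :: 'h \<Rightarrow> 'h \<Rightarrow> complex)"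
    by (standard; (simp add: cinner_add_left cinner_add_right scaleR_scaleC cinner_scaleC_left
          cinner_scaleC_right scaleR_conv_of_real)?)
      (metis cinner_norm_le mult.right_neutral)
  from bounded_bilinear.tendsto[OF this assms] show ?thesis .
qed

lemma cinner_eqI: "(\<And>z. cinner z x = cinner z y) \<Longrightarrow> x = y" for x :: "'h::chilbert"
proof -
  assume "\<And>z. cinner z x = cinner z y"
  then have "cinner (x - y) (x - y) = 0"
    by (simp add: cinner_diff_right)
  then show "x = y"
    by (simp add: cinner_self)
qed

lemma cinner_eqI': "(\<And>z. cinner x z = cinner y z) \<Longrightarrow> x = y" for x :: "'h::chilbert"
  by (rule cinner_eqI) (metis cinner_commute)

text \<open>The representing vector minimizes \<open>(norm x)\<^sup>2 - 2 Re (\<phi> x)\<close>;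
  a minimizing sequence is Cauchy by the parallelogram law.\<close>

lemma riesz_representation:
  fixes \<phi> :: "'h::chilbert \<Rightarrow> complex"
  assumes add: "\<And>x y. \<phi> (x + y) = \<phi> x + \<phi> y" and scale: "\<And>c x. \<phi> (c *\<^sub>C x) = c * \<phi> x"
    and bound: "\<And>x. cmod (\<phi> x) \<le> K * norm x"
  obtains z where "\<And>x. \<phi> x = cinner z x"
proof -
  define g where "g x = (norm x)\<^sup>2 - 2 * Re (\<phi> x)" for x
  have K: "Re (\<phi> x) \<le> K * norm x" for x
    using bound[of x] complex_Re_le_cmod[of "\<phi> x"] by linarith
  have g_ge: "g x \<ge> - K\<^sup>2" for x
  proof -
    have "0 \<le> (norm x - K)\<^sup>2"
      by simp
    then show ?thesis
      using K[of x] by (simp add: g_def power2_diff mult_ac)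
  qed
  then have bdd: "bdd_below (range g)"
    by (auto simp: bdd_below_def)
  define m where "m = (INF x. g x)"
  have m_le: "m \<le> g x" for x
    unfolding m_def by (rule cINF_lower[OF bdd]) simp
  have "\<exists>x. g x < m + 1 / real (Suc n)" for n
    using cINF_less_iff[OF _ bdd, of "m + 1 / real (Suc n)"] by (auto simp: m_def)
  then obtain X where X: "\<And>n. g (X n) < m + 1 / real (Suc n)"
    by metis
  have half: "\<phi> ((1/2) *\<^sub>R x) = \<phi> x / 2" for x
    by (simp add: scaleR_scaleC scale)
  have close: "(norm (x - y))\<^sup>2 \<le> 2 * (g x - m) + 2 * (g y - m)" for x y
  proof -
    have "(norm (x + y))\<^sup>2 = 4 * (norm ((1/2) *\<^sub>R (x + y)))\<^sup>2"
      by (simp add: power2_eq_square)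
    moreover have "m \<le> (norm ((1/2) *\<^sub>R (x + y)))\<^sup>2 - (Re (\<phi> x) + Re (\<phi> y))"
      using m_le[of "(1/2) *\<^sub>R (x + y)"]
      by (simp add: g_def half add del: scaleR_add_right) argo
    ultimately show ?thesis
      using parallelogram[of x y] by (simp add: g_def)
  qed
  have "Cauchy X"
  proof (rule metric_CauchyI)
    fix e :: real assume e: "0 < e"
    then obtain N where "inverse (real (Suc N)) < e\<^sup>2 / 4"
      using reals_Archimedean[of "e\<^sup>2 / 4"] by auto
    then have N: "4 * (1 / real (Suc N)) < e\<^sup>2"
      by (simp add: inverse_eq_divide)
    show "\<exists>M. \<forall>m\<ge>M. \<forall>n\<ge>M. dist (X m) (X n) < e"
    proof (intro exI allI impI)
      fix i j assume ij: "i \<ge> N" "j \<ge> N"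
      have "1 / real (Suc i) \<le> 1 / real (Suc N)" "1 / real (Suc j) \<le> 1 / real (Suc N)"
        using ij by (auto simp: frac_le)
      then have "(norm (X i - X j))\<^sup>2 < e\<^sup>2"
        using close[of "X i" "X j"] X[of i] X[of j] N by argo
      then show "dist (X i) (X j) < e"
        using e by (simp add: dist_norm power2_less_imp_less)
    qed
  qed
  then obtain z where z: "X \<longlonglongrightarrow> z"
    by (meson Cauchy_convergent convergent_def)
  have Re_lin: "bounded_linear (\<lambda>x. Re (\<phi> x))"
  proof (rule bounded_linear_intro[where K = K])
    show "norm (Re (\<phi> x)) \<le> norm x * K" for x
      using bound[of x] abs_Re_le_cmod[of "\<phi> x"] by (simp add: mult.commute)
  qed (simp_all add: add scaleR_scaleC scale)
  have "(\<lambda>n. g (X n)) \<longlonglongrightarrow> g z"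
    unfolding g_def by (intro tendsto_intros z bounded_linear.tendsto[OF Re_lin])
  moreover have "(\<lambda>n. g (X n)) \<longlonglongrightarrow> m"
  proof (rule tendsto_sandwich[of "\<lambda>n. m" _ _ "\<lambda>n. m + 1 / real (Suc n)"])
    show "(\<lambda>n. m + 1 / real (Suc n)) \<longlonglongrightarrow> m"
      using tendsto_add[OF tendsto_const LIMSEQ_inverse_real_of_nat, of m]
      by (simp add: inverse_eq_divide)
  qed (use m_le X in \<open>auto intro!: always_eventually less_imp_le\<close>)
  ultimately have gz: "g z = m"
    using LIMSEQ_unique by blast
  have Re_eq: "Re (\<phi> x) = Re (cinner z x)" for x
  proof -
    \<comment> \<open>\<open>2 * r\<close> is the derivative of \<open>g\<close> at \<open>z\<close>
      in the direction \<open>x\<close>; if it were nonzero, a small step against its sign would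
      take \<open>g\<close> below the minimum.\<close>
    define r where "r = Re (cinner z x) - Re (\<phi> x)"
    have *: "0 \<le> t\<^sup>2 * (norm x)\<^sup>2 + 2 * t * r" for t :: real
    proof -
      have "m \<le> g (z + t *\<^sub>R x)"
        by (rule m_le)
      also have "\<dots> = g z + t\<^sup>2 * (norm x)\<^sup>2 + 2 * t * r"
        unfolding g_def norm_add_sq add
        by (simp add: scaleR_scaleC scale cinner_scaleC_right r_def norm_scaleC power_mult_distrib
            right_diff_distrib)
      finally show ?thesis
        by (simp add: gz)
    qed
    have "r = 0"
    proof (rule ccontr)
      assume r: "r \<noteq> 0"
      \<comment> \<open>The added 1 keeps the denominator positive even for \<open>x = 0\<close>;
        the parameter \<open>- (r / s)\<close> is close to the minimizer of the quadratic in
        \<open>*\<close>.\<close>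
      define s where "s = (norm x)\<^sup>2 + 1"
      have s: "s > 0" "(norm x)\<^sup>2 < s"
        by (simp_all add: s_def add_nonneg_pos)
      have "0 \<le> (- (r / s))\<^sup>2 * (norm x)\<^sup>2 + 2 * (- (r / s)) * r"
        by (rule *)
      also have "\<dots> \<le> (- (r / s))\<^sup>2 * s + 2 * (- (r / s)) * r"
        using s by (intro add_right_mono mult_left_mono) auto
      also have "\<dots> = - (r\<^sup>2 / s)"
        using s by (simp add: field_simps power2_eq_square)
      finally have "0 \<le> - (r\<^sup>2 / s)" .
      moreover have "0 < r\<^sup>2 / s"
        using r s by simp
      ultimately show False
        by linarith
    qed
    then show ?thesis
      by (simp add: r_def)
  qed
  show thesis
  proof
    fix x
    have "Re (\<phi> (- \<i> *\<^sub>C x)) = Re (cinner z (- \<i> *\<^sub>C x))"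
      by (rule Re_eq)
    then have "Im (\<phi> x) = Im (cinner z x)"
      by (simp only: scale cinner_scaleC_right) simp
    then show "\<phi> x = cinner z x"
      using Re_eq by (simp add: complex_eq_iff)
  qed
qed

subsection \<open>Bounded operators\<close>

lemma app_add [simp]: "app T (x + y) = app T x + app T y"
  using app[of T] by (simp add: bounded_linear.linear linear_add)

lemma app_scaleC [simp]: "app T (c *\<^sub>C x) = c *\<^sub>C app T x"
  using app[of T] by simp

lemma bounded_linear_app: "bounded_linear (app T)"
  using app[of T] by simp

lemma app_zero [simp]: "app T 0 = 0"
  using bounded_linear_app by (rule linear_0[OF bounded_linear.linear])

lemma app_diff [simp]: "app T (x - y) = app T x - app T y"
  using bounded_linear_app by (rule linear_diff[OF bounded_linear.linear])

lemmas app_cop [simp] =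
  zero_cop.rep_eq one_cop.rep_eq plus_cop.rep_eq uminus_cop.rep_eq minus_cop.rep_eq
  times_cop.rep_eq scaleC_cop.rep_eq

lemma sum_app [simp]: "app (sum f S) x = (\<Sum>i\<in>S. app (f i) x)"
  by (induction S rule: infinite_finite_induct) auto

lemma cop_eqI: "(\<And>x. app S x = app T x) \<Longrightarrow> S = T"
  by (metis app_inject ext)

lemma cop_eqI_cinner: "(\<And>x y. cinner x (app S y) = cinner x (app T y)) \<Longrightarrow> S = T"
  by (blast intro: cop_eqI cinner_eqI)

text \<open>A bound with an unspecified constant passes directly through sums, products and strong
  limits; no optimal constant is ever compared.\<close>

definition op_bound :: "real \<Rightarrow> 'h::chilbert cop \<Rightarrow> bool" where
  "op_bound K T \<longleftrightarrow> (\<forall>x. norm (app T x) \<le> K * norm x)"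

lemma op_boundD: "op_bound K T \<Longrightarrow> norm (app T x) \<le> K * norm x"
  by (simp add: op_bound_def)

lemma op_bound_exists: obtains K where "K \<ge> 0" "op_bound K T"
  by (metis bounded_linear.nonneg_bounded bounded_linear_app op_bound_def mult.commute)

lemma op_bound_mult: "op_bound K S \<Longrightarrow> op_bound L T \<Longrightarrow> K \<ge> 0 \<Longrightarrow> op_bound (K * L) (S * T)"
  unfolding op_bound_def app_cop
  by (metis mult.assoc mult_left_mono order_trans)

lemma op_bound_add: "op_bound K S \<Longrightarrow> op_bound L T \<Longrightarrow> op_bound (K + L) (S + T)"
  unfolding op_bound_def app_cop
  by (metis add_mono distrib_right norm_triangle_le)

lemma op_bound_diff: "op_bound K S \<Longrightarrow> op_bound L T \<Longrightarrow> op_bound (K + L) (S - T)"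
  unfolding op_bound_def app_cop
  by (metis add_mono distrib_right norm_triangle_ineq4 order_trans)

lemma op_bound_mono: "op_bound K S \<Longrightarrow> K \<le> L \<Longrightarrow> op_bound L S"
  unfolding op_bound_def by (meson mult_right_mono norm_ge_zero order_trans)

lemma cop_of_linear:
  fixes f :: "'h::chilbert \<Rightarrow> 'h"
  assumes "\<And>x y. f (x + y) = f x + f y" "\<And>c x. f (c *\<^sub>C x) = c *\<^sub>C f x"
    and "\<And>x. norm (f x) \<le> K * norm x"
  obtains T where "app T = f" "op_bound K T"
proof -
  have "bounded_linear f"
    using assms by (intro bounded_linear_intro[where K = K]) (simp_all add: scaleR_scaleC mult.commute)
  then have "app (Cop f) = f"
    using assms by (simp add: Cop_inverse)
  then show thesis
    using that assms(3) by (metis op_bound_def)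
qed

text \<open>For fixed \<open>y\<close> the map \<open>x\<close> to \<open>cnj (G x y)\<close> is
  linear, so the Riesz theorem represents it. The lemma produces the adjoint and, later, the
  operator behind a weak cluster point.\<close>

lemma cop_of_form:
  fixes G :: "'h::chilbert \<Rightarrow> 'h \<Rightarrow> complex"
  assumes addr: "\<And>x y z. G x (y + z) = G x y + G x z"
    and addl: "\<And>x y z. G (x + y) z = G x z + G y z"
    and scr: "\<And>c x y. G x (c *\<^sub>C y) = c * G x y"
    and scl: "\<And>c x y. G (c *\<^sub>C x) y = cnj c * G x y"
    and bound: "\<And>x y. cmod (G x y) \<le> K * norm x * norm y" and K: "K \<ge> 0"
  obtains T where "\<And>x y. cinner x (app T y) = G x y" "op_bound K T"
proof -
  have "\<exists>z. \<forall>x. cnj (G x y) = cinner z x" for y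
    by (rule riesz_representation[where \<phi> = "\<lambda>x. cnj (G x y)" and K = "K * norm y"])
      (use bound[of _ y] in \<open>auto simp: addl scl mult_ac\<close>)
  then obtain f where f: "\<And>x y. cnj (G x y) = cinner (f y) x"
    by metis
  have f': "cinner x (f y) = G x y" for x y
    by (metis cinner_commute complex_cnj_cnj f)
  have norm_f: "norm (f y) \<le> K * norm y" for y
  proof (cases "f y = 0")
    case False
    have "(norm (f y))\<^sup>2 = cmod (G (f y) y)"
      by (simp add: f'[symmetric] cinner_self norm_power)
    also have "\<dots> \<le> (K * norm y) * norm (f y)"
      using bound[of "f y" y] by (simp add: mult_ac)
    finally show ?thesis
      using False by (simp add: power2_eq_square)
  qed (use K in simp)
  obtain T where "app T = f" "op_bound K T"
  proof (rule cop_of_linear[where f = f, OF _ _ norm_f])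
    show "f (x + y) = f x + f y" for x y
      by (rule cinner_eqI) (simp add: f' cinner_add_right addr)
    show "f (c *\<^sub>C x) = c *\<^sub>C f x" for c x
      by (rule cinner_eqI) (simp add: f' cinner_scaleC_right scr)
  qed
  then show thesis
    by (intro that[of T]) (simp_all add: f')
qed

subsection \<open>Adjoints\<close>

text \<open>The description in \<open>adj\<close> becomes usable only here: existence comes from the
  form \<open>cinner (app T x) y\<close>, uniqueness from the separating property of the inner
  product.\<close>

lemma adj_left: "cinner (app (adj T) x) y = cinner x (app T y)"
proof -
  obtain K where K: "K \<ge> 0" "op_bound K T"
    by (rule op_bound_exists)
  obtain S where S: "\<And>x y. cinner x (app S y) = cinner (app T x) y"
  proof (rule cop_of_form[where G = "\<lambda>x y. cinner (app T x) y" and K = K])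
    fix x y
    have "cmod (cinner (app T x) y) \<le> norm (app T x) * norm y"
      by (rule cinner_norm_le)
    also have "\<dots> \<le> K * norm x * norm y"
      by (intro mult_right_mono op_boundD K) simp
    finally show "cmod (cinner (app T x) y) \<le> K * norm x * norm y" .
  qed (simp_all add: cinner_add_left cinner_add_right cinner_scaleC_left cinner_scaleC_right K, blast)
  then have "\<forall>x y. cinner (app S x) y = cinner x (app T y)"
    by (metis cinner_commute)
  moreover have "S' = S" if "\<forall>x y. cinner (app S' x) y = cinner x (app T y)" for S'
    using that calculation by (metis cop_eqI cinner_eqI')
  ultimately have "\<forall>x y. cinner (app (adj T) x) y = cinner x (app T y)"
    unfolding adj_def by (rule theI)
  then show ?thesis
    by blast
qed

lemma adj_right: "cinner x (app (adj T) y) = cinner (app T x) y"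
  by (metis adj_left cinner_commute)

lemma adj_eqI: "(\<And>x y. cinner (app S x) y = cinner x (app T y)) \<Longrightarrow> adj T = S"
  by (rule cop_eqI, rule cinner_eqI') (simp add: adj_left)

lemma adj_adj [simp]: "adj (adj T) = T"
  by (rule adj_eqI) (simp add: adj_right)

lemma adj_mult [simp]: "adj (S * T) = adj T * adj S"
  by (rule adj_eqI) (simp add: adj_left)

lemma adj_add [simp]: "adj (S + T) = adj S + adj T"
  by (rule adj_eqI) (simp add: adj_left cinner_add_left cinner_add_right)

lemma adj_diff [simp]: "adj (S - T) = adj S - adj T"
  by (rule adj_eqI) (simp add: adj_left cinner_diff_left cinner_diff_right)

lemma adj_scaleC [simp]: "adj (c *\<^sub>C T) = cnj c *\<^sub>C adj T"
  by (rule adj_eqI) (simp add: adj_left cinner_scaleC_left cinner_scaleC_right)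

lemma adj_zero [simp]: "adj 0 = 0"
  by (rule adj_eqI) simp

lemma adj_one [simp]: "adj 1 = 1"
  by (rule adj_eqI) simp

lemma adj_sum: "adj (sum f S) = (\<Sum>i\<in>S. adj (f i))"
  by (induction S rule: infinite_finite_induct) auto

lemma op_bound_adj:
  assumes "op_bound K T" "K \<ge> 0"
  shows "op_bound K (adj T)"
  unfolding op_bound_def
proof
  fix x
  have "(norm (app (adj T) x))\<^sup>2 = Re (cinner x (app T (app (adj T) x)))"
    by (simp add: Re_cinner_self[symmetric] adj_left)
  also have "\<dots> \<le> norm x * (K * norm (app (adj T) x))"
    by (rule order_trans[OF Re_cinner_le]) (intro mult_left_mono op_boundD assms norm_ge_zero)
  finally show "norm (app (adj T) x) \<le> K * norm x"
    using assms(2) by (cases "app (adj T) x = 0") (simp_all add: power2_eq_square mult_ac)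
qed

lemma cinner_adj_mult: "cinner x (app (adj T * T) y) = cinner (app T x) (app T y)"
  by (simp add: adj_right)

lemma positive_adj_mult: "positive_op (adj T * T)"
  unfolding positive_op_def cinner_adj_mult by (simp add: cinner_self less_eq_complex_def)

lemma scaleC_cop_simps:
  fixes S T :: "'h::chilbert cop"
  shows "c *\<^sub>C (S + T) = c *\<^sub>C S + c *\<^sub>C T" "(c + d) *\<^sub>C S = c *\<^sub>C S + d *\<^sub>C S"
    "c *\<^sub>C d *\<^sub>C S = (c * d) *\<^sub>C S" "1 *\<^sub>C S = S" "0 *\<^sub>C S = 0"
    "(c *\<^sub>C S) * T = c *\<^sub>C (S * T)" "S * (c *\<^sub>C T) = c *\<^sub>C (S * T)"
    "c *\<^sub>C (S - T) = c *\<^sub>C S - c *\<^sub>C T" "(c - d) *\<^sub>C S = c *\<^sub>C S - d *\<^sub>C S"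
    "c *\<^sub>C (0 :: 'h cop) = 0" "(- 1) *\<^sub>C S = - S"
proof -
  have m: "(- 1) *\<^sub>C x = - x" for x :: 'h
    using scaleR_scaleC[of "-1" x] by simp
  have d: "(c - d) *\<^sub>C x = c *\<^sub>C x - d *\<^sub>C x" for x :: 'h
    using scaleC_add_left[of "c - d" d x] by simp
  show "(- 1) *\<^sub>C S = - S" "(c - d) *\<^sub>C S = c *\<^sub>C S - d *\<^sub>C S"
    by (rule cop_eqI, simp add: m d)+
qed (rule cop_eqI, simp add: scaleC_add_left scaleC_add_right scaleC_diff scaleC_scaleC scaleC_one
    scaleC_zero_left scaleC_zero)+

subsection \<open>Strong limits\<close>

lemma strong_lim_unique: "strong_lim X S \<Longrightarrow> strong_lim X T \<Longrightarrow> S = T"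
  unfolding strong_lim_def by (blast intro: cop_eqI LIMSEQ_unique)

lemma strong_lim_const: "strong_lim (\<lambda>n. T) T"
  by (simp add: strong_lim_def)

lemma strong_lim_add: "strong_lim X S \<Longrightarrow> strong_lim Y T \<Longrightarrow> strong_lim (\<lambda>n. X n + Y n) (S + T)"
  by (simp add: strong_lim_def tendsto_add)

lemma strong_lim_diff: "strong_lim X S \<Longrightarrow> strong_lim Y T \<Longrightarrow> strong_lim (\<lambda>n. X n - Y n) (S - T)"
  by (simp add: strong_lim_def tendsto_diff)

text \<open>Multiplication is strongly continuous only with a bounded left factor: the difference
  splits into \<open>X n\<close> applied to \<open>app (Y n) x - app T x\<close> and a term in which
  \<open>X n\<close> acts on a fixed vector.\<close>

lemma strong_lim_mult:
  assumes X: "strong_lim X S" and bound: "\<And>n. op_bound K (X n)" and Y: "strong_lim Y T"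
  shows "strong_lim (\<lambda>n. X n * Y n) (S * T)"
  unfolding strong_lim_def
proof
  fix x
  have "(\<lambda>n. norm (app (Y n) x - app T x)) \<longlonglongrightarrow> 0"
    using Y by (simp add: strong_lim_def LIM_zero tendsto_norm_zero)
  from tendsto_mult_right_zero[OF this, of K]
  have "(\<lambda>n. app (X n) (app (Y n) x - app T x)) \<longlonglongrightarrow> 0"
    by (rule Lim_null_comparison[rotated]) (intro always_eventually allI op_boundD bound)
  moreover have "(\<lambda>n. app (X n) (app T x)) \<longlonglongrightarrow> app S (app T x)"
    using X by (simp add: strong_lim_def)
  ultimately show "(\<lambda>n. app (X n * Y n) x) \<longlonglongrightarrow> app (S * T) x"
    using tendsto_add by fastforce
qed

lemma strong_lim_op_bound:
  assumes "strong_lim X T" "\<And>n. op_bound K (X n)"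
  shows "op_bound K T"
  unfolding op_bound_def
proof
  fix x
  have "(\<lambda>n. norm (app (X n) x)) \<longlonglongrightarrow> norm (app T x)"
    using assms(1) by (simp add: strong_lim_def tendsto_norm)
  then show "norm (app T x) \<le> K * norm x"
    by (rule Lim_bounded) (simp add: op_boundD assms(2))
qed

text \<open>Taking adjoints is not strongly continuous, but self-adjointness is a condition on the
  sesquilinear form and survives even weak limits.\<close>

lemma strong_lim_adj:
  assumes "strong_lim X T" "\<And>n. adj (X n) = X n"
  shows "adj T = T"
proof (rule adj_eqI)
  fix x y
  have "(\<lambda>n. cinner (app (X n) x) y) \<longlonglongrightarrow> cinner (app T x) y"
    "(\<lambda>n. cinner x (app (X n) y)) \<longlonglongrightarrow> cinner x (app T y)"
    using assms(1) by (auto simp: strong_lim_def intro!: tendsto_cinner)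
  moreover have "cinner (app (X n) x) y = cinner x (app (X n) y)" for n
    by (metis adj_left assms(2))
  ultimately show "cinner (app T x) y = cinner x (app T y)"
    by (simp add: LIMSEQ_unique)
qed

lemma strong_lim_positive:
  assumes "strong_lim X T" "\<And>n. positive_op (X n)"
  shows "positive_op T"
  unfolding positive_op_def
proof
  fix x
  have lim: "(\<lambda>n. cinner x (app (X n) x)) \<longlonglongrightarrow> cinner x (app T x)"
    using assms(1) by (auto simp: strong_lim_def intro!: tendsto_cinner)
  have "0 \<le> Re (cinner x (app (X n) x))" "Im (cinner x (app (X n) x)) = 0" for n
    using assms(2) by (auto simp: positive_op_def less_eq_complex_def)
  then show "0 \<le> cinner x (app T x)"
    using tendsto_Re[OF lim] tendsto_Im[OF lim]
    by (auto simp: less_eq_complex_def LIMSEQ_le_const LIMSEQ_const_iff)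
qed

lemma strong_lim_projection:
  assumes "strong_lim X T" "\<And>n. projection (X n)" "\<And>n. op_bound K (X n)"
  shows "projection T"
proof -
  have "strong_lim (\<lambda>n. X n * X n) (T * T)"
    by (rule strong_lim_mult[OF assms(1,3,1)])
  then have "T * T = T"
    using assms strong_lim_unique by (auto simp: projection_def)
  then show ?thesis
    using strong_lim_adj[OF assms(1)] assms(2) by (auto simp: projection_def)
qed

text \<open>Applied to a double commutant, this makes both the algebra and the masa strongly
  closed.\<close>

lemma strong_lim_commutant:
  assumes "strong_lim X T" "\<And>n. X n \<in> commutant S"
  shows "T \<in> commutant S"
  unfolding commutant_def mem_Collect_eq
proof (intro ballI cop_eqI)
  fix s x assume s: "s \<in> S"
  have "(\<lambda>n. app (X n) (app s x)) \<longlonglongrightarrow> app T (app s x)"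
    using assms(1) by (simp add: strong_lim_def)
  moreover have "(\<lambda>n. app s (app (X n) x)) \<longlonglongrightarrow> app s (app T x)"
    by (rule bounded_linear.tendsto[OF bounded_linear_app])
      (use assms(1) in \<open>simp add: strong_lim_def\<close>)
  moreover have "app (X n) (app s x) = app s (app (X n) x)" for n
    using assms(2)[of n] s by (metis (mono_tags, lifting) commutant_def mem_Collect_eq times_cop.rep_eq)
  ultimately show "app (T * s) x = app (s * T) x"
    by (simp add: LIMSEQ_unique)
qed

lemma strong_lim_Suc: "strong_lim X T \<longleftrightarrow> strong_lim (\<lambda>n. X (Suc n)) T"
  by (simp add: strong_lim_def filterlim_sequentially_Suc[of "\<lambda>n. app (X n) x" for x])

subsection \<open>Normal functionals and traces\<close>

text \<open>On a bounded family the series defining the functional is dominated uniformly in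
  \<open>n\<close>, so Tannery's theorem makes termwise, that is weak, convergence enough. General
  filters are allowed because the compactness argument below produces limits along a filter finer
  than \<open>sequentially\<close>.\<close>

lemma normal_functional_tendsto:
  assumes \<phi>: "normal_functional M \<phi>" and M: "\<And>n. X n \<in> M" "T \<in> M"
    and bound: "\<And>n. op_bound K (X n)" and F: "F \<noteq> bot"
    and lim: "\<And>x y. ((\<lambda>n. cinner x (app (X n) y)) \<longlongrightarrow> cinner x (app T y)) F"
  shows "((\<lambda>n. \<phi> (X n)) \<longlongrightarrow> \<phi> T) F"
proof -
  obtain \<xi> \<eta> where sm: "summable (\<lambda>i. (norm (\<xi> i))\<^sup>2)" "summable (\<lambda>i. (norm (\<eta> i))\<^sup>2)"
    and sums: "\<And>S. S \<in> M \<Longrightarrow> (\<lambda>i. cinner (\<xi> i) (app S (\<eta> i))) sums \<phi> S"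
    using \<phi> unfolding normal_functional_def by auto
  define L where "L = max K 0"
  have L: "L \<ge> 0" "op_bound L (X n)" for n
    using bound[of n] by (auto simp: L_def intro: op_bound_mono)
  have "cmod (cinner (\<xi> i) (app (X n) (\<eta> i))) \<le> L * ((norm (\<xi> i))\<^sup>2 + (norm (\<eta> i))\<^sup>2)" for i n
  proof -
    have "cmod (cinner (\<xi> i) (app (X n) (\<eta> i))) \<le> norm (\<xi> i) * (L * norm (\<eta> i))"
      by (rule order_trans[OF cinner_norm_le]) (intro mult_left_mono op_boundD L norm_ge_zero)
    also have "\<dots> = L * (norm (\<xi> i) * norm (\<eta> i))"
      by simp
    also have "norm (\<xi> i) * norm (\<eta> i) \<le> (norm (\<xi> i))\<^sup>2 + (norm (\<eta> i))\<^sup>2"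
      using sum_squares_bound[of "norm (\<xi> i)" "norm (\<eta> i)"]
        mult_nonneg_nonneg[OF norm_ge_zero[of "\<xi> i"] norm_ge_zero[of "\<eta> i"]] by linarith
    finally show ?thesis
      using L(1) mult_left_mono by blast
  qed
  then have "((\<lambda>n. \<Sum>i. cinner (\<xi> i) (app (X n) (\<eta> i))) \<longlongrightarrow> (\<Sum>i. cinner (\<xi> i) (app T (\<eta> i)))) F"
    by (intro tannerys_theorem[where M = "\<lambda>i. L * ((norm (\<xi> i))\<^sup>2 + (norm (\<eta> i))\<^sup>2)",
          THEN conjunct2, THEN conjunct2] lim F
        summable_mult summable_add sm) (auto intro!: always_eventually)
  then show ?thesis
    using sums[OF M(1)] sums[OF M(2)] by (simp add: sums_iff)
qed

locale tracial_algebra =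
  fixes M :: "'h::chilbert cop set" and \<tau> :: "'h cop \<Rightarrow> complex"
  assumes vn: "von_neumann_algebra M" and trace: "faithful_normal_trace M \<tau>"
begin

lemma M_zero [simp]: "0 \<in> M" and M_add [simp]: "S \<in> M \<Longrightarrow> T \<in> M \<Longrightarrow> S + T \<in> M"
  and M_mult [simp]: "S \<in> M \<Longrightarrow> T \<in> M \<Longrightarrow> S * T \<in> M"
  and M_scaleC [simp]: "T \<in> M \<Longrightarrow> c *\<^sub>C T \<in> M" and M_adj [simp]: "T \<in> M \<Longrightarrow> adj T \<in> M"
  using vn unfolding von_neumann_algebra_def star_subalgebra_def by auto

lemma M_commutant: "commutant (commutant M) = M"
  using vn unfolding von_neumann_algebra_def by auto

text \<open>The unit is not among the closure conditions of \<open>star_subalgebra\<close>; it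
  enters because every commutant contains it.\<close>

lemma M_one [simp]: "1 \<in> M"
  by (subst M_commutant[symmetric]) (simp add: commutant_def)

lemma M_diff [simp]: "S \<in> M \<Longrightarrow> T \<in> M \<Longrightarrow> S - T \<in> M"
  using M_add[of S "(- 1) *\<^sub>C T"] M_scaleC[of T "- 1"]
  by (simp add: scaleC_cop_simps del: M_add M_scaleC)

lemma M_sum [simp]: "(\<And>i. i \<in> I \<Longrightarrow> f i \<in> M) \<Longrightarrow> sum f I \<in> M"
  by (induction I rule: infinite_finite_induct) auto

lemma M_strong_lim: "strong_lim X T \<Longrightarrow> (\<And>n. X n \<in> M) \<Longrightarrow> T \<in> M"
  using strong_lim_commutant[of X T "commutant M"] by (simp add: M_commutant)

lemma trace_add: "S \<in> M \<Longrightarrow> T \<in> M \<Longrightarrow> \<tau> (S + T) = \<tau> S + \<tau> T"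
  using trace unfolding faithful_normal_trace_def by simp

lemma trace_scaleC: "T \<in> M \<Longrightarrow> \<tau> (c *\<^sub>C T) = c * \<tau> T"
  using trace unfolding faithful_normal_trace_def by simp

lemma trace_positive: "T \<in> M \<Longrightarrow> positive_op T \<Longrightarrow> 0 \<le> \<tau> T"
  using trace unfolding faithful_normal_trace_def by simp

lemma trace_commute: "S \<in> M \<Longrightarrow> T \<in> M \<Longrightarrow> \<tau> (S * T) = \<tau> (T * S)"
  using trace unfolding faithful_normal_trace_def by simp

lemma trace_one: "\<tau> 1 = 1"
  using trace unfolding faithful_normal_trace_def by simp

lemma trace_faithful: "T \<in> M \<Longrightarrow> positive_op T \<Longrightarrow> \<tau> T = 0 \<Longrightarrow> T = 0"
  using trace unfolding faithful_normal_trace_def by simp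

lemma trace_normal: "normal_functional M \<tau>"
  using trace unfolding faithful_normal_trace_def by simp

lemma trace_zero: "\<tau> 0 = 0"
  using trace_scaleC[of 0 0] by (simp add: scaleC_cop_simps)

lemma trace_diff: "S \<in> M \<Longrightarrow> T \<in> M \<Longrightarrow> \<tau> (S - T) = \<tau> S - \<tau> T"
  using trace_add[of S "(- 1) *\<^sub>C T"] trace_scaleC[of T "-1"] M_scaleC[of T "- 1"]
  by (simp add: scaleC_cop_simps del: M_add M_scaleC)

lemma trace_sum: "(\<And>i. i \<in> I \<Longrightarrow> f i \<in> M) \<Longrightarrow> \<tau> (sum f I) = (\<Sum>i\<in>I. \<tau> (f i))"
  by (induction I rule: infinite_finite_induct) (auto simp: trace_add trace_zero)

lemma trace_strong_lim:
  assumes "strong_lim X T" "\<And>n. X n \<in> M" "\<And>n. op_bound K (X n)"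
  shows "(\<lambda>n. \<tau> (X n)) \<longlonglongrightarrow> \<tau> T"
  using assms(1) M_strong_lim[OF assms(1,2)]
  by (intro normal_functional_tendsto[OF trace_normal _ _ assms(3)] assms(2) tendsto_cinner)
    (auto simp: strong_lim_def)

lemma trace_adj_mult_nonneg: "T \<in> M \<Longrightarrow> 0 \<le> \<tau> (adj T * T)"
  by (simp add: trace_positive positive_adj_mult)

lemma norm2_sq: "T \<in> M \<Longrightarrow> (norm2 \<tau> T)\<^sup>2 = Re (\<tau> (adj T * T))"
  using trace_adj_mult_nonneg[of T] by (simp add: norm2_def less_eq_complex_def)

lemma norm2_sq': "T \<in> M \<Longrightarrow> complex_of_real ((norm2 \<tau> T)\<^sup>2) = \<tau> (adj T * T)"
  using trace_adj_mult_nonneg[of T] norm2_sq[of T] by (simp add: complex_eq_iff less_eq_complex_def)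

lemma norm2_nonneg: "T \<in> M \<Longrightarrow> 0 \<le> norm2 \<tau> T"
  using trace_adj_mult_nonneg[of T] by (simp add: norm2_def less_eq_complex_def)

lemma adj_mult_eq_zero: "adj T * T = 0 \<Longrightarrow> T = 0"
proof (rule cop_eqI)
  fix x assume "adj T * T = 0"
  then have "cinner (app T x) (app T x) = 0"
    using cinner_adj_mult[of x T x] by simp
  then show "app T x = app 0 x"
    by (simp add: cinner_self)
qed

lemma norm2_eq_zero:
  assumes "T \<in> M" "norm2 \<tau> T = 0"
  shows "T = 0"
proof (rule adj_mult_eq_zero, rule trace_faithful)
  show "\<tau> (adj T * T) = 0"
    unfolding norm2_sq'[OF assms(1), symmetric] by (simp add: assms(2))
qed (use assms in \<open>simp_all add: positive_adj_mult\<close>)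

lemma norm2_zero: "norm2 \<tau> 0 = 0"
  by (simp add: norm2_def trace_zero)

text \<open>With \<open>s\<close> and \<open>t\<close> the two norms, positivity of the trace at
  \<open>t S - s T\<close> bounds the cross term by \<open>2 * s * t\<close>. The case of a zero
  norm is separate because \<open>s * t\<close> is cancelled.\<close>

lemma norm2_triangle:
  assumes M: "S \<in> M" "T \<in> M"
  shows "norm2 \<tau> (S + T) \<le> norm2 \<tau> S + norm2 \<tau> T"
proof (cases "norm2 \<tau> S = 0 \<or> norm2 \<tau> T = 0")
  case True
  then have "S = 0 \<or> T = 0"
    using norm2_eq_zero[OF M(1)] norm2_eq_zero[OF M(2)] by auto
  then show ?thesis
    by (auto simp: norm2_zero norm2_nonneg M)
next
  case False
  define s t where "s = norm2 \<tau> S" and "t = norm2 \<tau> T"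
  have st: "s > 0" "t > 0"
    using False norm2_nonneg M by (auto simp: s_def t_def less_le)
  define X where "X = Re (\<tau> (adj S * T)) + Re (\<tau> (adj T * S))"
  let ?D = "complex_of_real t *\<^sub>C S - complex_of_real s *\<^sub>C T"
  have "0 \<le> Re (\<tau> (adj ?D * ?D))"
    using trace_adj_mult_nonneg[of ?D] M by (simp add: less_eq_complex_def)
  also have "adj ?D * ?D = complex_of_real (t * t) *\<^sub>C (adj S * S) + complex_of_real (s * s) *\<^sub>C (adj T * T)
      - complex_of_real (s * t) *\<^sub>C (adj S * T) - complex_of_real (s * t) *\<^sub>C (adj T * S)"
    by (simp add: left_diff_distrib right_diff_distrib scaleC_cop_simps
        mult.commute[of "complex_of_real t" "complex_of_real s"])
  also have "\<tau> \<dots> = complex_of_real (t * t) * complex_of_real (s\<^sup>2)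
      + complex_of_real (s * s) * complex_of_real (t\<^sup>2)
      - complex_of_real (s * t) * \<tau> (adj S * T) - complex_of_real (s * t) * \<tau> (adj T * S)"
    unfolding s_def t_def using M
    by (simp add: trace_add trace_diff trace_scaleC norm2_sq' del: of_real_mult of_real_power)
  also have "Re \<dots> = (t * t) * s\<^sup>2 + (s * s) * t\<^sup>2 - s * t * X"
    unfolding X_def distrib_left by simp
  finally have "s * t * X \<le> s * t * (2 * s * t)"
    by (simp add: power2_eq_square mult_ac)
  then have X: "X \<le> 2 * s * t"
    using st by simp
  have "adj (S + T) * (S + T) = adj S * S + adj T * T + adj S * T + adj T * S"
    by (simp add: distrib_left distrib_right)
  then have "(norm2 \<tau> (S + T))\<^sup>2 = s\<^sup>2 + t\<^sup>2 + X"
    unfolding norm2_sq[OF M_add[OF M]] s_def t_def X_def using M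
    by (simp add: norm2_sq trace_add del: adj_add)
  also have "\<dots> \<le> (s + t)\<^sup>2"
    using X by (simp add: power2_sum)
  finally have "norm2 \<tau> (S + T) \<le> s + t"
    by (rule power2_le_imp_le) (use st in simp)
  then show ?thesis
    by (simp add: s_def t_def)
qed

text \<open>If the claim failed, a sequence of positive contractions with vanishing traces would have a
  nonzero weak cluster point, by Tychonoff's theorem applied to its sesquilinear forms. The trace
  of that cluster point vanishes by normality, which contradicts faithfulness.\<close>

lemma small_trace:
  fixes x :: 'h
  assumes K: "K \<ge> 0" and e: "e > 0"
  obtains d where "d > 0"
    "\<And>T. T \<in> M \<Longrightarrow> positive_op T \<Longrightarrow> op_bound K T \<Longrightarrow> Re (\<tau> T) < d \<Longrightarrow> Re (cinner x (app T x)) < e"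
proof (rule ccontr)
  assume "\<not> thesis"
  then have "\<forall>d>0. \<exists>T. T \<in> M \<and> positive_op T \<and> op_bound K T \<and> Re (\<tau> T) < d \<and> e \<le> Re (cinner x (app T x))"
    using that by (meson not_less)
  then have "\<forall>n. \<exists>T. T \<in> M \<and> positive_op T \<and> op_bound K T \<and> Re (\<tau> T) < 1 / real (Suc n)
      \<and> e \<le> Re (cinner x (app T x))"
    by (metis of_nat_0_less_iff zero_less_Suc zero_less_divide_1_iff)
  then obtain X where X: "\<And>n. X n \<in> M" "\<And>n. positive_op (X n)" "\<And>n. op_bound K (X n)"
    "\<And>n. Re (\<tau> (X n)) < 1 / real (Suc n)" "\<And>n. e \<le> Re (cinner x (app (X n) x))"
    by metis
  define f where "f n = (\<lambda>(y, z). cinner y (app (X n) z))" for n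
  \<comment> \<open>The forms of operators bounded by \<open>K\<close> lie in this product of closed
    discs, indexed by pairs of vectors.\<close>
  define U where "U = PiE UNIV (\<lambda>(y :: 'h, z :: 'h). cball (0 :: complex) (norm y * (K * norm z)))"
  have "compactin euclidean U"
    unfolding U_def euclidean_product_topology[symmetric] compactin_PiE by auto
  then have "compact U"
    by simp
  moreover have "f n \<in> U" for n
    unfolding U_def f_def
    by (auto simp: intro!: order_trans[OF cinner_norm_le] mult_left_mono op_boundD X)
  then have "eventually (\<lambda>g. g \<in> U) (filtermap f sequentially)"
    by (simp add: eventually_filtermap)
  ultimately obtain g where g: "g \<in> U" "inf (nhds g) (filtermap f sequentially) \<noteq> bot"
    by (metis compact_filter filtermap_bot_iff sequentially_bot)
  \<comment> \<open>The cluster point becomes an honest limit: \<open>N\<close> refines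
    \<open>sequentially\<close> by the demand that \<open>f n\<close> be near \<open>g\<close>.
    Every limit below is taken along \<open>N\<close>.\<close>
  define N where "N = inf sequentially (filtercomap f (nhds g))"
  have N: "N \<noteq> bot"
  proof
    assume "N = bot"
    then have "eventually (\<lambda>_. False) N"
      by simp
    then obtain P R where "eventually P sequentially" "eventually R (nhds g)" "\<And>n. P n \<Longrightarrow> \<not> R (f n)"
      unfolding N_def eventually_inf eventually_filtercomap by blast
    then have "eventually (\<lambda>_. False) (inf (nhds g) (filtermap f sequentially))"
      unfolding eventually_inf eventually_filtermap
      by (intro exI[of _ R] exI[of _ "\<lambda>h. \<not> R h"]) (auto elim: eventually_mono)
    then show False
      using g(2) by (simp add: trivial_limit_def)
  qed
  have "(f \<longlongrightarrow> g) N"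
    unfolding N_def by (rule tendsto_mono[OF inf_le2 filterlim_filtercomap])
  then have lim: "((\<lambda>n. cinner y (app (X n) z)) \<longlongrightarrow> g (y, z)) N" for y z
    using continuous_on_tendsto_compose[OF continuous_on_product_coordinates[of "(y, z)"], of f g N]
    by (simp add: f_def)
  obtain T where T: "\<And>y z. cinner y (app T z) = g (y, z)" "op_bound K T"
  proof (rule cop_of_form[where G = "\<lambda>y z. g (y, z)" and K = K])
    fix y z w :: 'h and c :: complex
    show "g (y, z + w) = g (y, z) + g (y, w)"
      by (rule tendsto_unique[OF N lim]) (simp add: cinner_add_right tendsto_add lim)
    show "g (y + z, w) = g (y, w) + g (z, w)"
      by (rule tendsto_unique[OF N lim]) (simp add: cinner_add_left tendsto_add lim)
    show "g (y, c *\<^sub>C z) = c * g (y, z)"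
      by (rule tendsto_unique[OF N lim]) (simp add: cinner_scaleC_right tendsto_mult lim)
    show "g (c *\<^sub>C y, z) = cnj c * g (y, z)"
      by (rule tendsto_unique[OF N lim]) (simp add: cinner_scaleC_left tendsto_mult lim)
    show "cmod (g (y, z)) \<le> K * norm y * norm z"
      using g(1) by (auto simp: U_def PiE_iff split_paired_all mult_ac)
  qed (use K in \<open>auto\<close>)
  have limT: "((\<lambda>n. cinner y (app (X n) z)) \<longlongrightarrow> cinner y (app T z)) N" for y z
    using lim T by simp
  \<comment> \<open>Commuting with a fixed operator is preserved by weak limits once that operator
    is moved to the other side as its adjoint.\<close>
  have "T \<in> commutant (commutant M)"
    unfolding commutant_def[of "commutant M"] mem_Collect_eq
  proof (intro ballI cop_eqI_cinner)
    fix s y z assume s: "s \<in> commutant M"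
    have "cinner y (app (X n) (app s z)) = cinner (app (adj s) y) (app (X n) z)" for n
    proof -
      have "app (X n) (app s z) = app s (app (X n) z)"
        using s X(1)[of n] unfolding commutant_def by (metis (mono_tags, lifting) mem_Collect_eq times_cop.rep_eq)
      then show ?thesis
        by (simp add: adj_left)
    qed
    then have "cinner y (app T (app s z)) = cinner (app (adj s) y) (app T z)"
      using tendsto_unique[OF N limT[of y "app s z"]] limT[of "app (adj s) y" z] by simp
    then show "cinner y (app (T * s) z) = cinner y (app (s * T) z)"
      by (simp add: adj_left)
  qed
  then have TM: "T \<in> M"
    by (simp add: M_commutant)
  have Im_lim: "Im (cinner y (app T y)) = 0" for y
  proof (rule tendsto_unique[OF N tendsto_Im[OF limT]])
    have "Im (cinner y (app (X n) y)) = 0" for n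
      using X(2)[of n] by (auto simp: positive_op_def less_eq_complex_def)
    then show "((\<lambda>n. Im (cinner y (app (X n) y))) \<longlongrightarrow> 0) N"
      by simp
  qed
  have "0 \<le> Re (cinner y (app T y))" for y
    by (rule tendsto_lowerbound[OF tendsto_Re[OF limT] _ N])
      (use X(2) in \<open>auto simp: positive_op_def less_eq_complex_def intro!: always_eventually\<close>)
  then have pos: "positive_op T"
    by (simp add: positive_op_def less_eq_complex_def Im_lim)
  have "((\<lambda>n. \<tau> (X n)) \<longlongrightarrow> \<tau> T) N"
    by (rule normal_functional_tendsto[OF trace_normal X(1) TM X(3) N limT])
  moreover have "((\<lambda>n. \<tau> (X n)) \<longlongrightarrow> 0) sequentially"
  proof (rule Lim_null_comparison[OF _ LIMSEQ_inverse_real_of_nat])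
    have "norm (\<tau> (X n)) \<le> inverse (real (Suc n))" for n
      using trace_positive[OF X(1,2), of n] X(4)[of n]
      by (simp add: less_eq_complex_def cmod_eq_Re inverse_eq_divide)
    then show "\<forall>\<^sub>F n in sequentially. norm (\<tau> (X n)) \<le> inverse (real (Suc n))"
      by simp
  qed
  then have "((\<lambda>n. \<tau> (X n)) \<longlongrightarrow> 0) N"
    unfolding N_def by (rule tendsto_mono[OF inf_le1])
  ultimately have "\<tau> T = 0"
    using tendsto_unique[OF N] by blast
  then have "T = 0"
    using TM pos trace_faithful by blast
  moreover have "e \<le> Re (cinner x (app T x))"
    by (rule tendsto_lowerbound[OF tendsto_Re[OF limT] _ N]) (use X(5) in auto)
  ultimately show False
    using e by simp
qed

text \<open>The quadratic form of \<open>adj T * T\<close> at \<open>x\<close> is the squared norm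
  of \<open>app T x\<close>, and its trace is the squared trace norm; this upgrades weak smallness
  to strong smallness.\<close>

lemma small_norm2:
  fixes x :: 'h
  assumes K: "K \<ge> 0" and e: "e > 0"
  obtains d where "d > 0"
    "\<And>T. T \<in> M \<Longrightarrow> op_bound K T \<Longrightarrow> norm2 \<tau> T < d \<Longrightarrow> norm (app T x) < e"
proof -
  obtain d where d: "d > 0" "\<And>T. T \<in> M \<Longrightarrow> positive_op T \<Longrightarrow> op_bound (K * K) T \<Longrightarrow>
      Re (\<tau> T) < d \<Longrightarrow> Re (cinner x (app T x)) < e\<^sup>2"
    using small_trace[of "K * K" "e\<^sup>2" x] K e by auto
  show thesis
  proof (rule that[of "sqrt d"])
    fix T assume T: "T \<in> M" "op_bound K T" "norm2 \<tau> T < sqrt d"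
    have "Re (\<tau> (adj T * T)) < d"
      using T(3) by (simp add: norm2_def)
    then have "Re (cinner x (app (adj T * T) x)) < e\<^sup>2"
      using T K by (intro d) (auto simp: positive_adj_mult intro!: op_bound_mult op_bound_adj)
    then show "norm (app T x) < e"
      unfolding cinner_adj_mult Re_cinner_self using e by (simp add: power2_less_imp_less)
  qed (use d in simp)
qed

lemma strong_lim_of_norm2:
  assumes M: "\<And>n. X n \<in> M" "T \<in> M" and bound: "\<And>n. op_bound K (X n - T)" and K: "K \<ge> 0"
    and lim: "(\<lambda>n. norm2 \<tau> (X n - T)) \<longlonglongrightarrow> 0"
  shows "strong_lim X T"
  unfolding strong_lim_def
proof (intro allI LIMSEQ_I)
  fix x and e :: real assume e: "0 < e"
  obtain d where d: "d > 0"
    "\<And>T. T \<in> M \<Longrightarrow> op_bound K T \<Longrightarrow> norm2 \<tau> T < d \<Longrightarrow> norm (app T x) < e"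
    by (rule small_norm2[OF K e, where x = x]) (rule that)
  obtain N where "\<forall>n\<ge>N. \<bar>norm2 \<tau> (X n - T)\<bar> < d"
    using LIMSEQ_D[OF lim d(1)] by auto
  then have "\<forall>n\<ge>N. norm (app (X n - T) x) < e"
    using d(2)[OF M_diff[OF M] bound] abs_less_iff by blast
  then show "\<exists>N. \<forall>n\<ge>N. norm (app (X n) x - app T x) < e"
    by auto
qed

text \<open>Completeness of operator-norm balls in the trace norm. The common bound \<open>K\<close>
  is essential: without it a trace-norm limit need not be a bounded operator.\<close>

lemma strong_lim_of_norm2_Cauchy:
  assumes M: "\<And>n. X n \<in> M" and bound: "\<And>n. op_bound K (X n)" and K: "K \<ge> 0"
    and Cauchy: "\<And>e. e > 0 \<Longrightarrow> \<exists>N. \<forall>m\<ge>N. \<forall>n\<ge>m. norm2 \<tau> (X n - X m) < e"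
  obtains T where "T \<in> M" "op_bound K T" "strong_lim X T"
proof -
  have "convergent (\<lambda>n. app (X n) x)" for x
  proof (rule Cauchy_convergent, rule CauchyI')
    fix e :: real assume "0 < e"
    then obtain d where d: "d > 0" "\<And>T. T \<in> M \<Longrightarrow> op_bound (K + K) T \<Longrightarrow> norm2 \<tau> T < d \<Longrightarrow> norm (app T x) < e"
      using small_norm2[of "K + K" e x] K by auto
    obtain N where N: "\<And>m n. m \<ge> N \<Longrightarrow> n \<ge> m \<Longrightarrow> norm2 \<tau> (X n - X m) < d"
      using Cauchy[OF d(1)] by blast
    have "norm (app (X n - X m) x) < e" if "m \<ge> N" "n \<ge> m" for m n
      by (rule d(2)[OF M_diff[OF M M] op_bound_diff[OF bound bound] N[OF that]])
    then show "\<exists>N. \<forall>m\<ge>N. \<forall>n>m. dist (app (X m) x) (app (X n) x) < e"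
      by (auto simp: dist_norm norm_minus_commute intro!: exI[of _ N])
  qed
  then obtain f where f: "\<And>x. (\<lambda>n. app (X n) x) \<longlonglongrightarrow> f x"
    unfolding convergent_def by metis
  obtain T where T: "app T = f" "op_bound K T"
  proof (rule cop_of_linear[of f K])
    show "f (x + y) = f x + f y" for x y
      by (rule LIMSEQ_unique[OF f]) (simp add: tendsto_add f)
    show "f (c *\<^sub>C x) = c *\<^sub>C f x" for c x
      by (rule LIMSEQ_unique[OF f]) (simp add: bounded_linear.tendsto[OF bounded_linear_scaleC] f)
    show "norm (f x) \<le> K * norm x" for x
      by (rule Lim_bounded[OF tendsto_norm[OF f]]) (simp add: op_boundD bound)
  qed
  then have "strong_lim X T"
    by (simp add: strong_lim_def f)
  then show thesis
    using that T M M_strong_lim by blast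
qed

end

subsection \<open>The matrix iteration\<close>

text \<open>Cuts sums over matrix indices into blocks: \<open>n = 2\<close> for the blocks of
  \<open>blk\<close>, \<open>n = 4\<close> for those of \<open>Wmat\<close>.\<close>

lemma sum_lessThan_times:
  fixes g :: "nat \<Rightarrow> 'a::comm_monoid_add"
  shows "(\<Sum>i<m * n. g i) = (\<Sum>q<m. \<Sum>r<n. g (n * q + r))"
proof (induction m)
  case (Suc m)
  have "(\<Sum>i<Suc m * n. g i) = (\<Sum>i<m * n. g i) + (\<Sum>i=m * n..<m * n + n. g i)"
    by (simp add: lessThan_atLeast0 sum.atLeastLessThan_concat add.commute)
  also have "(\<Sum>i=m * n..<m * n + n. g i) = (\<Sum>r<n. g (n * m + r))"
    using sum.shift_bounds_nat_ivl[of g 0 "m * n" n]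
    by (simp add: lessThan_atLeast0 add.commute mult.commute)
  finally show ?case
    using Suc by simp
qed simp

lemma sum_lessThan_4: "(\<Sum>i<4. g i) = g 0 + g 1 + g 2 + g (3::nat)"
  for g :: "nat \<Rightarrow> 'a::comm_monoid_add"
  by (simp add: eval_nat_numeral)

lemma sum_lessThan_2: "(\<Sum>i<2. g i) = g 0 + g (1::nat)"
  for g :: "nat \<Rightarrow> 'a::comm_monoid_add"
  by (simp add: eval_nat_numeral)

lemma less_4_cases: "r < 4 \<longleftrightarrow> r = 0 \<or> r = 1 \<or> r = 2 \<or> r = (3::nat)"
  by auto

lemma sum_block:
  fixes g :: "nat \<Rightarrow> 'a::comm_monoid_add"
  assumes "q < m"
  shows "(\<Sum>l<m * 4. if l div 4 = q then g l else 0) = (\<Sum>s<4. g (4 * q + s))"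
proof -
  have "(\<Sum>s<4. if (4 * q' + s) div 4 = q then g (4 * q' + s) else 0)
      = (if q' = q then (\<Sum>s<4. g (4 * q' + s)) else 0)" for q'
    by (auto intro!: sum.neutral sum.cong)
  then show ?thesis
    using assms by (simp add: sum_lessThan_times sum.delta)
qed

lemma mat_adjoint_carrier [simp]: "A \<in> carrier_mat m n \<Longrightarrow> mat_adjoint A \<in> carrier_mat n m"
  unfolding mat_adjoint_def by auto

lemma mat_adjoint_index [simp]:
  fixes A :: "complex mat"
  assumes "A \<in> carrier_mat m n" "i < n" "j < m"
  shows "mat_adjoint A $$ (i, j) = cnj (A $$ (j, i))"
  using assms by (simp add: mat_adjoint_def mat_of_rows_def)

lemma tensor_carrier [simp]:
  "A \<in> carrier_mat m n \<Longrightarrow> B \<in> carrier_mat m' n' \<Longrightarrow> tensor A B \<in> carrier_mat (m * m') (n * n')"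
  by (auto simp: tensor_def)

lemma tensor_one_index:
  assumes "C \<in> carrier_mat m m" "i < 2 * m" "j < 2 * m"
  shows "tensor (1\<^sub>m 2) C $$ (i, j) = (if i mod 2 = j mod 2 then C $$ (i div 2, j div 2) else 0)"
  using assms by (auto simp: tensor_def)

lemma mat_mult_index:
  assumes "A \<in> carrier_mat l m" "B \<in> carrier_mat m n" "i < l" "j < n"
  shows "(A * B) $$ (i, j) = (\<Sum>r<m. A $$ (i, r) * B $$ (r, j))"
  using assms by (auto simp: scalar_prod_def lessThan_atLeast0 intro!: sum.cong)

lemma Wmat_carrier: "n \<ge> 1 \<Longrightarrow> Wmat n \<in> carrier_mat (2 ^ Suc n) (2 ^ Suc n)"
proof (induction n rule: nat_induct_at_least)
  case (Suc n)
  then obtain n' where "n = Suc n'"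
    by (cases n) auto
  with Suc show ?case
    using tensor_carrier[of "Wmat n" "2 ^ Suc n" "2 ^ Suc n" "1\<^sub>m 2" 2 2] by (simp add: mult.commute)
next
  case base
  show ?case
    by (rule carrier_matI) (simp_all add: mat_of_rows_list_def)
qed

lemma Wmat_index:
  "n \<ge> 1 \<Longrightarrow> i < 2 ^ Suc n \<Longrightarrow> j < 2 ^ Suc n \<Longrightarrow>
    Wmat n $$ (i, j) = (if i div 4 = j div 4 then Wmat 1 $$ (i mod 4, j mod 4) else 0)"
proof (induction n arbitrary: i j rule: nat_induct_at_least)
  case (Suc n)
  then obtain n' where n': "n = Suc n'"
    by (cases n) auto
  define e :: nat where "e = 2 ^ n'"
  have e: "e > 0" "2 ^ Suc n = 4 * e"
    by (simp_all add: e_def n')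
  have W: "Wmat (Suc n) = tensor (Wmat n) (1\<^sub>m 2)"
    by (simp add: n')
  have dims: "dim_row (Wmat n) = 4 * e" "dim_col (Wmat n) = 4 * e"
    using Wmat_carrier[of n] Suc.hyps e(2) by auto
  have ij: "i < 4 * e * 2" "j < 4 * e * 2"
    using Suc.prems e(2) by simp_all
  have IH: "Wmat n $$ (i mod (4 * e), j mod (4 * e)) =
      (if i mod (4 * e) div 4 = j mod (4 * e) div 4 then Wmat 1 $$ (i mod (4 * e) mod 4, j mod (4 * e) mod 4) else 0)"
    using e by (intro Suc.IH) simp_all
  have mod: "x mod (4 * e) div 4 = x div 4 mod e" "x mod (4 * e) mod 4 = x mod 4" for x
    by (simp_all add: mod_mult2_eq)
  have div_lt: "i div (4 * e) < 2" "j div (4 * e) < 2"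
    using ij by (auto simp: less_mult_imp_div_less mult.commute)
  \<comment> \<open>Tensoring with the identity on the right splits off the leading digit
    \<open>i div (4 * e)\<close> of an index; together with \<open>i div 4 mod e\<close> it
    determines the block number \<open>i div 4\<close>.\<close>
  have eq: "i div (4 * e) = j div (4 * e) \<and> i div 4 mod e = j div 4 mod e \<longleftrightarrow> i div 4 = j div 4"
    unfolding div_mult2_eq by (metis div_mult_mod_eq)
  show ?case
    unfolding W tensor_def using ij div_lt
    by (simp only: dims index_mat IH index_one_mat dim_row_mat prod.case index_one_mat(2,3) mod) (use eq in auto)
qed simp

section \<open>One rotation step, read off in 4 by 4 blocks\<close>

definition rot_step :: "nat \<Rightarrow> complex mat \<Rightarrow> complex mat" where
  "rot_step N C = Wmat N * tensor (1\<^sub>m 2) C * mat_adjoint (Wmat N)"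

definition blk :: "complex mat \<Rightarrow> nat \<Rightarrow> nat \<Rightarrow> nat \<Rightarrow> nat \<Rightarrow> complex" where
  "blk C q q' t t' = C $$ (2 * q + t, 2 * q' + t')"

definition inv_sqrt2 :: complex where
  "inv_sqrt2 = complex_of_real (1 / sqrt 2)"

lemma Wmat_1_index:
  assumes "r < 4" "s < 4"
  shows "Wmat 1 $$ (r, s) =
    [[1, 0, 0, 0],
     [0, inv_sqrt2, - inv_sqrt2, 0],
     [0, inv_sqrt2, inv_sqrt2, 0],
     [0, 0, 0, 1]] ! r ! s"
  using assms by (simp add: mat_of_rows_list_def inv_sqrt2_def)

lemma Wmat_1_table:
  "Wmat 1 $$ (0, 0) = 1" "Wmat 1 $$ (0, 1) = 0" "Wmat 1 $$ (0, 2) = 0" "Wmat 1 $$ (0, 3) = 0"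
  "Wmat 1 $$ (1, 0) = 0" "Wmat 1 $$ (1, 1) = inv_sqrt2" "Wmat 1 $$ (1, 2) = - inv_sqrt2" "Wmat 1 $$ (1, 3) = 0"
  "Wmat 1 $$ (2, 0) = 0" "Wmat 1 $$ (2, 1) = inv_sqrt2" "Wmat 1 $$ (2, 2) = inv_sqrt2" "Wmat 1 $$ (2, 3) = 0"
  "Wmat 1 $$ (3, 0) = 0" "Wmat 1 $$ (3, 1) = 0" "Wmat 1 $$ (3, 2) = 0" "Wmat 1 $$ (3, 3) = 1"
  by (subst Wmat_1_index; simp)+

lemma inv_sqrt2_mult: "inv_sqrt2 * (inv_sqrt2 * z) = z / 2" "inv_sqrt2 * inv_sqrt2 = 1 / 2"
proof -
  show *: "inv_sqrt2 * inv_sqrt2 = 1 / 2"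
    unfolding inv_sqrt2_def of_real_mult[symmetric] by (simp del: of_real_mult)
  show "inv_sqrt2 * (inv_sqrt2 * z) = z / 2"
    unfolding mult.assoc[symmetric] * by simp
qed

lemma cnj_inv_sqrt2: "cnj inv_sqrt2 = inv_sqrt2"
  by (simp add: inv_sqrt2_def)

lemma tensor_one_block:
  assumes C: "C \<in> carrier_mat (2 * m) (2 * m)" and q: "q < m" "q' < m" and r: "r < 4" "r' < 4"
  shows "tensor (1\<^sub>m 2) C $$ (4 * q + r, 4 * q' + r') =
    (if r mod 2 = r' mod 2 then blk C q q' (r div 2) (r' div 2) else 0)"
proof -
  have *: "(4 * x + y) div 2 = 2 * x + y div 2" "(4 * x + y) mod 2 = y mod 2" for x y :: nat
    by presburger+
  have "4 * q + r < 2 * (2 * m)" "4 * q' + r' < 2 * (2 * m)"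
    using q r by auto
  then show ?thesis
    by (simp add: tensor_one_index[OF C] * blk_def)
qed

lemma rot_step_carrier:
  assumes "N \<ge> 1" "C \<in> carrier_mat (2 ^ N) (2 ^ N)"
  shows "rot_step N C \<in> carrier_mat (2 ^ Suc N) (2 ^ Suc N)"
proof -
  have X: "tensor (1\<^sub>m 2) C \<in> carrier_mat (2 ^ Suc N) (2 ^ Suc N)"
    using tensor_carrier[OF one_carrier_mat[of 2] assms(2)] by simp
  note W = Wmat_carrier[OF assms(1)]
  show ?thesis
    unfolding rot_step_def by (rule mult_carrier_mat[OF mult_carrier_mat[OF W X] mat_adjoint_carrier[OF W]])
qed

text \<open>As \<open>Wmat N\<close> is block diagonal, the 4 by 4 block of the result at
  \<open>(q, q')\<close> depends only on the block of \<open>tensor\<close> at the same place, and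
  the product of large matrices becomes one of 4 by 4 matrices.\<close>

lemma rot_step_sum:
  assumes N: "N \<ge> 1" and C: "C \<in> carrier_mat (2 ^ N) (2 ^ N)"
    and q: "q < 2 ^ (N - 1)" "q' < 2 ^ (N - 1)" and r: "r < 4" "r' < 4"
  shows "rot_step N C $$ (4 * q + r, 4 * q' + r') =
    (\<Sum>s'<4. (\<Sum>s<4. Wmat 1 $$ (r, s) * tensor (1\<^sub>m 2) C $$ (4 * q + s, 4 * q' + s')) *
      cnj (Wmat 1 $$ (r', s')))"
proof -
  define m :: nat where "m = 2 ^ (N - 1)"
  have m: "2 ^ N = 2 * m" "2 ^ Suc N = m * 4"
    using N by (simp_all add: m_def flip: power_Suc)
  note q = q[folded m_def]
  let ?X = "tensor (1\<^sub>m 2) C"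
  have W: "Wmat N \<in> carrier_mat (m * 4) (m * 4)" and X: "?X \<in> carrier_mat (m * 4) (m * 4)"
    using Wmat_carrier[OF N] tensor_carrier[OF one_carrier_mat[of 2] C] m by (auto simp: mult.commute)
  have i: "4 * q + r < m * 4" "4 * q' + r' < m * 4"
    using q r by auto
  have WX: "(Wmat N * ?X) $$ (4 * q + r, j) = (\<Sum>s<4. Wmat 1 $$ (r, s) * ?X $$ (4 * q + s, j))"
    if "j < m * 4" for j
  proof -
    have "(Wmat N * ?X) $$ (4 * q + r, j) = (\<Sum>l<m * 4. Wmat N $$ (4 * q + r, l) * ?X $$ (l, j))"
      by (rule mat_mult_index[OF W X i(1) that])
    also have "\<dots> = (\<Sum>l<m * 4. if l div 4 = q then Wmat 1 $$ (r, l mod 4) * ?X $$ (l, j) else 0)"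
      using i(1) r N m(2) by (intro sum.cong) (auto simp: Wmat_index)
    also have "\<dots> = (\<Sum>s<4. Wmat 1 $$ (r, s) * ?X $$ (4 * q + s, j))"
      unfolding sum_block[OF q(1)] by (intro sum.cong) auto
    finally show ?thesis .
  qed
  have "rot_step N C $$ (4 * q + r, 4 * q' + r') =
      (\<Sum>l<m * 4. (Wmat N * ?X) $$ (4 * q + r, l) * mat_adjoint (Wmat N) $$ (l, 4 * q' + r'))"
    unfolding rot_step_def by (rule mat_mult_index[OF mult_carrier_mat[OF W X] mat_adjoint_carrier[OF W] i])
  also have "\<dots> = (\<Sum>l<m * 4. if l div 4 = q' then (Wmat N * ?X) $$ (4 * q + r, l) * cnj (Wmat 1 $$ (r', l mod 4)) else 0)"
    using i(2) r N m(2) by (intro sum.cong) (auto simp: Wmat_index mat_adjoint_index[OF W])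
  also have "\<dots> = (\<Sum>s'<4. (Wmat N * ?X) $$ (4 * q + r, 4 * q' + s') * cnj (Wmat 1 $$ (r', s')))"
    unfolding sum_block[OF q(2)] by (intro sum.cong) auto
  finally show ?thesis
    using q(2) by (simp add: WX)
qed

text \<open>Tensoring spreads a 2 by 2 block over the positions of equal parity in a 4 by 4 block;
  the rotation then mixes the coordinates 1 and 2. All later facts about the iteration are read off
  from this table.\<close>

lemma rot_step_block:
  assumes N: "N \<ge> 1" and C: "C \<in> carrier_mat (2 ^ N) (2 ^ N)"
    and q: "q < 2 ^ (N - 1)" "q' < 2 ^ (N - 1)" and r: "r < 4" "r' < 4"
  defines "a \<equiv> blk C q q' 0 0" and "b \<equiv> blk C q q' 0 1"
    and "c \<equiv> blk C q q' 1 0" and "d \<equiv> blk C q q' 1 1" and "h \<equiv> inv_sqrt2"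
  shows "rot_step N C $$ (4 * q + r, 4 * q' + r') =
    [[a, - (h * b), h * b, 0],
     [- (h * c), (a + d) / 2, (a - d) / 2, h * b],
     [h * c, (a - d) / 2, (a + d) / 2, h * b],
     [0, h * c, h * c, d]] ! r ! r'"
proof -
  have C': "C \<in> carrier_mat (2 * 2 ^ (N - 1)) (2 * 2 ^ (N - 1))"
    using C N by (simp flip: power_Suc)
  note X = tensor_one_block[OF C' q]
  note h = inv_sqrt2_mult[folded h_def] cnj_inv_sqrt2[folded h_def]
  note W = Wmat_1_table[folded h_def]
  have X': "tensor (1\<^sub>m 2) C $$ (4 * q + s, 4 * q' + s') =
      [[a, 0, b, 0], [0, a, 0, b], [c, 0, d, 0], [0, c, 0, d]] ! s ! s'" if "s < 4" "s' < 4" for s s'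
    unfolding X[OF that] a_def b_def c_def d_def using that unfolding less_4_cases
    by (elim disjE; hypsubst; simp)
  have *: "rot_step N C $$ (4 * q + r, 4 * q' + r') =
    (\<Sum>s'<4. (\<Sum>s<4. Wmat 1 $$ (r, s) * [[a, 0, b, 0], [0, a, 0, b], [c, 0, d, 0], [0, c, 0, d]] ! s ! s') *
      cnj (Wmat 1 $$ (r', s')))"
    unfolding rot_step_sum[OF N C q r] by (intro sum.cong refl arg_cong2[where f = "(*)"] X') auto
  show ?thesis
    unfolding * sum_lessThan_4 using r unfolding less_4_cases
    by (elim disjE; hypsubst; simp only: W; simp add: h algebra_simps add_divide_distrib diff_divide_distrib)
qed

text \<open>This vanishes exactly when all 2 by 2 blocks are scalar, that is, for matrices of the
  form \<open>tensor (1\<^sub>m 2) D\<close>. A weight \<open>w\<close> on \<open>|a - d|^2\<close>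
  becomes \<open>w / 2 + 1 / 2\<close> under a step; the weight 1 used here is the fixed
  point.\<close>

definition energy :: "nat \<Rightarrow> complex mat \<Rightarrow> real" where
  "energy m C = (\<Sum>q<m. \<Sum>q'<m. (cmod (blk C q q' 0 0 - blk C q q' 1 1))\<^sup>2
    + (cmod (blk C q q' 0 1))\<^sup>2 + (cmod (blk C q q' 1 0))\<^sup>2)"

lemma norm_inv_sqrt2_sq: "(cmod inv_sqrt2)\<^sup>2 = 1 / 2"
  by (simp add: inv_sqrt2_def norm_divide power_divide)

lemma norm_inv_sqrt2_mult: "(cmod (inv_sqrt2 * z))\<^sup>2 = (cmod z)\<^sup>2 / 2"
  by (simp add: norm_mult power_mult_distrib norm_inv_sqrt2_sq)

lemma half_diff:
  fixes z w :: complex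
  shows "(cmod (z - (z + w) / 2))\<^sup>2 = (cmod (z - w))\<^sup>2 / 4"
    "(cmod ((z + w) / 2 - z))\<^sup>2 = (cmod (z - w))\<^sup>2 / 4"
    "(cmod ((z + w) / 2 - w))\<^sup>2 = (cmod (z - w))\<^sup>2 / 4"
    "(cmod ((z - w) / 2))\<^sup>2 = (cmod (z - w))\<^sup>2 / 4"
proof -
  have *: "z - (z + w) / 2 = (z - w) / 2" "(z + w) / 2 - w = (z - w) / 2"
    by (simp_all add: field_simps)
  show "(cmod ((z - w) / 2))\<^sup>2 = (cmod (z - w))\<^sup>2 / 4"
    by (simp add: norm_divide power_divide)
  then show "(cmod (z - (z + w) / 2))\<^sup>2 = (cmod (z - w))\<^sup>2 / 4"
    "(cmod ((z + w) / 2 - w))\<^sup>2 = (cmod (z - w))\<^sup>2 / 4"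
    by (simp_all only: *)
  then show "(cmod ((z + w) / 2 - z))\<^sup>2 = (cmod (z - w))\<^sup>2 / 4"
    by (simp only: norm_minus_commute[of "(z + w) / 2" z])
qed

text \<open>Each of the four new 2 by 2 blocks receives a quarter of \<open>|a - d|^2\<close>. The
  two diagonal ones also receive half of \<open>|b|^2\<close> and half of \<open>|c|^2\<close>; the
  other two have equal diagonal entries, so nothing is added there.\<close>

lemma energy_rot_step:
  assumes N: "N \<ge> 1" and C: "C \<in> carrier_mat (2 ^ N) (2 ^ N)"
  shows "energy (2 ^ N) (rot_step N C) = energy (2 ^ (N - 1)) C"
proof -
  define m :: nat where "m = 2 ^ (N - 1)"
  have m: "2 ^ N = m * 2"
    using N by (simp add: m_def flip: power_Suc2)
  let ?e = "\<lambda>C q q'. (cmod (blk C q q' 0 0 - blk C q q' 1 1))\<^sup>2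
    + (cmod (blk C q q' 0 1))\<^sup>2 + (cmod (blk C q q' 1 0))\<^sup>2"
  let ?R = "rot_step N C"
  have *: "(\<Sum>t<2. \<Sum>t'<2. ?e ?R (2 * q + t) (2 * q' + t')) = ?e C q q'" if q: "q < m" "q' < m" for q q'
  proof -
    define Rf where "Rf r r' = ?R $$ (4 * q + r, 4 * q' + r')" for r r'
    have b: "blk ?R (2 * q + t) (2 * q' + t') x x' = Rf (2 * t + x) (2 * t' + x')" for t t' x x'
      by (simp add: blk_def Rf_def algebra_simps)
    note R = rot_step_block[OF N C q[unfolded m_def], folded Rf_def]
    let ?a = "blk C q q' 0 0" and ?b = "blk C q q' 0 1" and ?c = "blk C q q' 1 0" and ?d = "blk C q q' 1 1"
    show ?thesis
      unfolding sum_lessThan_2 b by (simp add: R half_diff norm_inv_sqrt2_mult power_divide)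
  qed
  have "energy (2 ^ N) ?R = (\<Sum>q<m. \<Sum>t<2. \<Sum>q'<m. \<Sum>t'<2. ?e ?R (2 * q + t) (2 * q' + t'))"
    unfolding energy_def m sum_lessThan_times ..
  also have "\<dots> = (\<Sum>q<m. \<Sum>q'<m. \<Sum>t<2. \<Sum>t'<2. ?e ?R (2 * q + t) (2 * q' + t'))"
    by (intro sum.cong refl sum.swap)
  also have "\<dots> = energy m C"
    unfolding energy_def using * by (intro sum.cong refl) auto
  finally show ?thesis
    by (simp add: m_def)
qed

lemma frobenius_norm_sq:
  "C \<in> carrier_mat n n \<Longrightarrow> (frobenius_norm C)\<^sup>2 = (\<Sum>i<n. \<Sum>j<n. (cmod (C $$ (i, j)))\<^sup>2)"
  by (auto simp: frobenius_norm_def sum_nonneg)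

text \<open>The middle entries contribute \<open>|a - d|^2\<close> in total. Of the four entries
  containing \<open>b\<close>, two contribute \<open>|b|^2 / 2\<close> each and the other two at
  most \<open>|b|^2\<close> each, likewise for \<open>c\<close>; hence the factor 3.\<close>

lemma frobenius_rot_step:
  assumes N: "N \<ge> 1" and C: "C \<in> carrier_mat (2 ^ N) (2 ^ N)"
  shows "(frobenius_norm (rot_step N C - tensor (1\<^sub>m 2) C))\<^sup>2 \<le> 3 * energy (2 ^ (N - 1)) C"
proof -
  define m :: nat where "m = 2 ^ (N - 1)"
  have m: "2 ^ Suc N = m * 4" "2 ^ N = 2 * m"
    using N by (simp_all add: m_def flip: power_Suc)
  let ?e = "\<lambda>q q'. (cmod (blk C q q' 0 0 - blk C q q' 1 1))\<^sup>2
    + (cmod (blk C q q' 0 1))\<^sup>2 + (cmod (blk C q q' 1 0))\<^sup>2"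
  let ?R = "rot_step N C" and ?X = "tensor (1\<^sub>m 2) C"
  have R: "?R \<in> carrier_mat (m * 4) (m * 4)"
    using rot_step_carrier[OF N C] unfolding m(1) .
  have X: "?X \<in> carrier_mat (m * 4) (m * 4)"
    using tensor_carrier[OF one_carrier_mat[of 2] C] m by (simp add: mult.commute)
  let ?f = "\<lambda>i j. (cmod ((?R - ?X) $$ (i, j)))\<^sup>2"
  have *: "(\<Sum>r<4. \<Sum>r'<4. ?f (4 * q + r) (4 * q' + r')) \<le> 3 * ?e q q'" if q: "q < m" "q' < m" for q q'
  proof -
    define Rf Xf where "Rf r r' = ?R $$ (4 * q + r, 4 * q' + r')"
      and "Xf r r' = ?X $$ (4 * q + r, 4 * q' + r')" for r r'
    have f: "?f (4 * q + r) (4 * q' + r') = (cmod (Rf r r' - Xf r r'))\<^sup>2" if "r < 4" "r' < 4" for r r'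
      using R X q that by (auto simp: Rf_def Xf_def)
    note B = rot_step_block[OF N C q[unfolded m_def], folded Rf_def]
      tensor_one_block[OF C[unfolded m(2)] q, folded Xf_def]
    let ?a = "blk C q q' 0 0" and ?b = "blk C q q' 0 1" and ?c = "blk C q q' 1 0" and ?d = "blk C q q' 1 1"
    have s: "(cmod (inv_sqrt2 * z - z))\<^sup>2 \<le> (cmod z)\<^sup>2" for z
    proof -
      have "inv_sqrt2 * z - z = complex_of_real (1 / sqrt 2 - 1) * z"
        by (simp add: inv_sqrt2_def left_diff_distrib)
      moreover have "\<bar>1 / sqrt 2 - 1\<bar> \<le> (1 :: real)"
        by (auto simp: abs_if divide_le_eq)
      ultimately have "cmod (inv_sqrt2 * z - z) \<le> cmod z"
        by (simp only: norm_mult norm_of_real) (simp add: mult_left_le_one_le)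
      then show ?thesis
        by (simp add: power_mono)
    qed
    have "(\<Sum>r<4. \<Sum>r'<4. ?f (4 * q + r) (4 * q' + r')) = (\<Sum>r<4. \<Sum>r'<4. (cmod (Rf r r' - Xf r r'))\<^sup>2)"
      using f by (intro sum.cong refl) auto
    also have "\<dots> = (cmod (?a - ?d))\<^sup>2 + (cmod ?b)\<^sup>2 + (cmod ?c)\<^sup>2
      + 2 * (cmod (inv_sqrt2 * ?b - ?b))\<^sup>2 + 2 * (cmod (inv_sqrt2 * ?c - ?c))\<^sup>2"
      unfolding sum_lessThan_4 by (simp add: B half_diff norm_inv_sqrt2_mult power_divide)
    also have "\<dots> \<le> 3 * ?e q q'"
      using s[of ?b] s[of ?c] zero_le_power2[of "cmod (?a - ?d)"] by argo
    finally show ?thesis .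
  qed
  have "(frobenius_norm (?R - ?X))\<^sup>2 = (\<Sum>i<m * 4. \<Sum>j<m * 4. ?f i j)"
    by (rule frobenius_norm_sq) (use X in \<open>simp add: minus_carrier_mat\<close>)
  also have "\<dots> = (\<Sum>q<m. \<Sum>r<4. \<Sum>q'<m. \<Sum>r'<4. ?f (4 * q + r) (4 * q' + r'))"
    unfolding sum_lessThan_times ..
  also have "\<dots> = (\<Sum>q<m. \<Sum>q'<m. \<Sum>r<4. \<Sum>r'<4. ?f (4 * q + r) (4 * q' + r'))"
    by (intro sum.cong refl sum.swap)
  also have "\<dots> \<le> (\<Sum>q<m. \<Sum>q'<m. 3 * ?e q q')"
    using * by (intro sum_mono) auto
  also have "\<dots> = 3 * energy m C"
    unfolding energy_def sum_distrib_left ..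
  finally show ?thesis
    by (simp add: m_def)
qed

lemma Wmat_unitary:
  assumes N: "N \<ge> 1"
  shows "mat_adjoint (Wmat N) * Wmat N = 1\<^sub>m (2 ^ Suc N)"
proof (rule eq_matI)
  define m :: nat where "m = 2 ^ (N - 1)"
  have m: "2 ^ Suc N = m * 4"
    using N by (simp add: m_def flip: power_Suc)
  have W: "Wmat N \<in> carrier_mat (m * 4) (m * 4)"
    using Wmat_carrier[OF N] unfolding m .
  show "dim_row (mat_adjoint (Wmat N) * Wmat N) = dim_row (1\<^sub>m (2 ^ Suc N) :: complex mat)"
    "dim_col (mat_adjoint (Wmat N) * Wmat N) = dim_col (1\<^sub>m (2 ^ Suc N) :: complex mat)"
    unfolding m using carrier_matD[OF mult_carrier_mat[OF mat_adjoint_carrier[OF W] W]] by simp_all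
  fix i j assume "i < dim_row (1\<^sub>m (2 ^ Suc N) :: complex mat)" "j < dim_col (1\<^sub>m (2 ^ Suc N) :: complex mat)"
  then have ij: "i < m * 4" "j < m * 4"
    using m by auto
  have orth: "(\<Sum>s<4. cnj (Wmat 1 $$ (s, r)) * Wmat 1 $$ (s, r')) = (if r = r' then 1 else 0)"
    if "r < 4" "r' < 4" for r r'
    using that unfolding sum_lessThan_4 less_4_cases
    by (elim disjE; hypsubst; simp only: Wmat_1_table; simp add: cnj_inv_sqrt2 inv_sqrt2_mult)
  have "(mat_adjoint (Wmat N) * Wmat N) $$ (i, j) = (\<Sum>l<m * 4. mat_adjoint (Wmat N) $$ (i, l) * Wmat N $$ (l, j))"
    by (rule mat_mult_index[OF mat_adjoint_carrier[OF W] W ij])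
  also have "\<dots> = (\<Sum>l<m * 4. if l div 4 = i div 4 then cnj (Wmat 1 $$ (l mod 4, i mod 4)) *
      (if i div 4 = j div 4 then Wmat 1 $$ (l mod 4, j mod 4) else 0) else 0)"
    using ij N m by (intro sum.cong) (auto simp: Wmat_index mat_adjoint_index[OF W])
  also have "\<dots> = (\<Sum>s<4. cnj (Wmat 1 $$ (s, i mod 4)) * (if i div 4 = j div 4 then Wmat 1 $$ (s, j mod 4) else 0))"
    by (subst sum_block) (use ij in \<open>auto intro!: sum.cong simp: less_mult_imp_div_less\<close>)
  also have "\<dots> = (if i = j then 1 else 0)"
  proof (cases "i div 4 = j div 4")
    case True
    then have "i = j \<longleftrightarrow> i mod 4 = j mod 4"
      by (metis div_mult_mod_eq)
    moreover have "(\<Sum>s<4. cnj (Wmat 1 $$ (s, i mod 4)) * Wmat 1 $$ (s, j mod 4))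
        = (if i mod 4 = j mod 4 then 1 else 0)"
      by (rule orth) simp_all
    ultimately show ?thesis
      by (simp only: True refl if_True)
  next
    case False
    then have "i \<noteq> j"
      by blast
    then show ?thesis
      by (simp only: False if_False mult_zero_right sum.neutral_const)
  qed
  finally show "(mat_adjoint (Wmat N) * Wmat N) $$ (i, j) = 1\<^sub>m (2 ^ Suc N) $$ (i, j)"
    using ij m by simp
qed

lemma mat_iter_Suc:
  "n \<ge> 1 \<Longrightarrow> mat_iter k A (Suc n) = rot_step (k + n - 1) (mat_iter k A n)"
  by (simp add: rot_step_def)

lemma mat_iter_carrier:
  assumes "k \<ge> 1" "A \<in> carrier_mat (2 ^ k) (2 ^ k)" "n \<ge> 1"
  shows "mat_iter k A n \<in> carrier_mat (2 ^ (k + n - 1)) (2 ^ (k + n - 1))"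
  using assms(3)
proof (induction n rule: nat_induct_at_least)
  case (Suc n)
  then show ?case
    using rot_step_carrier[of "k + n - 1" "mat_iter k A n"] assms(1) mat_iter_Suc[OF Suc.hyps, of k A]
    by (simp del: mat_iter.simps)
qed (use assms in simp)

subsection \<open>Gram matrices\<close>

lemma mat_positive_form:
  assumes A: "A \<in> carrier_mat n n" "mat_positive A"
  shows "0 \<le> (\<Sum>i<n. \<Sum>j<n. A $$ (i, j) * (cnj (z i) * z j))"
proof -
  define w where "w = Matrix.vec n z"
  have "0 \<le> (A *\<^sub>v w) \<bullet>c w"
    using A by (auto simp: mat_positive_def w_def)
  also have "(A *\<^sub>v w) \<bullet>c w = (\<Sum>i<n. (\<Sum>j<n. A $$ (i, j) * z j) * cnj (z i))"
    using A(1) by (auto simp: scalar_prod_def w_def lessThan_atLeast0 intro!: sum.cong)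
  also have "\<dots> = (\<Sum>i<n. \<Sum>j<n. A $$ (i, j) * (cnj (z i) * z j))"
    unfolding sum_distrib_right by (intro sum.cong refl) (simp add: mult_ac)
  finally show ?thesis .
qed

text \<open>By induction on the number of nonzero vectors: subtracting from every vector its projection
  onto the line through one of them splits off a positive rank-one term.\<close>

lemma mat_positive_gram:
  fixes \<zeta> :: "nat \<Rightarrow> 'h::chilbert"
  assumes A: "A \<in> carrier_mat n n" "mat_positive A"
  shows "0 \<le> (\<Sum>i<n. \<Sum>j<n. A $$ (i, j) * cinner (\<zeta> i) (\<zeta> j))"
proof (induction "card {i\<in>{..<n}. \<zeta> i \<noteq> 0}" arbitrary: \<zeta> rule: less_induct)
  case less
  show ?case
  proof (cases "\<exists>l<n. \<zeta> l \<noteq> 0")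
    case False
    then have "(\<Sum>i<n. \<Sum>j<n. A $$ (i, j) * cinner (\<zeta> i) (\<zeta> j)) = 0"
      by (intro sum.neutral) auto
    then show ?thesis
      by simp
  next
    case True
    then obtain l where l: "l < n" "\<zeta> l \<noteq> 0"
      by blast
    define e where "e = complex_of_real (1 / norm (\<zeta> l)) *\<^sub>C \<zeta> l"
    define z where "z j = cinner e (\<zeta> j)" for j
    define \<zeta>' where "\<zeta>' j = \<zeta> j - z j *\<^sub>C e" for j
    have ee: "cinner e e = 1"
      unfolding cinner_self e_def norm_scaleC using l by (simp add: norm_divide)
    have "z l = complex_of_real (norm (\<zeta> l))"
      using l by (simp add: z_def e_def cinner_scaleC_left cinner_self power2_eq_square)
    then have "\<zeta>' l = 0"
      using l by (simp add: \<zeta>'_def e_def scaleC_scaleC scaleC_one)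
    moreover have "\<zeta>' j = 0" if "\<zeta> j = 0" for j
      by (simp add: \<zeta>'_def z_def that scaleC_zero_left)
    ultimately have "{i\<in>{..<n}. \<zeta>' i \<noteq> 0} \<subset> {i\<in>{..<n}. \<zeta> i \<noteq> 0}"
      using l by blast
    then have "card {i\<in>{..<n}. \<zeta>' i \<noteq> 0} < card {i\<in>{..<n}. \<zeta> i \<noteq> 0}"
      by (intro psubset_card_mono) auto
    from less[OF this] have 1: "0 \<le> (\<Sum>i<n. \<Sum>j<n. A $$ (i, j) * cinner (\<zeta>' i) (\<zeta>' j))" .
    have 2: "0 \<le> (\<Sum>i<n. \<Sum>j<n. A $$ (i, j) * (cnj (z i) * z j))"
      by (rule mat_positive_form[OF A])
    have "cinner (\<zeta> i) e = cnj (z i)" for i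
      unfolding z_def by (rule cinner_commute)
    then have "cinner (\<zeta>' i) (\<zeta>' j) + cnj (z i) * z j = cinner (\<zeta> i) (\<zeta> j)" for i j
      by (simp add: \<zeta>'_def cinner_diff_left cinner_diff_right cinner_scaleC_left cinner_scaleC_right
          ee z_def[symmetric])
    then have "(\<Sum>i<n. \<Sum>j<n. A $$ (i, j) * cinner (\<zeta> i) (\<zeta> j)) =
        (\<Sum>i<n. \<Sum>j<n. A $$ (i, j) * cinner (\<zeta>' i) (\<zeta>' j)) + (\<Sum>i<n. \<Sum>j<n. A $$ (i, j) * (cnj (z i) * z j))"
      by (simp only: sum.distrib[symmetric] distrib_left[symmetric])
    then show ?thesis
      using 1 2 by (simp add: less_eq_complex_def)
  qed
qed

subsection \<open>Dyadic matrix units\<close>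

lemma (in tracial_algebra) norm2_Cauchy_of_summable:
  assumes M: "\<And>n. X n \<in> M" and step: "\<And>n. norm2 \<tau> (X (Suc n) - X n) \<le> c n" and c: "summable c"
    and e: "e > 0"
  shows "\<exists>N. \<forall>m\<ge>N. \<forall>n\<ge>m. norm2 \<tau> (X n - X m) < e"
proof -
  have tele: "norm2 \<tau> (X n - X m) \<le> sum c {m..<n}" if "n \<ge> m" for m n
    using that
  proof (induction n rule: dec_induct)
    case (step n)
    have "X (Suc n) - X m = (X (Suc n) - X n) + (X n - X m)"
      by simp
    then have "norm2 \<tau> (X (Suc n) - X m) \<le> norm2 \<tau> (X (Suc n) - X n) + norm2 \<tau> (X n - X m)"
      using norm2_triangle[OF M_diff[OF M M] M_diff[OF M M]] by metis
    then show ?case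
      using step assms(2)[of n] by simp
  qed (simp add: norm2_zero)
  obtain N where "\<And>m n. m \<ge> N \<Longrightarrow> norm (sum c {m..<n}) < e"
    using c e unfolding summable_Cauchy by blast
  then have "norm2 \<tau> (X n - X m) < e" if "m \<ge> N" "n \<ge> m" for m n
    using tele[OF that(2)] that(1) by (smt (verit, best) real_norm_def)
  then show ?thesis
    by blast
qed

text \<open>The matrix units are indexed from 0 here.\<close>

locale dyadic_units = tracial_algebra M \<tau> for M :: "'h::chilbert cop set" and \<tau> +
  fixes v :: "nat \<Rightarrow> nat \<Rightarrow> nat \<Rightarrow> 'h cop"
  assumes v_M: "k \<ge> 1 \<Longrightarrow> i < 2 ^ k \<Longrightarrow> j < 2 ^ k \<Longrightarrow> v k i j \<in> M"
    and v_mult: "k \<ge> 1 \<Longrightarrow> i < 2 ^ k \<Longrightarrow> j < 2 ^ k \<Longrightarrow> r < 2 ^ k \<Longrightarrow> s < 2 ^ k \<Longrightarrow>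
      v k i j * v k r s = (if j = r then v k i s else 0)"
    and v_adj: "k \<ge> 1 \<Longrightarrow> i < 2 ^ k \<Longrightarrow> j < 2 ^ k \<Longrightarrow> adj (v k i j) = v k j i"
    and v_sum: "k \<ge> 1 \<Longrightarrow> (\<Sum>i<2 ^ k. v k i i) = 1"
    and v_coherent: "k \<ge> 1 \<Longrightarrow> i < 2 ^ k \<Longrightarrow> j < 2 ^ k \<Longrightarrow>
      v (Suc k) (2 * i) (2 * j) + v (Suc k) (Suc (2 * i)) (Suc (2 * j)) = v k i j"
begin

definition emb :: "nat \<Rightarrow> complex mat \<Rightarrow> 'h cop" where
  "emb k C = (\<Sum>i<2 ^ k. \<Sum>j<2 ^ k. (C $$ (i, j)) *\<^sub>C v k i j)"

lemma emb_M: "k \<ge> 1 \<Longrightarrow> emb k C \<in> M"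
  unfolding emb_def by (intro M_sum M_scaleC v_M) auto

lemma emb_one: "k \<ge> 1 \<Longrightarrow> emb k (1\<^sub>m (2 ^ k)) = 1"
proof -
  assume k: "k \<ge> 1"
  have "emb k (1\<^sub>m (2 ^ k)) = (\<Sum>i<2 ^ k. \<Sum>j<2 ^ k. if i = j then v k i j else 0)"
    unfolding emb_def by (intro sum.cong refl) (auto simp: scaleC_cop_simps)
  also have "\<dots> = 1"
    using v_sum[OF k] by (simp add: sum.delta)
  finally show ?thesis .
qed

lemma emb_diff:
  assumes "C \<in> carrier_mat (2 ^ k) (2 ^ k)" "D \<in> carrier_mat (2 ^ k) (2 ^ k)"
  shows "emb k (C - D) = emb k C - emb k D"
proof -
  have "emb k (C - D) = (\<Sum>i<2 ^ k. \<Sum>j<2 ^ k. (C $$ (i, j)) *\<^sub>C v k i j - (D $$ (i, j)) *\<^sub>C v k i j)"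
    unfolding emb_def using assms by (intro sum.cong refl) (auto simp: scaleC_cop_simps)
  then show ?thesis
    by (simp add: emb_def sum_subtractf)
qed

lemma emb_adj:
  assumes "k \<ge> 1" "C \<in> carrier_mat (2 ^ k) (2 ^ k)"
  shows "adj (emb k C) = emb k (mat_adjoint C)"
proof -
  have "adj (emb k C) = (\<Sum>i<2 ^ k. \<Sum>j<2 ^ k. cnj (C $$ (i, j)) *\<^sub>C v k j i)"
    unfolding emb_def adj_sum using assms by (intro sum.cong refl) (auto simp: v_adj)
  also have "\<dots> = (\<Sum>j<2 ^ k. \<Sum>i<2 ^ k. cnj (C $$ (i, j)) *\<^sub>C v k j i)"
    by (rule sum.swap)
  also have "\<dots> = emb k (mat_adjoint C)"
    unfolding emb_def using assms by (intro sum.cong refl) (auto simp: mat_adjoint_index[OF assms(2)])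
  finally show ?thesis .
qed

lemma emb_mult:
  assumes k: "k \<ge> 1" and C: "C \<in> carrier_mat (2 ^ k) (2 ^ k)" and D: "D \<in> carrier_mat (2 ^ k) (2 ^ k)"
  shows "emb k C * emb k D = emb k (C * D)"
proof -
  let ?n = "2 ^ k :: nat"
  have "emb k C * emb k D = (\<Sum>i<?n. \<Sum>j<?n. \<Sum>r<?n. \<Sum>s<?n.
      (C $$ (i, j) *\<^sub>C v k i j) * (D $$ (r, s) *\<^sub>C v k r s))"
    unfolding emb_def unfolding sum_distrib_right unfolding sum_distrib_left ..
  also have "\<dots> = (\<Sum>i<?n. \<Sum>j<?n. \<Sum>r<?n. if j = r then \<Sum>s<?n. (C $$ (i, j) * D $$ (r, s)) *\<^sub>C v k i s else 0)"
    using k by (intro sum.cong refl) (auto simp: scaleC_cop_simps v_mult mult.commute intro!: sum.cong sum.neutral)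
  also have "\<dots> = (\<Sum>i<?n. \<Sum>j<?n. \<Sum>s<?n. (C $$ (i, j) * D $$ (j, s)) *\<^sub>C v k i s)"
    by simp
  also have "\<dots> = (\<Sum>i<?n. \<Sum>s<?n. \<Sum>j<?n. (C $$ (i, j) * D $$ (j, s)) *\<^sub>C v k i s)"
    by (intro sum.cong refl sum.swap)
  also have "\<dots> = (\<Sum>i<?n. \<Sum>s<?n. ((C * D) $$ (i, s)) *\<^sub>C v k i s)"
  proof (intro sum.cong refl)
    fix i s assume "i \<in> {..<?n}" "s \<in> {..<?n}"
    then have "(C * D) $$ (i, s) = (\<Sum>j<?n. C $$ (i, j) * D $$ (j, s))"
      by (intro mat_mult_index[OF C D]) auto
    moreover have "(\<Sum>j\<in>J. g j *\<^sub>C v k i s) = (\<Sum>j\<in>J. g j) *\<^sub>C v k i s" for J :: "nat set" and g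
      by (induction J rule: infinite_finite_induct) (auto simp: scaleC_cop_simps)
    ultimately show "(\<Sum>j<?n. (C $$ (i, j) * D $$ (j, s)) *\<^sub>C v k i s) = ((C * D) $$ (i, s)) *\<^sub>C v k i s"
      by simp
  qed
  finally show ?thesis
    by (simp add: emb_def)
qed

text \<open>The coherence relation in matrix form: with the block convention of
  \<open>tensor\<close>, only the terms with \<open>r = r'\<close> survive among the children of
  \<open>v k q q'\<close>, and their sum is \<open>v k q q'\<close>.\<close>

lemma emb_tensor:
  assumes k: "k \<ge> 1" and C: "C \<in> carrier_mat (2 ^ k) (2 ^ k)"
  shows "emb (Suc k) (tensor (1\<^sub>m 2) C) = emb k C"
proof -
  let ?X = "tensor (1\<^sub>m 2) C"
  have two: "(2 :: nat) ^ Suc k = 2 ^ k * 2"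
    by simp
  have "emb (Suc k) ?X = (\<Sum>q<2 ^ k. \<Sum>r<2. \<Sum>q'<2 ^ k. \<Sum>r'<2.
      ?X $$ (2 * q + r, 2 * q' + r') *\<^sub>C v (Suc k) (2 * q + r) (2 * q' + r'))"
    unfolding emb_def two sum_lessThan_times ..
  also have "\<dots> = (\<Sum>q<2 ^ k. \<Sum>q'<2 ^ k. \<Sum>r<2. \<Sum>r'<2.
      ?X $$ (2 * q + r, 2 * q' + r') *\<^sub>C v (Suc k) (2 * q + r) (2 * q' + r'))"
    by (intro sum.cong refl sum.swap)
  also have "\<dots> = emb k C"
    unfolding emb_def
  proof (intro sum.cong refl)
    fix q q' :: nat assume q: "q \<in> {..<2 ^ k}" "q' \<in> {..<2 ^ k}"
    have X: "?X $$ (2 * q + r, 2 * q' + r') = (if r = r' then C $$ (q, q') else 0)" if "r < 2" "r' < 2" for r r'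
      using tensor_one_index[OF C, of "2 * q + r" "2 * q' + r'"] q that by auto
    show "(\<Sum>r<2. \<Sum>r'<2. ?X $$ (2 * q + r, 2 * q' + r') *\<^sub>C v (Suc k) (2 * q + r) (2 * q' + r'))
        = (C $$ (q, q')) *\<^sub>C v k q q'"
      unfolding v_coherent[OF k q[unfolded lessThan_iff], symmetric] sum_lessThan_2 X[of 0 0, simplified]
      using X[of 0 0] X[of 0 1] X[of 1 0] X[of 1 1] by (simp add: scaleC_cop_simps)
  qed
  finally show ?thesis .
qed

text \<open>The products of \<open>v k l 0\<close> and \<open>v k 0 l\<close> in the two orders are
  \<open>v k l l\<close> and \<open>v k 0 0\<close>, so all diagonal units have equal trace. Off the
  diagonal, \<open>v k i i * v k i j\<close> is \<open>v k i j\<close>, whereas the reversed product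
  is zero.\<close>

lemma trace_v:
  assumes k: "k \<ge> 1" and ij: "i < 2 ^ k" "j < 2 ^ k"
  shows "\<tau> (v k i j) = (if i = j then 1 / 2 ^ k else 0)"
proof (cases "i = j")
  case True
  have eq: "\<tau> (v k l l) = \<tau> (v k 0 0)" if "l < 2 ^ k" for l
    using trace_commute[of "v k l 0" "v k 0 l"] v_mult[OF k] v_M[OF k] that by simp
  have "1 = (\<Sum>l<2 ^ k. \<tau> (v k l l))"
    unfolding trace_one[symmetric] v_sum[OF k, symmetric] using v_M[OF k] by (intro trace_sum) auto
  also have "\<dots> = (\<Sum>l<(2::nat) ^ k. \<tau> (v k 0 0))"
    by (intro sum.cong refl eq) auto
  finally have "\<tau> (v k 0 0) = 1 / 2 ^ k"
    by (simp add: field_simps)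
  then show ?thesis
    using True eq[OF ij(1)] by simp
next
  case False
  then show ?thesis
    using trace_commute[of "v k i i" "v k i j"] v_mult[OF k] v_M[OF k] ij by (simp add: trace_zero)
qed

lemma trace_emb:
  assumes k: "k \<ge> 1"
  shows "\<tau> (emb k C) = (\<Sum>i<2 ^ k. C $$ (i, i)) / 2 ^ k"
proof -
  have "\<tau> (emb k C) = (\<Sum>i<2 ^ k. \<tau> (\<Sum>j<2 ^ k. C $$ (i, j) *\<^sub>C v k i j))"
    unfolding emb_def by (intro trace_sum M_sum M_scaleC v_M k) auto
  also have "\<dots> = (\<Sum>i<2 ^ k. \<Sum>j<2 ^ k. \<tau> (C $$ (i, j) *\<^sub>C v k i j))"
    by (intro sum.cong refl trace_sum M_scaleC v_M k) auto
  also have "\<dots> = (\<Sum>i<2 ^ k. \<Sum>j<2 ^ k. C $$ (i, j) * \<tau> (v k i j))"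
    by (intro sum.cong refl trace_scaleC v_M k) auto
  also have "\<dots> = (\<Sum>i<2 ^ k. \<Sum>j<2 ^ k. if i = j then C $$ (i, i) / 2 ^ k else 0)"
    using k by (intro sum.cong refl) (auto simp: trace_v)
  finally show ?thesis
    by (simp add: sum.delta sum_divide_distrib)
qed

lemma norm2_emb:
  assumes k: "k \<ge> 1" and C: "C \<in> carrier_mat (2 ^ k) (2 ^ k)"
  shows "(norm2 \<tau> (emb k C))\<^sup>2 = (frobenius_norm C)\<^sup>2 / 2 ^ k"
proof -
  have "(norm2 \<tau> (emb k C))\<^sup>2 = Re (\<tau> (emb k (mat_adjoint C * C)))"
    using norm2_sq[OF emb_M[OF k]] emb_adj[OF k C] emb_mult[OF k mat_adjoint_carrier[OF C] C] by simp
  also have "\<tau> (emb k (mat_adjoint C * C)) = (\<Sum>i<2 ^ k. \<Sum>l<2 ^ k. complex_of_real ((cmod (C $$ (l, i)))\<^sup>2)) / 2 ^ k"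
    unfolding trace_emb[OF k]
  proof (rule arg_cong[where f = "\<lambda>z. z / 2 ^ k"], rule sum.cong[OF refl])
    fix i :: nat assume "i \<in> {..<2 ^ k}"
    then have i: "i < 2 ^ k"
      by simp
    have "(mat_adjoint C * C) $$ (i, i) = (\<Sum>l<2 ^ k. mat_adjoint C $$ (i, l) * C $$ (l, i))"
      by (rule mat_mult_index[OF mat_adjoint_carrier[OF C] C i i])
    also have "\<dots> = (\<Sum>l<2 ^ k. complex_of_real ((cmod (C $$ (l, i)))\<^sup>2))"
      using i unfolding complex_norm_square
      by (intro sum.cong refl) (auto simp: mat_adjoint_index[OF C] mult.commute)
    finally show "(mat_adjoint C * C) $$ (i, i) = (\<Sum>l<2 ^ k. complex_of_real ((cmod (C $$ (l, i)))\<^sup>2))" .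
  qed
  also have "Re \<dots> = (\<Sum>i<2 ^ k. \<Sum>l<2 ^ k. (cmod (C $$ (l, i)))\<^sup>2) / 2 ^ k"
  proof -
    have "Re (complex_of_real r / 2 ^ k) = r / 2 ^ k" for r
      using Re_divide_of_real[of "complex_of_real r" "2 ^ k"] by simp
    then show ?thesis
      by (simp only: of_real_sum[symmetric])
  qed
  also have "(\<Sum>i<2 ^ k. \<Sum>l<2 ^ k. (cmod (C $$ (l, i)))\<^sup>2) = (frobenius_norm C)\<^sup>2"
    unfolding frobenius_norm_sq[OF C] by (rule sum.swap)
  finally show ?thesis .
qed

text \<open>Positivity of \<open>C\<close> concerns scalar vectors, that of the operator concerns
  Hilbert space vectors. The factorization \<open>v k i j = adj (v k 0 i) * v k 0 j\<close> pairs
  \<open>C\<close> with a Gram matrix, to which \<open>mat_positive_gram\<close> applies.\<close>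

lemma emb_positive:
  assumes k: "k \<ge> 1" and C: "C \<in> carrier_mat (2 ^ k) (2 ^ k)" "mat_positive C"
  shows "positive_op (emb k C)"
  unfolding positive_op_def
proof
  fix x
  have "cinner x (app (v k i j) x) = cinner (app (v k 0 i) x) (app (v k 0 j) x)"
    if "i < 2 ^ k" "j < 2 ^ k" for i j
  proof -
    have "v k i j = adj (v k 0 i) * v k 0 j"
      using v_mult[OF k] v_adj[OF k] that by simp
    then show ?thesis
      by (simp add: adj_right)
  qed
  then have "cinner x (app (emb k C) x) =
      (\<Sum>i<2 ^ k. \<Sum>j<2 ^ k. C $$ (i, j) * cinner (app (v k 0 i) x) (app (v k 0 j) x))"
    unfolding emb_def by (simp add: cinner_sum_right cinner_scaleC_right)
  then show "0 \<le> cinner x (app (emb k C) x)"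
    using mat_positive_gram[OF C] by simp
qed

end

section \<open>Conjugation by isometries, and the trace norm under strong limits\<close>

lemma op_bound_isometry: "adj T * T = 1 \<Longrightarrow> op_bound 1 T"
  unfolding op_bound_def
proof
  fix x assume "adj T * T = 1"
  then have "(norm (app T x))\<^sup>2 = (norm x)\<^sup>2"
    using cinner_adj_mult[of x T x] by (simp add: Re_cinner_self[symmetric])
  then show "norm (app T x) \<le> 1 * norm x"
    by simp
qed

lemma projection_conj: "adj w * w = 1 \<Longrightarrow> projection T \<Longrightarrow> projection (w * T * adj w)"
proof -
  assume w: "adj w * w = 1" and T: "projection T"
  have "(w * T * adj w) * (w * T * adj w) = w * T * (adj w * w) * T * adj w"
    by (simp only: mult.assoc)
  also have "\<dots> = w * (T * T) * adj w"
    by (simp add: w mult.assoc)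
  also have "\<dots> = w * T * adj w"
    using T by (simp add: projection_def)
  finally show ?thesis
    using T by (simp add: projection_def mult.assoc)
qed

lemma positive_conj: "positive_op T \<Longrightarrow> positive_op (w * T * adj w)"
  unfolding positive_op_def
proof
  fix x assume "\<forall>x. 0 \<le> cinner x (app T x)"
  moreover have "cinner x (app (w * T * adj w) x) = cinner (app (adj w) x) (app T (app (adj w) x))"
    by (simp add: adj_left)
  ultimately show "0 \<le> cinner x (app (w * T * adj w) x)"
    by simp
qed

context tracial_algebra
begin

lemma norm2_conj:
  assumes "adj w * w = 1" "w \<in> M" "T \<in> M"
  shows "norm2 \<tau> (w * T * adj w) = norm2 \<tau> T"
proof -
  have "adj (w * T * adj w) * (w * T * adj w) = w * (adj T * ((adj w * w) * (T * adj w)))"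
    by (simp add: mult.assoc)
  also have "\<tau> \<dots> = \<tau> ((adj T * ((adj w * w) * (T * adj w))) * w)"
    using assms by (intro trace_commute) auto
  also have "(adj T * ((adj w * w) * (T * adj w))) * w = adj T * T * (adj w * w)"
    by (simp add: mult.assoc assms(1))
  finally show ?thesis
    by (simp add: norm2_def assms(1))
qed

text \<open>The adjoints need not converge strongly, but the form of \<open>adj (X n) * X n\<close>
  is an inner product of two convergent vectors; this weak convergence is all that normality asks
  for.\<close>

lemma norm2_strong_lim:
  assumes lim: "strong_lim X T" and M: "\<And>n. X n \<in> M" and bound: "\<And>n. op_bound K (X n)" and K: "K \<ge> 0"
  shows "(\<lambda>n. (norm2 \<tau> (X n))\<^sup>2) \<longlonglongrightarrow> (norm2 \<tau> T)\<^sup>2"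
proof -
  have T: "T \<in> M"
    by (rule M_strong_lim[OF lim M])
  have "(\<lambda>n. \<tau> (adj (X n) * X n)) \<longlonglongrightarrow> \<tau> (adj T * T)"
  proof (rule normal_functional_tendsto[OF trace_normal])
    show "(\<lambda>n. cinner x (app (adj (X n) * X n) y)) \<longlonglongrightarrow> cinner x (app (adj T * T) y)" for x y
      unfolding cinner_adj_mult by (rule tendsto_cinner) (use lim in \<open>auto simp: strong_lim_def\<close>)
    show "op_bound (K * K) (adj (X n) * X n)" for n
      using bound K by (intro op_bound_mult op_bound_adj) auto
  qed (use M T in auto)
  then show ?thesis
    unfolding norm2_sq[OF M] norm2_sq[OF T] by (rule tendsto_Re)
qed

end

section \<open>The iterates in the algebra: convergence and preserved properties\<close>

context dyadic_units
begin

lemma emb_rot_step: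
  assumes N: "N \<ge> 1" and C: "C \<in> carrier_mat (2 ^ N) (2 ^ N)"
  shows "emb (Suc N) (rot_step N C) = emb (Suc N) (Wmat N) * emb N C * adj (emb (Suc N) (Wmat N))"
proof -
  note W = Wmat_carrier[OF N]
  have X: "tensor (1\<^sub>m 2) C \<in> carrier_mat (2 ^ Suc N) (2 ^ Suc N)"
    using tensor_carrier[OF one_carrier_mat[of 2] C] by simp
  have N': "Suc N \<ge> 1"
    by simp
  show ?thesis
    unfolding emb_adj[OF N' W] emb_tensor[OF N C, symmetric] emb_mult[OF N' W X]
      emb_mult[OF N' mult_carrier_mat[OF W X] mat_adjoint_carrier[OF W]] rot_step_def ..
qed

lemma emb_Wmat_isometry:
  assumes N: "N \<ge> 1"
  shows "adj (emb (Suc N) (Wmat N)) * emb (Suc N) (Wmat N) = 1"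
proof -
  note W = Wmat_carrier[OF N]
  have N': "Suc N \<ge> 1"
    by simp
  show ?thesis
    unfolding emb_adj[OF N' W] emb_mult[OF N' mat_adjoint_carrier[OF W] W] Wmat_unitary[OF N]
    by (rule emb_one[OF N'])
qed

text \<open>The index is shifted: \<open>iter k A n\<close> is the term with number
  \<open>n + 1\<close> of the sequence, so that its level is \<open>k + n\<close>.\<close>

definition iter :: "nat \<Rightarrow> complex mat \<Rightarrow> nat \<Rightarrow> 'h cop" where
  "iter k A n = emb (k + n) (mat_iter k A (Suc n))"

lemma iter_0: "iter k A 0 = emb k A"
  by (simp add: iter_def)

lemma iter_M: "k \<ge> 1 \<Longrightarrow> iter k A n \<in> M"
  by (simp add: iter_def emb_M)

context
  fixes k :: nat
  assumes k: "k \<ge> 1"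
begin

lemma mat_iter_Suc_carrier:
  "A \<in> carrier_mat (2 ^ k) (2 ^ k) \<Longrightarrow> mat_iter k A (Suc n) \<in> carrier_mat (2 ^ (k + n)) (2 ^ (k + n))"
  using mat_iter_carrier[OF k, of A "Suc n"] by simp

text \<open>The order of quantifiers matters: one \<open>w\<close> serves all matrices
  \<open>A\<close> at once, which allows two iterations to be compared.\<close>

lemma iter_Suc:
  obtains w where "adj w * w = 1" "w \<in> M"
    "\<And>A. A \<in> carrier_mat (2 ^ k) (2 ^ k) \<Longrightarrow> iter k A (Suc n) = w * iter k A n * adj w"
proof
  let ?w = "emb (Suc (k + n)) (Wmat (k + n))"
  have N: "k + n \<ge> 1"
    using k by simp
  show "adj ?w * ?w = 1"
    by (rule emb_Wmat_isometry[OF N])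
  show "?w \<in> M"
    by (rule emb_M) simp
  show "iter k A (Suc n) = ?w * iter k A n * adj ?w" if A: "A \<in> carrier_mat (2 ^ k) (2 ^ k)" for A
    using emb_rot_step[OF N mat_iter_Suc_carrier[OF A]] mat_iter_Suc[of "Suc n" k A]
    by (simp add: iter_def del: mat_iter.simps)
qed

lemma iter_op_bound:
  assumes A: "A \<in> carrier_mat (2 ^ k) (2 ^ k)"
  obtains K where "K \<ge> 0" "\<And>n. op_bound K (iter k A n)"
proof -
  obtain K where K: "K \<ge> 0" "op_bound K (iter k A 0)"
    by (rule op_bound_exists)
  have "op_bound K (iter k A n)" for n
  proof (induction n)
    case (Suc n)
    obtain w where w: "adj w * w = 1" "iter k A (Suc n) = w * iter k A n * adj w"
      using iter_Suc[of n] A by metis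
    have "op_bound (1 * K * 1) (w * iter k A n * adj w)"
      using K(1) by (intro op_bound_mult op_bound_adj op_bound_isometry w(1) Suc) auto
    then show ?case
      by (simp add: w(2))
  qed (use K in simp)
  then show thesis
    using K that by blast
qed

lemma energy_mat_iter:
  assumes A: "A \<in> carrier_mat (2 ^ k) (2 ^ k)"
  shows "energy (2 ^ (k + n - 1)) (mat_iter k A (Suc n)) = energy (2 ^ (k - 1)) A"
proof (induction n)
  case (Suc n)
  have N: "k + n \<ge> 1"
    using k by simp
  then show ?case
    using energy_rot_step[OF N mat_iter_Suc_carrier[OF A]] mat_iter_Suc[of "Suc n" k A] Suc
    by (simp del: mat_iter.simps)
qed simp

text \<open>The energy is constant while \<open>norm2_emb\<close> divides by the size
  \<open>2 ^ (k + n + 1)\<close> of the matrix. Of this only \<open>2 ^ n\<close> is kept, and its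
  square root gives the ratio \<open>1 / sqrt 2\<close>.\<close>

lemma norm2_iter_step:
  assumes A: "A \<in> carrier_mat (2 ^ k) (2 ^ k)"
  shows "norm2 \<tau> (iter k A (Suc n) - iter k A n) \<le> sqrt (3 * energy (2 ^ (k - 1)) A) * (1 / sqrt 2) ^ n"
proof -
  define N where "N = k + n"
  define C where "C = mat_iter k A (Suc n)"
  have N: "N \<ge> 1" and C: "C \<in> carrier_mat (2 ^ N) (2 ^ N)"
    using k mat_iter_Suc_carrier[OF A] by (simp_all add: N_def C_def del: mat_iter.simps)
  define S where "S = 3 * energy (2 ^ (k - 1)) A"
  have S: "S \<ge> 0"
    unfolding S_def energy_def by (intro mult_nonneg_nonneg sum_nonneg add_nonneg_nonneg) auto
  have X: "tensor (1\<^sub>m 2) C \<in> carrier_mat (2 ^ Suc N) (2 ^ Suc N)"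
    using tensor_carrier[OF one_carrier_mat[of 2] C] by simp
  have "iter k A (Suc n) - iter k A n = emb (Suc N) (rot_step N C) - emb (Suc N) (tensor (1\<^sub>m 2) C)"
    unfolding emb_tensor[OF N C] using mat_iter_Suc[of "Suc n" k A]
    by (simp add: iter_def N_def C_def del: mat_iter.simps)
  also have "\<dots> = emb (Suc N) (rot_step N C - tensor (1\<^sub>m 2) C)"
    by (rule emb_diff[OF rot_step_carrier[OF N C] X, symmetric])
  also have "(norm2 \<tau> \<dots>)\<^sup>2 = (frobenius_norm (rot_step N C - tensor (1\<^sub>m 2) C))\<^sup>2 / 2 ^ Suc N"
    by (rule norm2_emb[OF _ minus_carrier_mat[OF X]]) simp
  also have "\<dots> \<le> S / 2 ^ Suc N"
    using frobenius_rot_step[OF N C] energy_mat_iter[OF A, of n]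
    by (intro divide_right_mono) (simp_all add: S_def N_def C_def del: mat_iter.simps)
  also have "\<dots> \<le> S / 2 ^ n"
    using S by (intro divide_left_mono power_increasing) (simp_all add: N_def)
  also have "S / 2 ^ n = (sqrt S * (1 / sqrt 2) ^ n)\<^sup>2"
    using S by (simp add: power_mult_distrib power_divide flip: power_mult) (simp add: power_mult mult.commute[of n])
  finally show ?thesis
    unfolding S_def[symmetric] by (rule power2_le_imp_le) (use S in simp)
qed

lemma iter_converges:
  assumes A: "A \<in> carrier_mat (2 ^ k) (2 ^ k)"
  obtains a where "a \<in> M" "strong_lim (iter k A) a"
proof -
  obtain K where K: "K \<ge> 0" "\<And>n. op_bound K (iter k A n)"
    using iter_op_bound[OF A] by blast
  have "summable (\<lambda>n. sqrt (3 * energy (2 ^ (k - 1)) A) * (1 / sqrt 2) ^ n)"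
    by (intro summable_mult summable_geometric) simp
  from norm2_Cauchy_of_summable[OF iter_M[OF k] norm2_iter_step[OF A] this]
  show thesis
    using that by (rule strong_lim_of_norm2_Cauchy[OF iter_M[OF k] K(2,1)])
qed

lemma iter_preserves:
  assumes A: "A \<in> carrier_mat (2 ^ k) (2 ^ k)" and lim: "strong_lim (iter k A) a"
  shows "mat_projection A \<Longrightarrow> projection a"
    and "mat_self_adjoint A \<Longrightarrow> self_adjoint a"
    and "mat_positive A \<Longrightarrow> positive_op a"
proof -
  obtain K where K: "K \<ge> 0" "\<And>n. op_bound K (iter k A n)"
    using iter_op_bound[OF A] by blast
  have ind: "P (iter k A n)" if 0: "P (emb k A)"
    and Suc: "\<And>w T. adj w * w = 1 \<Longrightarrow> P T \<Longrightarrow> P (w * T * adj w)" for P n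
  proof (induction n)
    case (Suc n)
    obtain w where "adj w * w = 1" "iter k A (Suc n) = w * iter k A n * adj w"
      using iter_Suc[of n] A by metis
    then show ?case
      using Suc that(2) by simp
  qed (simp add: iter_0 0)
  show "projection a" if p: "mat_projection A"
  proof (rule strong_lim_projection[OF lim ind[where P = projection] K(2)])
    show "projection (emb k A)"
      using p emb_mult[OF k A A] emb_adj[OF k A] by (simp add: mat_projection_def projection_def)
  qed (rule projection_conj)
  show "self_adjoint a" if s: "mat_self_adjoint A"
    unfolding self_adjoint_def
  proof (rule strong_lim_adj[OF lim ind[where P = "\<lambda>T. adj T = T"]])
    show "adj (emb k A) = emb k A"
      using s emb_adj[OF k A] by (simp add: mat_self_adjoint_def)
  qed (simp add: mult.assoc)
  show "positive_op a" if "mat_positive A"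
    by (rule strong_lim_positive[OF lim ind[where P = positive_op]]) (use that k A in \<open>auto intro: emb_positive positive_conj\<close>)
qed

text \<open>Both sequences are conjugated by the same element at each step, so the trace norm of
  their difference is constant in \<open>n\<close>; the factor \<open>1 / 2 ^ k\<close> is the trace
  normalization at the initial level.\<close>

lemma norm2_iter_limit:
  assumes A: "A \<in> carrier_mat (2 ^ k) (2 ^ k)" and B: "B \<in> carrier_mat (2 ^ k) (2 ^ k)"
    and a: "strong_lim (iter k A) a" and b: "strong_lim (iter k B) b"
  shows "(norm2 \<tau> (b - a))\<^sup>2 = (frobenius_norm (B - A))\<^sup>2 / 2 ^ k"
proof -
  let ?X = "\<lambda>n. iter k B n - iter k A n"
  obtain K where K: "K \<ge> 0" "\<And>n. op_bound K (iter k A n)"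
    using iter_op_bound[OF A] by blast
  obtain L where L: "L \<ge> 0" "\<And>n. op_bound L (iter k B n)"
    using iter_op_bound[OF B] by blast
  have XM: "?X n \<in> M" for n
    by (intro M_diff iter_M k)
  have "norm2 \<tau> (?X n) = norm2 \<tau> (emb k (B - A))" for n
  proof (induction n)
    case (Suc n)
    obtain w where w: "adj w * w = 1" "w \<in> M"
      "\<And>A. A \<in> carrier_mat (2 ^ k) (2 ^ k) \<Longrightarrow> iter k A (Suc n) = w * iter k A n * adj w"
      using iter_Suc[of n] by metis
    have "?X (Suc n) = w * ?X n * adj w"
      by (simp add: w(3)[OF A] w(3)[OF B] left_diff_distrib right_diff_distrib)
    then show ?case
      using norm2_conj[OF w(1,2) XM] Suc by simp
  qed (simp add: iter_0 emb_diff[OF B A])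
  then have "(norm2 \<tau> (?X n))\<^sup>2 = (frobenius_norm (B - A))\<^sup>2 / 2 ^ k" for n
    using norm2_emb[OF k minus_carrier_mat[OF A, of B]] by simp
  moreover have "(\<lambda>n. (norm2 \<tau> (?X n))\<^sup>2) \<longlonglongrightarrow> (norm2 \<tau> (b - a))\<^sup>2"
    by (rule norm2_strong_lim[OF strong_lim_diff[OF b a] XM op_bound_diff[OF L(2) K(2)]]) (use K L in simp)
  ultimately show ?thesis
    by (simp add: LIMSEQ_const_iff)
qed

end

subsection \<open>Conditional expectation\<close>

definition diag_op :: "nat \<Rightarrow> (nat \<Rightarrow> complex) \<Rightarrow> 'h cop" where
  "diag_op k c = (\<Sum>i<2 ^ k. c i *\<^sub>C v k i i)"

end

text \<open>Continuity is not among the axioms of \<open>E\<close>. The identity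
  \<open>\<tau> (c * E S) = \<tau> (c * S)\<close> for \<open>c\<close> in \<A> transfers the limit
  to the trace, where normality is available.\<close>

lemma (in tracial_algebra) cond_exp_strong_lim:
  assumes E: "trace_preserving_cond_exp M \<tau> \<A> E" and \<A>: "star_subalgebra \<A>" "\<A> \<subseteq> M" "1 \<in> \<A>"
    and X: "strong_lim X a" "\<And>n. X n \<in> M" "\<And>n. op_bound K (X n)"
    and D: "strong_lim (\<lambda>n. E (X n)) T" "T \<in> \<A>" "\<And>n. op_bound L (E (X n))"
  shows "E a = T"
proof -
  have a: "a \<in> M"
    by (rule M_strong_lim[OF X(1,2)])
  have EA: "E S \<in> \<A>" and E_mod: "c \<in> \<A> \<Longrightarrow> E (c * S) = c * E S" and E_tr: "\<tau> (E S) = \<tau> S"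
    if "S \<in> M" for S c
  proof -
    show "E S \<in> \<A>" "\<tau> (E S) = \<tau> S"
      using E that unfolding trace_preserving_cond_exp_def by auto
    \<comment> \<open>The module property is two-sided; the unit fills the right-hand place.\<close>
    have "E (c * S * 1) = c * E S * 1" if "c \<in> \<A>"
      using E that \<A>(3) \<open>S \<in> M\<close> unfolding trace_preserving_cond_exp_def by blast
    then show "E (c * S) = c * E S" if "c \<in> \<A>"
      using that by simp
  qed
  \<comment> \<open>Testing against the adjoint of the expected zero turns equality of traces into
    \<open>norm2 \<tau> (E a - T) = 0\<close>.\<close>
  define c where "c = adj (E a - T)"
  have "E a + (- 1) *\<^sub>C T \<in> \<A>"
    using EA[OF a] D(2) \<A>(1) unfolding star_subalgebra_def by blast
  then have "E a - T \<in> \<A>"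
    by (simp add: scaleC_cop_simps)
  then have c: "c \<in> \<A>" "c \<in> M"
    using \<A> unfolding c_def star_subalgebra_def by auto
  obtain J where J: "J \<ge> 0" "op_bound J c"
    by (rule op_bound_exists)
  have tr: "\<tau> (c * E S) = \<tau> (c * S)" if "S \<in> M" for S
    using E_mod[OF that c(1)] E_tr[of "c * S"] c(2) that by simp
  have "(\<lambda>n. \<tau> (c * X n)) \<longlonglongrightarrow> \<tau> (c * a)"
    by (rule trace_strong_lim[OF strong_lim_mult[OF strong_lim_const J(2) X(1)] _ op_bound_mult[OF J(2) X(3) J(1)]])
      (use X c in auto)
  moreover have "(\<lambda>n. \<tau> (c * E (X n))) \<longlonglongrightarrow> \<tau> (c * T)"
    by (rule trace_strong_lim[OF strong_lim_mult[OF strong_lim_const J(2) D(1)] _ op_bound_mult[OF J(2) D(3) J(1)]])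
      (intro M_mult c(2) subsetD[OF \<A>(2) EA[OF X(2)]])
  ultimately have "\<tau> (c * a) = \<tau> (c * T)"
    using tr[OF X(2)] LIMSEQ_unique by force
  then have "\<tau> (c * E a) - \<tau> (c * T) = 0"
    using tr[OF a] by simp
  moreover have ET: "E a \<in> M" "T \<in> M"
    using EA[OF a] D(2) \<A>(2) by auto
  ultimately have "\<tau> (adj (E a - T) * (E a - T)) = 0"
    using c(2) trace_diff[of "c * E a" "c * T"] by (simp add: c_def right_diff_distrib del: adj_diff)
  then have "norm2 \<tau> (E a - T) = 0"
    by (simp add: norm2_def)
  then show ?thesis
    using norm2_eq_zero[of "E a - T"] ET by simp
qed

text \<open>Off the diagonal, \<open>v k i j\<close> is compressed between the orthogonal
  projections \<open>v k i i\<close> and \<open>v k j j\<close>. Both lie in \<A> and commute with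
  its expectation, so they meet and annihilate it.\<close>

lemma (in dyadic_units) cond_exp_emb:
  assumes E: "trace_preserving_cond_exp M \<tau> \<A> E" and k: "k \<ge> 1"
    and v\<A>: "\<And>i. i < 2 ^ k \<Longrightarrow> v k i i \<in> \<A>" and comm: "\<And>a b. a \<in> \<A> \<Longrightarrow> b \<in> \<A> \<Longrightarrow> a * b = b * a"
  shows "E (emb k C) = diag_op k (\<lambda>i. C $$ (i, i))"
proof -
  have EA: "E T \<in> \<A>" and E_scale: "E (c *\<^sub>C T) = c *\<^sub>C E T" if "T \<in> M" for T c
    using E that unfolding trace_preserving_cond_exp_def by auto
  have E_add: "E (S + T) = E S + E T" if "S \<in> M" "T \<in> M" for S T
    using E that unfolding trace_preserving_cond_exp_def by auto
  have E_mod: "E (a * T * b) = a * E T * b" if "a \<in> \<A>" "b \<in> \<A>" "T \<in> M" for a b T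
    using E that unfolding trace_preserving_cond_exp_def by auto
  have E_id: "E a = a" if "a \<in> \<A>" for a
    using E that unfolding trace_preserving_cond_exp_def by auto
  have E_zero: "E 0 = 0"
    using E_scale[of 0 0] by (simp add: scaleC_cop_simps)
  have E_sum: "E (sum g I) = (\<Sum>i\<in>I. E (g i))" if "\<And>i. i \<in> I \<Longrightarrow> g i \<in> M" for g and I :: "nat set"
    using that by (induction I rule: infinite_finite_induct) (auto simp: E_zero E_add)
  have E_v: "E (v k i j) = (if i = j then v k i i else 0)" if ij: "i < 2 ^ k" "j < 2 ^ k" for i j
  proof (cases "i = j")
    case False
    have "E (v k i j) = E (v k i i * v k i j * v k j j)"
      using v_mult[OF k] ij by simp
    also have "\<dots> = v k i i * E (v k i j) * v k j j"
      using ij by (intro E_mod v\<A> v_M[OF k])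
    also have "\<dots> = E (v k i j) * (v k i i * v k j j)"
      using comm[OF v\<A>[OF ij(1)] EA[OF v_M[OF k ij]]] by (simp add: mult.assoc)
    also have "\<dots> = 0"
      using v_mult[OF k] ij False by simp
    finally show ?thesis
      using False by simp
  qed (use E_id v\<A> ij in simp)
  have "E (emb k C) = (\<Sum>i<2 ^ k. E (\<Sum>j<2 ^ k. C $$ (i, j) *\<^sub>C v k i j))"
    unfolding emb_def by (intro E_sum M_sum M_scaleC v_M k) auto
  also have "\<dots> = (\<Sum>i<2 ^ k. \<Sum>j<2 ^ k. E (C $$ (i, j) *\<^sub>C v k i j))"
    by (intro sum.cong refl E_sum M_scaleC v_M k) auto
  also have "\<dots> = (\<Sum>i<2 ^ k. \<Sum>j<2 ^ k. if i = j then C $$ (i, i) *\<^sub>C v k i i else 0)"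
    using E_scale v_M[OF k] by (intro sum.cong refl) (auto simp: E_v scaleC_cop_simps)
  finally show ?thesis
    by (simp add: diag_op_def)
qed

subsection \<open>The diagonal of the iterates\<close>

text \<open>The diagonal of a matrix of size \<open>2 ^ N\<close> describes the function that is linear on each dyadic interval
  of level \<open>N - 1\<close> and takes there the values of two consecutive diagonal entries as one-sided
  limits at the end points.\<close>

definition diag_linear :: "(real \<Rightarrow> complex) \<Rightarrow> nat \<Rightarrow> complex mat \<Rightarrow> bool" where
  "diag_linear f N C \<longleftrightarrow> (\<forall>q<2 ^ (N - 1). \<forall>t. real q \<le> 2 ^ (N - 1) * t \<longrightarrow> 2 ^ (N - 1) * t < real q + 1 \<longrightarrow>
    f t = blk C q q 0 0 + complex_of_real (2 ^ (N - 1) * t - real q) * (blk C q q 1 1 - blk C q q 0 0))"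

text \<open>For a matrix satisfying \<open>diag_linear f N C\<close>, this controls the oscillation
  of \<open>f\<close> on dyadic intervals of level \<open>N - 1\<close>; a rotation step halves
  it.\<close>

definition diag_gap :: "real \<Rightarrow> nat \<Rightarrow> complex mat \<Rightarrow> bool" where
  "diag_gap \<delta> N C \<longleftrightarrow> (\<forall>q<2 ^ (N - 1). cmod (blk C q q 1 1 - blk C q q 0 0) \<le> \<delta>)"

lemma rot_step_diag_blk:
  assumes N: "N \<ge> 1" and C: "C \<in> carrier_mat (2 ^ N) (2 ^ N)" and q: "q < 2 ^ (N - 1)"
  defines "R \<equiv> rot_step N C" and "a \<equiv> blk C q q 0 0" and "d \<equiv> blk C q q 1 1"
  shows "blk R (2 * q) (2 * q) 0 0 = a" "blk R (2 * q) (2 * q) 1 1 = (a + d) / 2"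
    "blk R (2 * q + 1) (2 * q + 1) 0 0 = (a + d) / 2" "blk R (2 * q + 1) (2 * q + 1) 1 1 = d"
proof -
  have *: "blk R (2 * q + t) (2 * q + t) x x = R $$ (4 * q + (2 * t + x), 4 * q + (2 * t + x))" for t x
    by (simp add: blk_def algebra_simps)
  note B = rot_step_block[OF N C q q, folded R_def]
  show "blk R (2 * q) (2 * q) 0 0 = a"
    using *[of 0 0] B[of 0 0] by (simp add: a_def)
  show "blk R (2 * q) (2 * q) 1 1 = (a + d) / 2"
    using *[of 0 1] B[of 1 1] by (simp add: a_def d_def)
  show "blk R (2 * q + 1) (2 * q + 1) 0 0 = (a + d) / 2"
    using *[of 1 0] B[of 2 2] by (simp add: a_def d_def)
  show "blk R (2 * q + 1) (2 * q + 1) 1 1 = d"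
    using *[of 1 1] B[of 3 3] by (simp add: d_def)
qed

lemma diag_gap_rot_step:
  assumes N: "N \<ge> 1" and C: "C \<in> carrier_mat (2 ^ N) (2 ^ N)" and gap: "diag_gap \<delta> N C"
  shows "diag_gap (\<delta> / 2) (Suc N) (rot_step N C)"
  unfolding diag_gap_def
proof (intro allI impI)
  fix q' :: nat assume "q' < 2 ^ (Suc N - 1)"
  then have "q' < 2 * 2 ^ (N - 1)"
    using N by (simp flip: power_Suc)
  then have q: "q' div 2 < 2 ^ (N - 1)"
    by auto
  define q where "q = q' div 2"
  let ?a = "blk C q q 0 0" and ?d = "blk C q q 1 1"
  have half: "cmod ((?a + ?d) / 2 - ?a) = cmod (?d - ?a) / 2" "cmod (?d - (?a + ?d) / 2) = cmod (?d - ?a) / 2"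
  proof -
    have "(?a + ?d) / 2 - ?a = (?d - ?a) / 2" "?d - (?a + ?d) / 2 = (?d - ?a) / 2"
      by (simp_all add: field_simps)
    then show "cmod ((?a + ?d) / 2 - ?a) = cmod (?d - ?a) / 2" "cmod (?d - (?a + ?d) / 2) = cmod (?d - ?a) / 2"
      by (simp_all only: norm_divide norm_numeral)
  qed
  have "cmod (?d - ?a) \<le> \<delta>"
    using gap q by (simp add: diag_gap_def q_def)
  moreover have "q' = 2 * q \<or> q' = 2 * q + 1"
    unfolding q_def by presburger
  ultimately show "cmod (blk (rot_step N C) q' q' 1 1 - blk (rot_step N C) q' q' 0 0) \<le> \<delta> / 2"
    using rot_step_diag_blk[OF N C q[folded q_def]] half by (elim disjE; simp only:)
qed

text \<open>In the coordinate \<open>s\<close> of level \<open>N - 1\<close> the two child intervals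
  meet at \<open>q + 1/2\<close>, where the line takes the value \<open>(a + d) / 2\<close>; both
  children thus carry pieces of the same line.\<close>

lemma diag_linear_rot_step:
  assumes N: "N \<ge> 1" and C: "C \<in> carrier_mat (2 ^ N) (2 ^ N)" and lin: "diag_linear f N C"
  shows "diag_linear f (Suc N) (rot_step N C)"
  unfolding diag_linear_def
proof (intro allI impI)
  fix q' :: nat and t :: real
  define s where "s = 2 ^ (N - 1) * t"
  have s: "2 ^ (Suc N - 1) * t = 2 * s"
    using N by (simp add: s_def flip: power_Suc)
  assume "q' < 2 ^ (Suc N - 1)" and t: "real q' \<le> 2 ^ (Suc N - 1) * t" "2 ^ (Suc N - 1) * t < real q' + 1"
  then have "q' < 2 * 2 ^ (N - 1)"
    using N by (simp flip: power_Suc)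
  then have q: "q' div 2 < 2 ^ (N - 1)"
    by auto
  define q where "q = q' div 2"
  note q = q[folded q_def]
  let ?a = "blk C q q 0 0" and ?d = "blk C q q 1 1"
  note R = rot_step_diag_blk[OF N C q]
  have cases: "q' = 2 * q \<or> q' = 2 * q + 1"
    unfolding q_def by presburger
  then have "real q \<le> s" "s < real q + 1"
    using t unfolding s by auto
  then have ft: "f t = ?a + complex_of_real (s - real q) * (?d - ?a)"
    using lin q unfolding diag_linear_def s_def by blast
  from cases show "f t = blk (rot_step N C) q' q' 0 0
      + complex_of_real (2 ^ (Suc N - 1) * t - real q') * (blk (rot_step N C) q' q' 1 1 - blk (rot_step N C) q' q' 0 0)"
  proof
    assume q': "q' = 2 * q"
    show ?thesis
      unfolding ft s q' R by (simp add: field_simps)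
  next
    assume q': "q' = 2 * q + 1"
    show ?thesis
      unfolding ft s q' R by (simp add: field_simps)
  qed
qed

text \<open>An even entry is the value at the left end of the interval of level
  \<open>N - 1\<close>, an odd one the limit at its right end; \<open>f\<close> is within the gap of
  either.\<close>

lemma diag_linear_approx:
  assumes N: "N \<ge> 1" and lin: "diag_linear f N C" and gap: "diag_gap \<delta> N C"
    and i: "i < 2 ^ N" and t: "real i \<le> 2 ^ N * t" "2 ^ N * t < real i + 1"
  shows "cmod (f t - C $$ (i, i)) \<le> \<delta>"
proof -
  define q where "q = i div 2"
  define s where "s = 2 ^ (N - 1) * t"
  let ?a = "blk C q q 0 0" and ?d = "blk C q q 1 1"
  have s: "2 ^ N * t = 2 * s"
    using N by (simp add: s_def flip: power_Suc)
  have "i < 2 * 2 ^ (N - 1)"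
    using i N by (simp flip: power_Suc)
  then have q: "q < 2 ^ (N - 1)"
    by (auto simp: q_def)
  have cases: "i = 2 * q \<or> i = 2 * q + 1"
    unfolding q_def by presburger
  then have sq: "real q \<le> s" "s < real q + 1"
    using t unfolding s by auto
  then have ft: "f t = ?a + complex_of_real (s - real q) * (?d - ?a)"
    using lin q unfolding diag_linear_def s_def by blast
  have gap': "cmod (?d - ?a) \<le> \<delta>"
    using gap q by (simp add: diag_gap_def)
  have le: "cmod (complex_of_real r * (?d - ?a)) \<le> \<delta>" if "\<bar>r\<bar> \<le> 1" for r
    using mult_mono[OF that gap'] by (simp add: norm_mult)
  from cases show ?thesis
  proof
    assume "i = 2 * q"
    then have "f t - C $$ (i, i) = complex_of_real (s - real q) * (?d - ?a)"
      by (simp add: ft blk_def)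
    then show ?thesis
      using le[of "s - real q"] sq by simp
  next
    assume "i = 2 * q + 1"
    then have "f t - C $$ (i, i) = complex_of_real (s - real q - 1) * (?d - ?a)"
      by (simp add: ft blk_def algebra_simps)
    then show ?thesis
      using le[of "s - real q - 1"] sq by simp
  qed
qed

subsection \<open>Diagonal operators\<close>

context dyadic_units
begin

lemma v_diag:
  assumes "k \<ge> 1" "i < 2 ^ k"
  shows "v k i i \<in> M" "adj (v k i i) = v k i i" "v k i i * v k i i = v k i i"
    and "cinner x (app (v k i i) x) = complex_of_real ((norm (app (v k i i) x))\<^sup>2)"
proof -
  show 1: "v k i i \<in> M" "adj (v k i i) = v k i i" "v k i i * v k i i = v k i i"
    using assms by (simp_all add: v_M v_adj v_mult)
  show "cinner x (app (v k i i) x) = complex_of_real ((norm (app (v k i i) x))\<^sup>2)"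
    using cinner_adj_mult[of x "v k i i" x] 1 by (simp add: cinner_self)
qed

lemma diag_op_M: "k \<ge> 1 \<Longrightarrow> diag_op k c \<in> M"
  unfolding diag_op_def by (intro M_sum M_scaleC v_M) auto

lemma diag_op_cong: "(\<And>i. i < 2 ^ k \<Longrightarrow> c i = d i) \<Longrightarrow> diag_op k c = diag_op k d"
  unfolding diag_op_def by (intro sum.cong refl) auto

lemma diag_op_add: "diag_op k c + diag_op k d = diag_op k (\<lambda>i. c i + d i)"
  by (simp add: diag_op_def scaleC_cop_simps sum.distrib)

lemma diag_op_diff: "diag_op k c - diag_op k d = diag_op k (\<lambda>i. c i - d i)"
  by (simp add: diag_op_def scaleC_cop_simps sum_subtractf)

lemma diag_op_adj: "k \<ge> 1 \<Longrightarrow> adj (diag_op k c) = diag_op k (\<lambda>i. cnj (c i))"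
  unfolding diag_op_def adj_sum by (intro sum.cong refl) (auto simp: v_adj)

lemma diag_op_mult:
  assumes k: "k \<ge> 1"
  shows "diag_op k c * diag_op k d = diag_op k (\<lambda>i. c i * d i)"
proof -
  have "diag_op k c * diag_op k d = (\<Sum>i<2 ^ k. \<Sum>j<2 ^ k. (c i *\<^sub>C v k i i) * (d j *\<^sub>C v k j j))"
    unfolding diag_op_def unfolding sum_distrib_right unfolding sum_distrib_left ..
  also have "\<dots> = (\<Sum>i<2 ^ k. \<Sum>j<2 ^ k. if i = j then (c i * d i) *\<^sub>C v k i i else 0)"
    using k by (intro sum.cong refl) (auto simp: scaleC_cop_simps v_mult mult.commute)
  finally show ?thesis
    by (simp add: diag_op_def)
qed

lemma diag_op_one: "k \<ge> 1 \<Longrightarrow> diag_op k (\<lambda>i. 1) = 1"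
  by (simp add: diag_op_def scaleC_cop_simps v_sum)

lemma diag_op_zero: "diag_op k (\<lambda>i. 0) = 0"
  by (simp add: diag_op_def scaleC_cop_simps)

lemma trace_diag_op: "k \<ge> 1 \<Longrightarrow> \<tau> (diag_op k c) = (\<Sum>i<2 ^ k. c i) / 2 ^ k"
proof -
  assume k: "k \<ge> 1"
  have "\<tau> (diag_op k c) = (\<Sum>i<2 ^ k. \<tau> (c i *\<^sub>C v k i i))"
    unfolding diag_op_def by (intro trace_sum M_scaleC v_M k) auto
  also have "\<dots> = (\<Sum>i<2 ^ k. c i / 2 ^ k)"
    using k by (intro sum.cong refl) (auto simp: trace_scaleC v_M trace_v)
  finally show ?thesis
    by (simp add: sum_divide_distrib)
qed

lemma norm2_diag_op:
  assumes k: "k \<ge> 1"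
  shows "(norm2 \<tau> (diag_op k c))\<^sup>2 = (\<Sum>i<2 ^ k. (cmod (c i))\<^sup>2) / 2 ^ k"
proof -
  have "complex_of_real ((norm2 \<tau> (diag_op k c))\<^sup>2) = (\<Sum>i<2 ^ k. cnj (c i) * c i) / 2 ^ k"
    unfolding norm2_sq'[OF diag_op_M[OF k]] diag_op_adj[OF k] diag_op_mult[OF k] trace_diag_op[OF k] ..
  also have "\<dots> = complex_of_real ((\<Sum>i<2 ^ k. (cmod (c i))\<^sup>2) / 2 ^ k)"
    unfolding of_real_divide of_real_sum complex_norm_square by (simp add: mult.commute)
  finally show ?thesis
    unfolding of_real_eq_iff .
qed

lemma norm2_diag_op_le:
  assumes k: "k \<ge> 1" and c: "\<And>i. i < 2 ^ k \<Longrightarrow> cmod (c i) \<le> K" and K: "K \<ge> 0"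
  shows "norm2 \<tau> (diag_op k c) \<le> K"
proof (rule power2_le_imp_le[OF _ K])
  have "(\<Sum>i<2 ^ k. (cmod (c i))\<^sup>2) \<le> (\<Sum>i<(2::nat) ^ k. K\<^sup>2)"
    using c by (intro sum_mono power_mono) auto
  then show "(norm2 \<tau> (diag_op k c))\<^sup>2 \<le> K\<^sup>2"
    by (simp add: norm2_diag_op[OF k] divide_le_eq mult.commute)
qed

lemma cinner_diag_op:
  assumes k: "k \<ge> 1"
  shows "cinner x (app (diag_op k c) x) = (\<Sum>i<2 ^ k. c i * complex_of_real ((norm (app (v k i i) x))\<^sup>2))"
  unfolding diag_op_def sum_app cinner_sum_right app_cop cinner_scaleC_right
  using v_diag(4)[OF k] by (intro sum.cong refl) auto

lemma norm_diag_op: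
  assumes k: "k \<ge> 1"
  shows "(norm (app (diag_op k c) x))\<^sup>2 = (\<Sum>i<2 ^ k. (cmod (c i))\<^sup>2 * (norm (app (v k i i) x))\<^sup>2)"
proof -
  have "complex_of_real ((norm (app (diag_op k c) x))\<^sup>2) = cinner x (app (diag_op k (\<lambda>i. cnj (c i) * c i)) x)"
    unfolding cinner_self[symmetric] cinner_adj_mult[symmetric] diag_op_adj[OF k] diag_op_mult[OF k] ..
  also have "\<dots> = complex_of_real (\<Sum>i<2 ^ k. (cmod (c i))\<^sup>2 * (norm (app (v k i i) x))\<^sup>2)"
    unfolding cinner_diag_op[OF k] of_real_sum of_real_mult complex_norm_square by (simp add: mult.commute)
  finally show ?thesis
    unfolding of_real_eq_iff .
qed

lemma sum_norm_v: "k \<ge> 1 \<Longrightarrow> (\<Sum>i<2 ^ k. (norm (app (v k i i) x))\<^sup>2) = (norm x)\<^sup>2"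
  using norm_diag_op[of k "\<lambda>i. 1" x] by (simp add: diag_op_one)

lemma op_bound_diag_op:
  assumes k: "k \<ge> 1" and c: "\<And>i. i < 2 ^ k \<Longrightarrow> cmod (c i) \<le> K" and K: "K \<ge> 0"
  shows "op_bound K (diag_op k c)"
  unfolding op_bound_def
proof
  fix x
  have "(norm (app (diag_op k c) x))\<^sup>2 \<le> (\<Sum>i<2 ^ k. K\<^sup>2 * (norm (app (v k i i) x))\<^sup>2)"
    unfolding norm_diag_op[OF k] using c by (intro sum_mono mult_right_mono power_mono) auto
  also have "\<dots> = (K * norm x)\<^sup>2"
    unfolding sum_distrib_left[symmetric] sum_norm_v[OF k] power_mult_distrib ..
  finally show "norm (app (diag_op k c) x) \<le> K * norm x"
    by (rule power2_le_imp_le) (use K in simp)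
qed

lemma diag_op_refine: "k \<ge> 1 \<Longrightarrow> diag_op k c = diag_op (Suc k) (\<lambda>i. c (i div 2))"
proof -
  assume k: "k \<ge> 1"
  have two: "(2 :: nat) ^ Suc k = 2 ^ k * 2"
    by simp
  have "c q *\<^sub>C v (Suc k) (2 * q) (2 * q) + c q *\<^sub>C v (Suc k) (Suc (2 * q)) (Suc (2 * q)) = c q *\<^sub>C v k q q"
    if "q < 2 ^ k" for q
    unfolding v_coherent[OF k that that, symmetric] by (simp add: scaleC_cop_simps)
  then show ?thesis
    unfolding diag_op_def two sum_lessThan_times sum_lessThan_2 by (intro sum.cong refl) auto
qed

lemma diag_op_refine_add: "k \<ge> 1 \<Longrightarrow> diag_op k c = diag_op (k + m) (\<lambda>i. c (i div 2 ^ m))"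
proof (induction m)
  case (Suc m)
  then show ?case
    using diag_op_refine[of "k + m" "\<lambda>i. c (i div 2 ^ m)"] by (simp add: div_mult2_eq)
qed simp

end

subsection \<open>The spectral measure of a dyadic system\<close>

text \<open>Without division, splitting an interval is linear arithmetic. Half-open intervals make
  each level an exact partition of \<open>{0..<1}\<close>, and the index is zero-based.\<close>

definition dyadic_ivl :: "nat \<Rightarrow> nat \<Rightarrow> real set" where
  "dyadic_ivl k i = {t. real i \<le> 2 ^ k * t \<and> 2 ^ k * t < real i + 1}"

lemma dyadic_ivl_eq: "dyadic_ivl k i = {real i / 2 ^ k ..< (real i + 1) / 2 ^ k}"
  by (auto simp: dyadic_ivl_def field_simps)

lemma dyadic_ivl_borel [measurable, simp]: "dyadic_ivl k i \<in> sets borel"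
  by (simp add: dyadic_ivl_eq)

lemma dyadic_ivl_finite: "S \<in> sets borel \<Longrightarrow> emeasure lborel (S \<inter> dyadic_ivl k i) \<noteq> \<infinity>"
proof -
  assume "S \<in> sets borel"
  have "emeasure lborel (S \<inter> dyadic_ivl k i) \<le> emeasure lborel (dyadic_ivl k i)"
    by (rule emeasure_mono) auto
  also have "\<dots> < \<infinity>"
    by (simp add: dyadic_ivl_eq field_simps)
  finally show ?thesis
    by simp
qed

lemma dyadic_ivl_disjoint: "i \<noteq> j \<Longrightarrow> dyadic_ivl k i \<inter> dyadic_ivl k j = {}"
  unfolding dyadic_ivl_def by (auto simp: less_Suc_eq_le)

lemma dyadic_ivl_split:
  "dyadic_ivl k i = dyadic_ivl (Suc k) (2 * i) \<union> dyadic_ivl (Suc k) (Suc (2 * i))"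
  unfolding dyadic_ivl_def by (auto simp: algebra_simps)

lemma dyadic_ivl_union: "(\<Union>i<2 ^ k. dyadic_ivl k i) = {0..<1}"
proof (intro equalityI subsetI)
  fix t :: real assume t: "t \<in> {0..<1}"
  define i where "i = nat \<lfloor>2 ^ k * t\<rfloor>"
  have i: "real i \<le> 2 ^ k * t" "2 ^ k * t < real i + 1"
    using t by (auto simp: i_def)
  have "real i < 2 ^ k"
    using i(1) t by (smt (verit) atLeastLessThan_iff mult_less_cancel_left2 zero_less_power)
  then have "i < 2 ^ k"
    by (metis of_nat_less_iff of_nat_numeral of_nat_power)
  then show "t \<in> (\<Union>i<2 ^ k. dyadic_ivl k i)"
    using i by (auto simp: dyadic_ivl_def)
next
  fix t assume "t \<in> (\<Union>i<2 ^ k. dyadic_ivl k i)"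
  then obtain i where i: "i < 2 ^ k" "real i \<le> 2 ^ k * t" "2 ^ k * t < real i + 1"
    by (auto simp: dyadic_ivl_def)
  then have "real i + 1 \<le> 2 ^ k"
    by (metis Suc_leI of_nat_Suc of_nat_le_iff of_nat_numeral of_nat_power add.commute)
  then have "2 ^ k * t < 2 ^ k * 1"
    using i(3) by linarith
  then have "t < 1"
    by (rule mult_left_less_imp_less) simp
  have "2 ^ k * 0 \<le> 2 ^ k * t"
    using i(2) of_nat_0_le_iff[of i, where 'a = real] by linarith
  then have "0 \<le> t"
    by (rule mult_left_le_imp_le) simp
  then show "t \<in> {0..<1}"
    using \<open>t < 1\<close> by simp
qed

text \<open>The mean of the indicator of \<open>S\<close> over the interval, that is, the value
  there of its conditional expectation given the dyadic intervals of level \<open>k\<close>.\<close>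

definition dyadic_avg :: "nat \<Rightarrow> real set \<Rightarrow> nat \<Rightarrow> real" where
  "dyadic_avg k S i = 2 ^ k * measure lborel (S \<inter> dyadic_ivl k i)"

lemma dyadic_avg_nonneg: "0 \<le> dyadic_avg k S i"
  by (simp add: dyadic_avg_def)

lemma dyadic_avg_full:
  assumes "dyadic_ivl k i \<subseteq> S"
  shows "dyadic_avg k S i = 1"
proof -
  have "S \<inter> dyadic_ivl k i = dyadic_ivl k i"
    using assms by auto
  moreover have "measure lborel (dyadic_ivl k i) = 1 / 2 ^ k"
    by (simp add: dyadic_ivl_eq field_simps)
  ultimately show ?thesis
    by (simp add: dyadic_avg_def)
qed

lemma dyadic_avg_empty: "S \<inter> dyadic_ivl k i = {} \<Longrightarrow> dyadic_avg k S i = 0"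
  by (simp add: dyadic_avg_def)

lemma dyadic_avg_add:
  assumes "S \<in> sets borel" "T \<in> sets borel" "S \<inter> T = {}"
  shows "dyadic_avg k (S \<union> T) i = dyadic_avg k S i + dyadic_avg k T i"
proof -
  have "measure lborel ((S \<inter> dyadic_ivl k i) \<union> (T \<inter> dyadic_ivl k i))
      = measure lborel (S \<inter> dyadic_ivl k i) + measure lborel (T \<inter> dyadic_ivl k i)"
    using assms by (intro measure_Union dyadic_ivl_finite) auto
  then show ?thesis
    by (simp add: dyadic_avg_def Int_Un_distrib2 distrib_left)
qed

lemma dyadic_avg_le_one: "S \<in> sets borel \<Longrightarrow> dyadic_avg k S i \<le> 1"
  using dyadic_avg_add[of S "- S" k i] dyadic_avg_nonneg[of k "- S" i] dyadic_avg_full[of k i UNIV]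
  by (simp add: Compl_partition)

lemma dyadic_avg_split:
  assumes S: "S \<in> sets borel"
  shows "dyadic_avg (Suc k) S (2 * i) + dyadic_avg (Suc k) S (Suc (2 * i)) = 2 * dyadic_avg k S i"
proof -
  have "measure lborel ((S \<inter> dyadic_ivl (Suc k) (2 * i)) \<union> (S \<inter> dyadic_ivl (Suc k) (Suc (2 * i))))
      = measure lborel (S \<inter> dyadic_ivl (Suc k) (2 * i)) + measure lborel (S \<inter> dyadic_ivl (Suc k) (Suc (2 * i)))"
    using S dyadic_ivl_disjoint[of "2 * i" "Suc (2 * i)" "Suc k"]
    by (intro measure_Union dyadic_ivl_finite) auto
  then show ?thesis
    by (simp add: dyadic_avg_def dyadic_ivl_split[of k i] Int_Un_distrib distrib_left)
qed

lemma sum_dyadic_avg: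
  assumes S: "S \<in> sets borel"
  shows "(\<Sum>i<2 ^ k. dyadic_avg k S i) / 2 ^ k = measure lborel (S \<inter> {0..<1})"
proof -
  have "measure lborel (\<Union>i<2 ^ k. S \<inter> dyadic_ivl k i) = (\<Sum>i<2 ^ k. measure lborel (S \<inter> dyadic_ivl k i))"
    using S dyadic_ivl_disjoint[of _ _ k] dyadic_ivl_finite[OF S]
    by (intro measure_finite_Union) (fastforce simp: disjoint_family_on_def)+
  moreover have "(\<Union>i<2 ^ k. S \<inter> dyadic_ivl k i) = S \<inter> {0..<1}"
    using dyadic_ivl_union[of k] by auto
  ultimately show ?thesis
    by (simp add: dyadic_avg_def flip: sum_distrib_left)
qed

text \<open>\<open>avg_op k S\<close> is the conditional expectation of the spectral projection of \<open>S\<close> onto the algebra of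
  dyadic level \<open>k\<close>. These operators form a martingale, so that their trace norms increase and their
  orthogonal increments tend to zero.\<close>

context dyadic_units
begin

definition avg_op :: "nat \<Rightarrow> real set \<Rightarrow> 'h cop" where
  "avg_op k S = diag_op k (\<lambda>i. complex_of_real (dyadic_avg k S i))"

text \<open>Existence of the limit for Borel sets is \<open>dyadic_pvm_lim\<close>; nothing is
  claimed for other sets. The sequence runs over \<open>Suc n\<close> because the matrix units start
  at level 1.\<close>

definition dyadic_pvm :: "real set \<Rightarrow> 'h cop" where
  "dyadic_pvm S = (SOME T. strong_lim (\<lambda>n. avg_op (Suc n) S) T)"

lemma avg_op_M: "k \<ge> 1 \<Longrightarrow> avg_op k S \<in> M"
  by (simp add: avg_op_def diag_op_M)

lemma avg_op_bound: "k \<ge> 1 \<Longrightarrow> S \<in> sets borel \<Longrightarrow> op_bound 1 (avg_op k S)"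
  unfolding avg_op_def by (intro op_bound_diag_op) (auto simp: dyadic_avg_nonneg dyadic_avg_le_one)

lemma avg_op_adj: "k \<ge> 1 \<Longrightarrow> adj (avg_op k S) = avg_op k S"
  by (simp add: avg_op_def diag_op_adj)

lemma avg_op_positive:
  assumes "k \<ge> 1"
  shows "positive_op (avg_op k S)"
  unfolding positive_op_def
proof
  fix x
  have "cinner x (app (avg_op k S) x) = complex_of_real (\<Sum>i<2 ^ k. dyadic_avg k S i * (norm (app (v k i i) x))\<^sup>2)"
    by (simp add: avg_op_def cinner_diag_op[OF assms])
  moreover have "0 \<le> (\<Sum>i<2 ^ k. dyadic_avg k S i * (norm (app (v k i i) x))\<^sup>2)"
    by (intro sum_nonneg mult_nonneg_nonneg dyadic_avg_nonneg) auto
  ultimately show "0 \<le> cinner x (app (avg_op k S) x)"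
    by (simp add: less_eq_complex_def)
qed

text \<open>The coefficients lie between 0 and 1, hence dominate their squares. In the limit this
  bounds the norm of a vector by the quadratic form before \<open>dyadic_pvm S\<close> is known to
  be idempotent, which is the situation in the proof of countable additivity.\<close>

lemma avg_op_norm_le:
  assumes k: "k \<ge> 1" and S: "S \<in> sets borel"
  shows "(norm (app (avg_op k S) x))\<^sup>2 \<le> Re (cinner x (app (avg_op k S) x))"
proof -
  have "(dyadic_avg k S i)\<^sup>2 \<le> dyadic_avg k S i" for i
    using dyadic_avg_nonneg[of k S i] dyadic_avg_le_one[OF S, of k i]
    by (simp add: power2_eq_square mult_left_le)
  then have "(norm (app (avg_op k S) x))\<^sup>2 \<le> (\<Sum>i<2 ^ k. dyadic_avg k S i * (norm (app (v k i i) x))\<^sup>2)"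
    unfolding avg_op_def norm_diag_op[OF k] by (intro sum_mono mult_right_mono) auto
  also have "\<dots> = Re (cinner x (app (avg_op k S) x))"
    by (simp add: avg_op_def cinner_diag_op[OF k])
  finally show ?thesis .
qed

lemma avg_op_add:
  assumes "S \<in> sets borel" "T \<in> sets borel" "S \<inter> T = {}"
  shows "avg_op k (S \<union> T) = avg_op k S + avg_op k T"
  by (simp add: avg_op_def diag_op_add dyadic_avg_add[OF assms])

lemma trace_avg_op:
  "k \<ge> 1 \<Longrightarrow> S \<in> sets borel \<Longrightarrow> \<tau> (avg_op k S) = complex_of_real (measure lborel (S \<inter> {0..<1}))"
  by (simp add: avg_op_def trace_diag_op sum_dyadic_avg[symmetric, of S k])

text \<open>The martingale property: the means over the two children of an interval add up to twice
  the mean over the parent, so pairing with a diagonal operator of level \<open>k\<close> does not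
  see the refinement.\<close>

lemma trace_avg_op_mult:
  assumes k: "k \<ge> 1" and S: "S \<in> sets borel"
  shows "\<tau> (avg_op (k + m) S * diag_op k c) = \<tau> (avg_op k S * diag_op k c)"
proof (induction m)
  case (Suc m)
  define l where "l = k + m"
  define d where "d = (\<lambda>i. c (i div 2 ^ m))"
  have l: "l \<ge> 1"
    using k by (simp add: l_def)
  have d: "diag_op k c = diag_op l d"
    using diag_op_refine_add[OF k, of c m] by (simp add: l_def d_def)
  have two: "(2 :: nat) ^ Suc l = 2 ^ l * 2"
    by simp
  have "\<tau> (avg_op (Suc l) S * diag_op l d) = (\<Sum>i<2 ^ Suc l. complex_of_real (dyadic_avg (Suc l) S i) * d (i div 2)) / 2 ^ Suc l"
    using l by (simp only: diag_op_refine[OF l] avg_op_def) (simp add: diag_op_mult trace_diag_op)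
  also have "(\<Sum>i<2 ^ Suc l. complex_of_real (dyadic_avg (Suc l) S i) * d (i div 2)) =
      (\<Sum>q<2 ^ l. 2 * (complex_of_real (dyadic_avg l S q) * d q))"
  proof -
    have "complex_of_real (dyadic_avg (Suc l) S (2 * q)) + complex_of_real (dyadic_avg (Suc l) S (Suc (2 * q)))
        = 2 * complex_of_real (dyadic_avg l S q)" for q
      unfolding of_real_add[symmetric] dyadic_avg_split[OF S] by simp
    then show ?thesis
      unfolding two sum_lessThan_times sum_lessThan_2
      by (intro sum.cong refl) (simp add: distrib_right[symmetric])
  qed
  also have "\<dots> / 2 ^ Suc l = \<tau> (avg_op l S * diag_op l d)"
    using l by (simp add: avg_op_def diag_op_mult trace_diag_op flip: sum_distrib_left)
  finally show ?case
    using Suc by (simp add: d l_def)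
qed simp

text \<open>Pythagoras: by the martingale property the increment is orthogonal to the level
  \<open>k\<close> operator.\<close>

lemma norm2_avg_op_diff:
  assumes k: "k \<ge> 1" and S: "S \<in> sets borel"
  shows "(norm2 \<tau> (avg_op (k + m) S - avg_op k S))\<^sup>2 = (norm2 \<tau> (avg_op (k + m) S))\<^sup>2 - (norm2 \<tau> (avg_op k S))\<^sup>2"
proof -
  let ?P = "avg_op (k + m) S" and ?Q = "avg_op k S"
  have M: "?P \<in> M" "?Q \<in> M"
    using k by (simp_all add: avg_op_M)
  have adj: "adj ?P = ?P" "adj ?Q = ?Q"
    using k by (simp_all add: avg_op_adj)
  have PQ: "\<tau> (?P * ?Q) = \<tau> (?Q * ?Q)" "\<tau> (?Q * ?P) = \<tau> (?Q * ?Q)"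
    using trace_avg_op_mult[OF k S, of m] trace_commute[OF M] by (simp_all add: avg_op_def)
  have "adj (?P - ?Q) * (?P - ?Q) = (?P * ?P - ?P * ?Q) - (?Q * ?P - ?Q * ?Q)"
    by (simp add: adj left_diff_distrib right_diff_distrib)
  then have "\<tau> (adj (?P - ?Q) * (?P - ?Q)) = \<tau> (?P * ?P) - \<tau> (?Q * ?Q)"
    using M by (simp only: trace_diff M_diff M_mult PQ) simp
  then show ?thesis
    using M by (simp add: norm2_sq adj del: adj_diff)
qed

lemma norm2_avg_op_le: "k \<ge> 1 \<Longrightarrow> S \<in> sets borel \<Longrightarrow> norm2 \<tau> (avg_op k S) \<le> 1"
  unfolding avg_op_def by (intro norm2_diag_op_le) (auto simp: dyadic_avg_nonneg dyadic_avg_le_one)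

lemma dyadic_pvm_lim:
  assumes S: "S \<in> sets borel"
  shows "strong_lim (\<lambda>n. avg_op (Suc n) S) (dyadic_pvm S)"
proof -
  define s where "s n = (norm2 \<tau> (avg_op (Suc n) S))\<^sup>2" for n
  have diff: "(norm2 \<tau> (avg_op (Suc n) S - avg_op (Suc m) S))\<^sup>2 = s n - s m" if "n \<ge> m" for m n
    using norm2_avg_op_diff[OF _ S, of "Suc m" "n - m"] that by (simp add: s_def)
  have "incseq s"
  proof (rule incseq_SucI)
    show "s n \<le> s (Suc n)" for n
      using diff[of n "Suc n"] zero_le_power2[of "norm2 \<tau> (avg_op (Suc (Suc n)) S - avg_op (Suc n) S)"] by simp
  qed
  moreover have "s n \<le> 1" for n
    using norm2_avg_op_le[OF _ S, of "Suc n"] norm2_nonneg[OF avg_op_M, of "Suc n" S]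
    by (simp add: s_def power_le_one)
  ultimately have "convergent s"
    by (intro Bseq_mono_convergent BseqI'[of _ 1]) (auto simp: incseq_def s_def)
  then have Cauchy: "Cauchy s"
    by (rule convergent_Cauchy)
  obtain T where "strong_lim (\<lambda>n. avg_op (Suc n) S) T"
  proof (rule strong_lim_of_norm2_Cauchy[where X = "\<lambda>n. avg_op (Suc n) S" and K = 1])
    fix e :: real assume e: "e > 0"
    then obtain N where N: "\<And>m n. m \<ge> N \<Longrightarrow> n \<ge> N \<Longrightarrow> \<bar>s n - s m\<bar> < e\<^sup>2"
      using metric_CauchyD[OF Cauchy, of "e\<^sup>2"] by (auto simp: dist_real_def)
    show "\<exists>N. \<forall>m\<ge>N. \<forall>n\<ge>m. norm2 \<tau> (avg_op (Suc n) S - avg_op (Suc m) S) < e"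
    proof (intro exI allI impI)
      fix m n assume mn: "N \<le> m" "m \<le> n"
      have "(norm2 \<tau> (avg_op (Suc n) S - avg_op (Suc m) S))\<^sup>2 < e\<^sup>2"
        unfolding diff[OF mn(2)] using N[of m n] mn by simp
      then show "norm2 \<tau> (avg_op (Suc n) S - avg_op (Suc m) S) < e"
        by (rule power2_less_imp_less) (use e in simp)
    qed
  qed (use S in \<open>auto simp: avg_op_M avg_op_bound\<close>)
  then show ?thesis
    unfolding dyadic_pvm_def by (rule someI)
qed

lemma dyadic_pvm_eq: "S \<in> sets borel \<Longrightarrow> strong_lim (\<lambda>n. avg_op (Suc n) S) T \<Longrightarrow> dyadic_pvm S = T"
  using dyadic_pvm_lim strong_lim_unique by blast

lemma dyadic_pvm_M: "S \<in> sets borel \<Longrightarrow> dyadic_pvm S \<in> M"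
  by (rule M_strong_lim[OF dyadic_pvm_lim]) (auto simp: avg_op_M)

lemma dyadic_pvm_adj: "S \<in> sets borel \<Longrightarrow> adj (dyadic_pvm S) = dyadic_pvm S"
  by (rule strong_lim_adj[OF dyadic_pvm_lim]) (auto simp: avg_op_adj)

lemma dyadic_pvm_positive: "S \<in> sets borel \<Longrightarrow> positive_op (dyadic_pvm S)"
  by (rule strong_lim_positive[OF dyadic_pvm_lim]) (auto simp: avg_op_positive)

lemma dyadic_pvm_bound: "S \<in> sets borel \<Longrightarrow> op_bound 1 (dyadic_pvm S)"
  by (rule strong_lim_op_bound[OF dyadic_pvm_lim]) (auto simp: avg_op_bound)

lemma dyadic_pvm_norm_le:
  assumes S: "S \<in> sets borel"
  shows "(norm (app (dyadic_pvm S) x))\<^sup>2 \<le> Re (cinner x (app (dyadic_pvm S) x))"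
proof (rule LIMSEQ_le)
  have lim: "(\<lambda>n. app (avg_op (Suc n) S) x) \<longlonglongrightarrow> app (dyadic_pvm S) x"
    using dyadic_pvm_lim[OF S] by (simp add: strong_lim_def)
  show "(\<lambda>n. (norm (app (avg_op (Suc n) S) x))\<^sup>2) \<longlonglongrightarrow> (norm (app (dyadic_pvm S) x))\<^sup>2"
    by (intro tendsto_intros lim)
  show "(\<lambda>n. Re (cinner x (app (avg_op (Suc n) S) x))) \<longlonglongrightarrow> Re (cinner x (app (dyadic_pvm S) x))"
    by (intro tendsto_intros tendsto_cinner lim)
qed (use avg_op_norm_le S in auto)

lemma dyadic_pvm_add:
  assumes "S \<in> sets borel" "T \<in> sets borel" "S \<inter> T = {}"
  shows "dyadic_pvm (S \<union> T) = dyadic_pvm S + dyadic_pvm T"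
  using assms by (intro dyadic_pvm_eq) (auto simp: avg_op_add intro!: strong_lim_add dyadic_pvm_lim)

lemma dyadic_pvm_empty: "S \<in> sets borel \<Longrightarrow> S \<inter> {0..<1} = {} \<Longrightarrow> dyadic_pvm S = 0"
proof (rule dyadic_pvm_eq)
  assume S: "S \<inter> {0..<1} = {}"
  have "avg_op k S = 0" for k
  proof -
    have "dyadic_avg k S i = 0" if "i < 2 ^ k" for i
      using S that dyadic_ivl_union[of k] by (intro dyadic_avg_empty) auto
    then have "avg_op k S = diag_op k (\<lambda>i. 0)"
      unfolding avg_op_def by (intro diag_op_cong) simp
    then show ?thesis
      by (simp add: diag_op_zero)
  qed
  then show "strong_lim (\<lambda>n. avg_op (Suc n) S) 0"
    by (simp add: strong_lim_const)
qed

lemma dyadic_pvm_UNIV: "dyadic_pvm UNIV = 1"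
proof (rule dyadic_pvm_eq)
  have "avg_op (Suc n) UNIV = 1" for n
    by (simp add: avg_op_def dyadic_avg_full diag_op_one)
  then show "strong_lim (\<lambda>n. avg_op (Suc n) UNIV) 1"
    by (simp add: strong_lim_const)
qed simp

lemma trace_dyadic_pvm:
  assumes S: "S \<in> sets borel"
  shows "\<tau> (dyadic_pvm S) = complex_of_real (measure lborel (S \<inter> {0..<1}))"
proof -
  have "(\<lambda>n. \<tau> (avg_op (Suc n) S)) \<longlonglongrightarrow> \<tau> (dyadic_pvm S)"
    by (rule trace_strong_lim[OF dyadic_pvm_lim[OF S], where K = 1]) (use S in \<open>auto simp: avg_op_M avg_op_bound\<close>)
  then show ?thesis
    using S by (simp add: trace_avg_op LIMSEQ_const_iff)
qed

text \<open>The induction varies \<open>k\<close> and \<open>i\<close>: the interval is replaced by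
  its two children, whose units add up to that of the parent.\<close>

lemma avg_op_dyadic_ivl: "k \<ge> 1 \<Longrightarrow> i < 2 ^ k \<Longrightarrow> avg_op (k + m) (dyadic_ivl k i) = v k i i"
proof (induction m arbitrary: k i)
  case 0
  have "complex_of_real (dyadic_avg k (dyadic_ivl k i) j) = (if j = i then 1 else 0)" for j
    using dyadic_avg_full[of k i "dyadic_ivl k i"] dyadic_avg_empty[of "dyadic_ivl k i" k j]
      dyadic_ivl_disjoint[of i j k] by auto
  then have "avg_op k (dyadic_ivl k i) = (\<Sum>j<2 ^ k. if j = i then v k i i else 0)"
    unfolding avg_op_def diag_op_def by (intro sum.cong refl) (auto simp: scaleC_cop_simps)
  then show ?case
    using 0 by simp
next
  case (Suc m)
  have "avg_op (Suc k + m) (dyadic_ivl k i) =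
      avg_op (Suc k + m) (dyadic_ivl (Suc k) (2 * i)) + avg_op (Suc k + m) (dyadic_ivl (Suc k) (Suc (2 * i)))"
    unfolding dyadic_ivl_split[of k i] by (intro avg_op_add dyadic_ivl_disjoint) auto
  also have "\<dots> = v k i i"
    using Suc.IH[of "Suc k" "2 * i"] Suc.IH[of "Suc k" "Suc (2 * i)"] Suc.prems v_coherent[of k i i] by simp
  finally show ?case
    by simp
qed

lemma dyadic_pvm_ivl:
  assumes k: "k \<ge> 1" and i: "i < 2 ^ k"
  shows "dyadic_pvm (dyadic_ivl k i) = v k i i"
proof (rule dyadic_pvm_eq)
  have "eventually (\<lambda>n. avg_op (Suc n) (dyadic_ivl k i) = v k i i) sequentially"
    unfolding eventually_sequentially
  proof (intro exI allI impI)
    show "avg_op (Suc n) (dyadic_ivl k i) = v k i i" if "n \<ge> k" for n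
      using avg_op_dyadic_ivl[OF k i, of "Suc n - k"] that by simp
  qed
  then show "strong_lim (\<lambda>n. avg_op (Suc n) (dyadic_ivl k i)) (v k i i)"
    unfolding strong_lim_def
    by (intro allI tendsto_eventually) (auto elim: eventually_mono)
qed simp

text \<open>The defect of multiplicativity at level \<open>k\<close> is supported on the single dyadic interval that contains the
  end point \<open>a\<close>.\<close>

lemma dyadic_pvm_Int_lessThan:
  assumes S: "S \<in> sets borel"
  shows "dyadic_pvm (S \<inter> {..<a}) = dyadic_pvm S * dyadic_pvm {..<a}"
proof -
  let ?T = "{..<a}"
  have ST: "S \<inter> ?T \<in> sets borel" "?T \<in> sets borel"
    using S by auto
  define D where "D n = avg_op (Suc n) (S \<inter> ?T) - avg_op (Suc n) S * avg_op (Suc n) ?T" for n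
  have "strong_lim D (dyadic_pvm (S \<inter> ?T) - dyadic_pvm S * dyadic_pvm ?T)"
    unfolding D_def using S ST
    by (intro strong_lim_diff strong_lim_mult[where K = 1] dyadic_pvm_lim) (auto simp: avg_op_bound)
  moreover have "strong_lim D 0"
  proof (rule strong_lim_of_norm2[where K = 2])
    have DM: "D n \<in> M" for n
      by (auto simp: D_def avg_op_M)
    then show "D n \<in> M" for n .
    have "op_bound (1 + 1 * 1) (D n)" for n
      unfolding D_def using S ST by (intro op_bound_diff op_bound_mult avg_op_bound) auto
    then show "op_bound 2 (D n - 0)" for n
      by simp
    have "(norm2 \<tau> (D n))\<^sup>2 \<le> 1 / 2 ^ Suc n" for n
    proof -
      define k where "k = Suc n"
      define c where "c i = complex_of_real (dyadic_avg k (S \<inter> ?T) i - dyadic_avg k S i * dyadic_avg k ?T i)" for i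
      \<comment> \<open>The index of the only interval that can have \<open>a\<close> in its
        interior. For negative \<open>a\<close> it is the default 0, which does no harm because the
        third case below requires \<open>a > 0\<close>.\<close>
      define l where "l = nat \<lfloor>2 ^ k * a\<rfloor>"
      have D: "D n = diag_op k c"
        by (simp add: D_def k_def c_def[abs_def] avg_op_def diag_op_mult diag_op_diff)
      have c: "(cmod (c i))\<^sup>2 \<le> (if i = l then 1 else 0)" for i
      proof -
        consider "2 ^ k * a \<le> real i" | "real i + 1 \<le> 2 ^ k * a" | "real i < 2 ^ k * a" "2 ^ k * a < real i + 1"
          by linarith
        then show ?thesis
        proof cases
          case 1
          have "?T \<inter> dyadic_ivl k i = {}"
          proof (rule equals0I)
            fix t assume "t \<in> ?T \<inter> dyadic_ivl k i"
            then have t: "t < a" "real i \<le> 2 ^ k * t"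
              by (auto simp: dyadic_ivl_def)
            have "2 ^ k * a \<le> 2 ^ k * t"
              using 1 t(2) by linarith
            then have "a \<le> t"
              by (rule mult_left_le_imp_le) simp
            then show False
              using t by simp
          qed
          then have "dyadic_avg k ?T i = 0" "dyadic_avg k (S \<inter> ?T) i = 0"
            by (auto intro: dyadic_avg_empty)
          then show ?thesis
            by (simp add: c_def)
        next
          case 2
          have "dyadic_ivl k i \<subseteq> ?T"
          proof
            fix t assume "t \<in> dyadic_ivl k i"
            then have "2 ^ k * t < real i + 1"
              by (simp add: dyadic_ivl_def)
            then have "2 ^ k * t < 2 ^ k * a"
              using 2 by linarith
            then have "t < a"
              by (rule mult_left_less_imp_less) simp
            then show "t \<in> ?T"
              by simp
          qed
          then have "dyadic_avg k ?T i = 1" "S \<inter> ?T \<inter> dyadic_ivl k i = S \<inter> dyadic_ivl k i"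
            by (auto intro: dyadic_avg_full)
          then show ?thesis
            by (simp add: c_def dyadic_avg_def)
        next
          case 3
          then have "i = l"
            unfolding l_def by linarith
          have "0 \<le> dyadic_avg k S i * dyadic_avg k ?T i" "dyadic_avg k S i * dyadic_avg k ?T i \<le> 1"
            using dyadic_avg_nonneg dyadic_avg_le_one S ST(2) by (auto intro: mult_le_one)
          then have "\<bar>dyadic_avg k (S \<inter> ?T) i - dyadic_avg k S i * dyadic_avg k ?T i\<bar> \<le> 1"
            using dyadic_avg_nonneg[of k "S \<inter> ?T" i] dyadic_avg_le_one[OF ST(1), of k i] by linarith
          then have "cmod (c i) \<le> 1"
            by (simp only: c_def norm_of_real)
          then show ?thesis
            using \<open>i = l\<close> by (simp add: power_le_one)
        qed
      qed
      have "(\<Sum>i<2 ^ k. (cmod (c i))\<^sup>2) \<le> (\<Sum>i<2 ^ k. if i = l then 1 else 0)"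
        by (intro sum_mono c)
      also have "\<dots> \<le> 1"
        by simp
      finally show ?thesis
        unfolding D by (simp add: norm2_diag_op k_def divide_right_mono)
    qed
    then have "(\<lambda>n. (norm2 \<tau> (D n))\<^sup>2) \<longlonglongrightarrow> 0"
      using LIMSEQ_ignore_initial_segment[OF LIMSEQ_power_zero[of "1 / 2 :: real"], of 1]
      by (intro tendsto_sandwich[of "\<lambda>n. 0" "\<lambda>n. (norm2 \<tau> (D n))\<^sup>2" _ "\<lambda>n. (1 / 2) ^ (n + 1)"])
        (auto simp: power_divide intro!: always_eventually)
    from tendsto_real_sqrt[OF this] show "(\<lambda>n. norm2 \<tau> (D n - 0)) \<longlonglongrightarrow> 0"
      using norm2_nonneg[OF DM] by simp
  qed auto
  ultimately show ?thesis
    using strong_lim_unique by fastforce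
qed

end

section \<open>Countable additivity and multiplicativity of the dyadic measure\<close>

context dyadic_units
begin

text \<open>Finite additivity leaves the tails \<open>R N\<close>, which decrease to the empty set.
  Their traces are Lebesgue measures and tend to 0; \<open>small_trace\<close> makes the quadratic
  forms small, and \<open>dyadic_pvm_norm_le\<close> turns this into strong convergence.\<close>

lemma dyadic_pvm_sums:
  assumes F: "range F \<subseteq> sets borel" "disjoint_family F"
  shows "(\<lambda>n. app (dyadic_pvm (F n)) x) sums app (dyadic_pvm (\<Union>n. F n)) x"
proof -
  define R where "R N = (\<Union>n\<in>{N..}. F n)" for N :: nat
  have Fn: "F n \<in> sets borel" and RN: "R N \<in> sets borel" for n N
    using F(1) by (auto simp: R_def)
  have disj: "F i \<inter> F j = {}" if "i \<noteq> j" for i j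
    using F(2) that by (simp add: disjoint_family_on_def)
  have split: "R N = F N \<union> R (Suc N)" "F N \<inter> R (Suc N) = {}" for N
  proof -
    have "{N..} = insert N {Suc N..}"
      by auto
    then show "R N = F N \<union> R (Suc N)"
      by (simp add: R_def)
    have "F N \<inter> F m = {}" if "m \<in> {Suc N..}" for m
      using that by (intro disj) auto
    then show "F N \<inter> R (Suc N) = {}"
      unfolding R_def by blast
  qed
  have part: "app (dyadic_pvm (\<Union>n. F n)) x = (\<Sum>n<N. app (dyadic_pvm (F n)) x) + app (dyadic_pvm (R N)) x" for N
  proof (induction N)
    case (Suc N)
    have "dyadic_pvm (R N) = dyadic_pvm (F N) + dyadic_pvm (R (Suc N))"
      unfolding split(1)[of N] by (intro dyadic_pvm_add Fn RN split)
    then show ?case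
      using Suc by simp
  qed (simp add: R_def)
  have "(\<lambda>N. measure lborel (R N \<inter> {0..<1})) \<longlonglongrightarrow> measure lborel (\<Inter>N. R N \<inter> {0..<1})"
  proof (rule Lim_measure_decseq)
    have "R n \<subseteq> R m" if "m \<le> n" for m n
      unfolding R_def using that by (intro UN_mono) auto
    then show "decseq (\<lambda>N. R N \<inter> {0..<1})"
      unfolding decseq_def by blast
    show "emeasure lborel (R N \<inter> {0..<1}) \<noteq> \<infinity>" for N
    proof -
      have "emeasure lborel (R N \<inter> {0..<1}) \<le> emeasure lborel {0..<1::real}"
        by (rule emeasure_mono) auto
      then show ?thesis
        by (simp add: top_unique) (metis ennreal_one_neq_top neq_top_trans)
    qed
  qed (use RN in auto)
  also have "(\<Inter>N. R N \<inter> {0..<1}) = {}"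
  proof (rule equals0I)
    fix t assume t: "t \<in> (\<Inter>N. R N \<inter> {0..<1})"
    then obtain n where "t \<in> F n"
      by (auto simp: R_def)
    moreover obtain m where "m \<ge> Suc n" "t \<in> F m"
      using t by (auto simp: R_def)
    ultimately show False
      using disj[of n m] by auto
  qed
  finally have lim: "(\<lambda>N. measure lborel (R N \<inter> {0..<1})) \<longlonglongrightarrow> 0"
    by simp
  have "(\<lambda>N. app (dyadic_pvm (R N)) x) \<longlonglongrightarrow> 0"
  proof (rule LIMSEQ_I)
    fix e :: real assume e: "0 < e"
    obtain d where d: "d > 0" "\<And>T. T \<in> M \<Longrightarrow> positive_op T \<Longrightarrow> op_bound 1 T \<Longrightarrow> Re (\<tau> T) < d \<Longrightarrow>
        Re (cinner x (app T x)) < e\<^sup>2"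
      using small_trace[of 1 "e\<^sup>2" x] e by auto
    obtain N where N: "\<forall>n\<ge>N. \<bar>measure lborel (R n \<inter> {0..<1})\<bar> < d"
      using LIMSEQ_D[OF lim d(1)] by auto
    have "norm (app (dyadic_pvm (R n)) x) < e" if "n \<ge> N" for n
    proof (rule power2_less_imp_less)
      have "Re (\<tau> (dyadic_pvm (R n))) < d"
        using N that by (auto simp: trace_dyadic_pvm[OF RN])
      then have "Re (cinner x (app (dyadic_pvm (R n)) x)) < e\<^sup>2"
        by (intro d dyadic_pvm_M dyadic_pvm_positive dyadic_pvm_bound RN)
      then show "(norm (app (dyadic_pvm (R n)) x))\<^sup>2 < e\<^sup>2"
        using dyadic_pvm_norm_le[OF RN, of n x] by linarith
    qed (use e in simp)
    then show "\<exists>N. \<forall>n\<ge>N. norm (app (dyadic_pvm (R n)) x - 0) < e"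
      by auto
  qed
  from tendsto_diff[OF tendsto_const this]
  have "(\<lambda>N. app (dyadic_pvm (\<Union>n. F n)) x - app (dyadic_pvm (R N)) x) \<longlonglongrightarrow> app (dyadic_pvm (\<Union>n. F n)) x"
    by simp
  moreover have "(\<Sum>n<N. app (dyadic_pvm (F n)) x) = app (dyadic_pvm (\<Union>n. F n)) x - app (dyadic_pvm (R N)) x" for N
    using part[of N] by simp
  ultimately show ?thesis
    by (simp add: sums_def)
qed

text \<open>Half-lines form an intersection-stable generator of the Borel sets. The case of a
  half-line is already known for arbitrary Borel \<open>S\<close>, so a single Dynkin induction on
  \<open>T\<close> suffices.\<close>

lemma dyadic_pvm_Int:
  assumes "S \<in> sets borel" "T \<in> sets borel"
  shows "dyadic_pvm (S \<inter> T) = dyadic_pvm S * dyadic_pvm T"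
proof -
  have int: "Int_stable (range (lessThan :: real \<Rightarrow> real set))"
  proof (rule Int_stableI)
    fix A B :: "real set" assume "A \<in> range lessThan" "B \<in> range lessThan"
    then obtain a b where "A = {..<a}" "B = {..<b}"
      by blast
    then have "A \<inter> B = {..<min a b}"
      by auto
    then show "A \<inter> B \<in> range lessThan"
      by blast
  qed
  have borel: "sets borel = sigma_sets UNIV (range (lessThan :: real \<Rightarrow> real set))"
    by (subst borel_Iio) (simp add: sets_measure_of)
  have G: "range (lessThan :: real \<Rightarrow> real set) \<subseteq> Pow UNIV"
    by simp
  show ?thesis
    using int G assms(2)[unfolded borel]
  proof (induction rule: sigma_sets_induct_disjoint)
    case (basic A)
    then show ?case
      using dyadic_pvm_Int_lessThan[OF assms(1)] by auto
  next
    case empty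
    show ?case
      by (simp add: dyadic_pvm_empty)
  next
    case (compl A)
    then have A: "A \<in> sets borel"
      by (simp add: borel)
    have "dyadic_pvm ((S \<inter> A) \<union> (S \<inter> - A)) = dyadic_pvm (S \<inter> A) + dyadic_pvm (S \<inter> - A)"
      using assms A by (intro dyadic_pvm_add) auto
    moreover have "(S \<inter> A) \<union> (S \<inter> - A) = S"
      by auto
    moreover have "dyadic_pvm (A \<union> - A) = dyadic_pvm A + dyadic_pvm (- A)"
      using A by (intro dyadic_pvm_add) auto
    moreover have "A \<union> - A = UNIV"
      by auto
    ultimately have "dyadic_pvm S = dyadic_pvm (S \<inter> A) + dyadic_pvm (S \<inter> - A)"
      "1 = dyadic_pvm A + dyadic_pvm (- A)"
      by (simp_all add: dyadic_pvm_UNIV)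
    then have "dyadic_pvm (S \<inter> - A) = dyadic_pvm S - dyadic_pvm S * dyadic_pvm A"
      "dyadic_pvm (- A) = 1 - dyadic_pvm A"
      using compl by (simp_all add: eq_diff_eq add.commute)
    then show ?case
      by (simp add: right_diff_distrib Compl_eq_Diff_UNIV[symmetric])
  next
    case (union F)
    then have F: "range F \<subseteq> sets borel"
      by (simp add: borel)
    have "app (dyadic_pvm (S \<inter> (\<Union>n. F n))) x = app (dyadic_pvm S * dyadic_pvm (\<Union>n. F n)) x" for x
    proof (rule sums_unique2)
      have "range (\<lambda>n. S \<inter> F n) \<subseteq> sets borel" "disjoint_family (\<lambda>n. S \<inter> F n)"
        using F assms(1) union(1) by (auto simp: disjoint_family_on_def)
      from dyadic_pvm_sums[OF this, of x]
      show "(\<lambda>n. app (dyadic_pvm (S \<inter> F n)) x) sums app (dyadic_pvm (S \<inter> (\<Union>n. F n))) x"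
        by simp
      have "(\<lambda>n. app (dyadic_pvm S) (app (dyadic_pvm (F n)) x)) sums app (dyadic_pvm S) (app (dyadic_pvm (\<Union>n. F n)) x)"
        by (rule bounded_linear.sums[OF bounded_linear_app dyadic_pvm_sums[OF F union(1)]])
      then show "(\<lambda>n. app (dyadic_pvm (S \<inter> F n)) x) sums app (dyadic_pvm S * dyadic_pvm (\<Union>n. F n)) x"
        using union(3) by simp
    qed
    then show ?case
      by (rule cop_eqI)
  qed
qed

lemma dyadic_pvm_projection: "S \<in> sets borel \<Longrightarrow> projection (dyadic_pvm S)"
  using dyadic_pvm_Int[of S S] by (simp add: projection_def dyadic_pvm_adj)

lemma projection_valued_measure_dyadic_pvm: "projection_valued_measure dyadic_pvm"
  unfolding projection_valued_measure_def
  by (auto simp: dyadic_pvm_projection dyadic_pvm_UNIV intro!: dyadic_pvm_sums)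

lemma Re_cinner_dyadic_pvm_nonneg: "S \<in> sets borel \<Longrightarrow> 0 \<le> Re (cinner x (app (dyadic_pvm S) x))"
  using dyadic_pvm_positive by (auto simp: positive_op_def less_eq_complex_def)

section \<open>Scalar measures and spectral integrals\<close>

lemma sets_vector_measure [simp, measurable_cong]: "sets (vector_measure P x) = sets borel"
  unfolding vector_measure_def using sets.sigma_sets_eq[of "borel :: real measure"]
  by (subst sets_measure_of) auto

lemma space_vector_measure [simp]: "space (vector_measure P x) = UNIV"
  unfolding vector_measure_def by (subst space_measure_of) auto

text \<open>\<open>measure_of\<close> yields the intended values only after countable additivity has
  been verified; it is inherited from strong additivity through the continuous map
  \<open>Re (cinner x y)\<close> in \<open>y\<close>.\<close>

lemma emeasure_vector_measure:
  assumes S: "S \<in> sets borel"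
  shows "emeasure (vector_measure dyadic_pvm x) S = ennreal (Re (cinner x (app (dyadic_pvm S) x)))"
proof (rule emeasure_measure_of)
  show "vector_measure dyadic_pvm x =
      measure_of UNIV (sets borel) (\<lambda>S. ennreal (Re (cinner x (app (dyadic_pvm S) x))))"
    by (simp add: vector_measure_def)
  show "positive (sets (vector_measure dyadic_pvm x)) (\<lambda>S. ennreal (Re (cinner x (app (dyadic_pvm S) x))))"
    by (simp add: positive_def dyadic_pvm_empty)
  show "countably_additive (sets (vector_measure dyadic_pvm x)) (\<lambda>S. ennreal (Re (cinner x (app (dyadic_pvm S) x))))"
  proof (rule countably_additiveI)
    fix F :: "nat \<Rightarrow> real set"
    assume F: "range F \<subseteq> sets (vector_measure dyadic_pvm x)" "disjoint_family F"
    then have F': "range F \<subseteq> sets borel" "F n \<in> sets borel" for n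
      by auto
    have "bounded_linear (\<lambda>y. Re (cinner x y))"
      by (rule bounded_linear_compose[OF bounded_linear_Re bounded_linear_cinner_right])
    from bounded_linear.sums[OF this dyadic_pvm_sums[OF F'(1) F(2)]]
    have "(\<lambda>n. Re (cinner x (app (dyadic_pvm (F n)) x))) sums Re (cinner x (app (dyadic_pvm (\<Union>n. F n)) x))" .
    then show "(\<Sum>n. ennreal (Re (cinner x (app (dyadic_pvm (F n)) x)))) = ennreal (Re (cinner x (app (dyadic_pvm (\<Union>n. F n)) x)))"
      using Re_cinner_dyadic_pvm_nonneg[OF F'(2)] by (intro suminf_ennreal_eq)
  qed
qed (use S in auto)

lemma measure_vector_measure:
  "S \<in> sets borel \<Longrightarrow> measure (vector_measure dyadic_pvm x) S = Re (cinner x (app (dyadic_pvm S) x))"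
  by (simp add: measure_def emeasure_vector_measure Re_cinner_dyadic_pvm_nonneg)

lemma finite_vector_measure: "finite_measure (vector_measure dyadic_pvm x)"
  by (rule finite_measureI) (simp add: emeasure_vector_measure)

text \<open>The integral of a step function on dyadic intervals is the form of a diagonal operator,
  and uniform approximation passes to the limit on both sides. It is used once for \<open>f\<close>
  and once for the identity function, which yields \<open>x\<close>.\<close>

lemma has_spectral_integral_dyadic:
  assumes k: "k \<ge> 1" and f: "f \<in> borel_measurable borel"
    and approx: "\<And>n i t. i < 2 ^ (k + n) \<Longrightarrow> t \<in> dyadic_ivl (k + n) i \<Longrightarrow> cmod (f t - c n i) \<le> \<epsilon> n"
    and \<epsilon>: "\<epsilon> \<longlonglongrightarrow> 0" and T: "strong_lim (\<lambda>n. diag_op (k + n) (c n)) T"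
  shows "has_spectral_integral dyadic_pvm f T"
  unfolding has_spectral_integral_def
proof (intro allI conjI)
  fix x
  let ?\<mu> = "vector_measure dyadic_pvm x"
  interpret finite_measure ?\<mu>
    by (rule finite_vector_measure)
  define g where "g n t = (\<Sum>i<2 ^ (k + n). indicator (dyadic_ivl (k + n) i) t *\<^sub>R c n i)" for n t
  have g_int: "integrable ?\<mu> (g n)" for n
    unfolding g_def by (intro Bochner_Integration.integrable_sum integrable_scaleR_left integrable_real_indicator)
      (auto simp: emeasure_vector_measure)
  have g_eq: "integral\<^sup>L ?\<mu> (g n) = cinner x (app (diag_op (k + n) (c n)) x)" for n
  proof -
    have kn: "k + n \<ge> 1"
      using k by simp
    have "integral\<^sup>L ?\<mu> (g n) = (\<Sum>i<2 ^ (k + n). measure ?\<mu> (dyadic_ivl (k + n) i) *\<^sub>R c n i)"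
      unfolding g_def by (subst Bochner_Integration.integral_sum)
        (auto simp: emeasure_vector_measure intro!: integrable_scaleR_left integrable_real_indicator)
    also have "\<dots> = cinner x (app (diag_op (k + n) (c n)) x)"
      unfolding cinner_diag_op[OF kn]
      using v_diag(4)[OF kn] by (intro sum.cong refl)
        (auto simp: measure_vector_measure dyadic_pvm_ivl[OF kn] scaleR_conv_of_real)
    finally show ?thesis .
  qed
  have g_val: "g n t = c n i" if "i < 2 ^ (k + n)" "t \<in> dyadic_ivl (k + n) i" for n i t
  proof -
    have "indicator (dyadic_ivl (k + n) j) t *\<^sub>R c n j = (if j = i then c n i else 0)" for j
      using that(2) dyadic_ivl_disjoint[of j i "k + n"] by (auto simp: indicator_def)
    then show ?thesis
      using that(1) by (simp add: g_def)
  qed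
  \<comment> \<open>Outside \<open>{0..<1}\<close> nothing is known about \<open>f\<close>; that set
    is null for every vector measure.\<close>
  have "emeasure ?\<mu> (- {0..<1}) = 0"
    by (simp add: emeasure_vector_measure dyadic_pvm_empty)
  then have "AE t in ?\<mu>. t \<in> {0..<1}"
    by (intro AE_I[of _ _ "- {0..<1}"]) auto
  then have AE: "AE t in ?\<mu>. cmod (f t - g n t) \<le> \<epsilon> n" for n
  proof (rule AE_mp, intro AE_I2 impI)
    fix t :: real assume "t \<in> {0..<1}"
    then obtain i where i: "i < 2 ^ (k + n)" "t \<in> dyadic_ivl (k + n) i"
      using dyadic_ivl_union[of "k + n"] by blast
    then show "cmod (f t - g n t) \<le> \<epsilon> n"
      using approx[OF i] g_val[OF i] by simp
  qed
  have fm: "f \<in> borel_measurable ?\<mu>"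
    using f measurable_cong_sets[OF sets_vector_measure refl] by blast
  have fg_int: "integrable ?\<mu> (\<lambda>t. f t - g n t)" for n
    by (rule integrable_const_bound[OF AE]) (use fm borel_measurable_integrable[OF g_int] in measurable)
  \<comment> \<open>\<open>f\<close> may be unbounded on the null set; it is the sum of an almost
    everywhere bounded function and a step function.\<close>
  show f_int: "integrable ?\<mu> f"
    using Bochner_Integration.integrable_add[OF fg_int[of 0] g_int[of 0]] by simp
  have "(\<lambda>n. integral\<^sup>L ?\<mu> f - integral\<^sup>L ?\<mu> (g n)) \<longlonglongrightarrow> 0"
  proof (rule Lim_null_comparison)
    have "norm (integral\<^sup>L ?\<mu> f - integral\<^sup>L ?\<mu> (g n)) \<le> \<epsilon> n * measure ?\<mu> UNIV" for n
    proof -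
      have "norm (integral\<^sup>L ?\<mu> (\<lambda>t. f t - g n t)) \<le> integral\<^sup>L ?\<mu> (\<lambda>t. cmod (f t - g n t))"
        by (rule integral_norm_bound)
      also have "\<dots> \<le> integral\<^sup>L ?\<mu> (\<lambda>t. \<epsilon> n)"
        by (rule integral_mono_AE[OF integrable_norm[OF fg_int] _ AE]) simp
      finally show ?thesis
        using f_int g_int by (simp add: Bochner_Integration.integral_diff mult.commute)
    qed
    then show "\<forall>\<^sub>F n in sequentially. norm (integral\<^sup>L ?\<mu> f - integral\<^sup>L ?\<mu> (g n)) \<le> \<epsilon> n * measure ?\<mu> UNIV"
      by simp
    show "(\<lambda>n. \<epsilon> n * measure ?\<mu> UNIV) \<longlonglongrightarrow> 0"
      using tendsto_mult_right[OF \<epsilon>] by simp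
  qed
  from tendsto_diff[OF tendsto_const[of "integral\<^sup>L ?\<mu> f"] this]
  have "(\<lambda>n. cinner x (app (diag_op (k + n) (c n)) x)) \<longlonglongrightarrow> integral\<^sup>L ?\<mu> f"
    by (simp add: g_eq)
  moreover have "(\<lambda>n. cinner x (app (diag_op (k + n) (c n)) x)) \<longlonglongrightarrow> cinner x (app T x)"
    using T by (auto simp: strong_lim_def intro!: tendsto_cinner)
  ultimately show "cinner x (app T x) = integral\<^sup>L ?\<mu> f"
    by (rule LIMSEQ_unique[symmetric])
qed

text \<open>The function \<open>f\<close> serves as common reference for the coefficients of
  different levels, which makes the sequence Cauchy without any limit operator being known
  beforehand.\<close>

lemma diag_op_converges:
  assumes k: "k \<ge> 1"
    and approx: "\<And>n i t. i < 2 ^ (k + n) \<Longrightarrow> t \<in> dyadic_ivl (k + n) i \<Longrightarrow> cmod (f t - c n i) \<le> \<epsilon> n"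
    and \<epsilon>: "\<epsilon> \<longlonglongrightarrow> (0 :: real)"
  obtains T K where "strong_lim (\<lambda>n. diag_op (k + n) (c n)) T" "\<And>n. op_bound K (diag_op (k + n) (c n))"
proof -
  define X where "X n = diag_op (k + n) (c n)" for n
  have kn: "k + n \<ge> 1" for n
    using k by simp
  have XM: "X n \<in> M" for n
    unfolding X_def by (rule diag_op_M[OF kn])
  have diff: "X n - X m = diag_op (k + n) (\<lambda>i. c n i - c m (i div 2 ^ (n - m)))"
    and coeff: "i < 2 ^ (k + n) \<Longrightarrow> cmod (c n i - c m (i div 2 ^ (n - m))) \<le> \<epsilon> n + \<epsilon> m"
    if mn: "m \<le> n" for m n i
  proof -
    define d where "d = n - m"
    have n: "n = m + d"
      using mn by (simp add: d_def)
    have "X m = diag_op (k + n) (\<lambda>i. c m (i div 2 ^ d))"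
      using diag_op_refine_add[OF kn, of m "c m" d] by (simp add: X_def n add.assoc)
    then show "X n - X m = diag_op (k + n) (\<lambda>i. c n i - c m (i div 2 ^ (n - m)))"
      unfolding X_def[of n] d_def[symmetric] by (simp add: diag_op_diff)
    assume i: "i < 2 ^ (k + n)"
    \<comment> \<open>The left end point of an interval also lies in its ancestor of level
      \<open>k + m\<close>, so both coefficients are compared with the same value
      \<open>f t\<close>.\<close>
    define t :: real where "t = real i / 2 ^ (k + n)"
    have t: "t \<in> dyadic_ivl (k + n) i"
      by (simp add: t_def dyadic_ivl_def)
    have i': "i div 2 ^ d < 2 ^ (k + m)"
      using i by (intro less_mult_imp_div_less) (simp add: n power_add mult_ac)
    have "2 ^ (k + m) * t = real i / real (2 ^ d)"
      by (simp add: t_def n power_add)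
    then have "\<lfloor>2 ^ (k + m) * t\<rfloor> = int (i div 2 ^ d)"
      by (simp only: floor_divide_of_nat_eq)
    then have "t \<in> dyadic_ivl (k + m) (i div 2 ^ d)"
      unfolding dyadic_ivl_def by (auto simp only: mem_Collect_eq floor_eq_iff of_int_of_nat_eq)
    from approx[OF i t] approx[OF i' this]
    have "cmod (c n i - f t) \<le> \<epsilon> n" "cmod (f t - c m (i div 2 ^ d)) \<le> \<epsilon> m"
      by (simp_all add: norm_minus_commute)
    then show "cmod (c n i - c m (i div 2 ^ (n - m))) \<le> \<epsilon> n + \<epsilon> m"
      unfolding d_def[symmetric] using norm_triangle_le[of "c n i - f t" "f t - c m (i div 2 ^ d)" "\<epsilon> n + \<epsilon> m"] by simp
  qed
  obtain B where B: "\<And>n. \<bar>\<epsilon> n\<bar> \<le> B"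
    using convergent_imp_Bseq[OF convergentI[OF \<epsilon>]] unfolding Bseq_def by auto
  obtain L where L: "L \<ge> 0" "op_bound L (X 0)"
    by (rule op_bound_exists)
  have B0: "B \<ge> 0"
    using B[of 0] by linarith
  \<comment> \<open>No bound on the coefficients is assumed; boundedness is inherited from the
    single operator \<open>X 0\<close>, from which every \<open>X n\<close> differs by at most
    \<open>2 * B\<close>.\<close>
  have bound: "op_bound (2 * B + L) (X n)" for n
  proof -
    have "op_bound (2 * B) (X n - X 0)"
      unfolding diff[OF le0]
    proof (rule op_bound_diag_op[OF kn])
      show "cmod (c n i - c 0 (i div 2 ^ (n - 0))) \<le> 2 * B" if "i < 2 ^ (k + n)" for i
        using coeff[OF le0 that] B[of n] B[of 0] by linarith
    qed (use B0 in simp)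
    from op_bound_add[OF this L(2)] show ?thesis
      by simp
  qed
  obtain T where "strong_lim X T"
  proof (rule strong_lim_of_norm2_Cauchy[OF XM bound])
    fix e :: real assume e: "e > 0"
    then obtain N where N: "\<forall>n\<ge>N. \<bar>\<epsilon> n\<bar> < e / 2"
      using LIMSEQ_D[OF \<epsilon>, of "e / 2"] by auto
    have "norm2 \<tau> (X n - X m) < e" if "m \<ge> N" "n \<ge> m" for m n
    proof -
      have nm: "\<bar>\<epsilon> n\<bar> < e / 2" "\<bar>\<epsilon> m\<bar> < e / 2"
        using N that by auto
      have "norm2 \<tau> (X n - X m) \<le> \<bar>\<epsilon> n\<bar> + \<bar>\<epsilon> m\<bar>"
        unfolding diff[OF that(2)]
      proof (rule norm2_diag_op_le[OF kn])
        show "cmod (c n i - c m (i div 2 ^ (n - m))) \<le> \<bar>\<epsilon> n\<bar> + \<bar>\<epsilon> m\<bar>" if "i < 2 ^ (k + n)" for i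
          using coeff[OF \<open>n \<ge> m\<close> that] by linarith
      qed simp
      then show ?thesis
        using nm by linarith
    qed
    then show "\<exists>N. \<forall>m\<ge>N. \<forall>n\<ge>m. norm2 \<tau> (X n - X m) < e"
      by blast
  qed (use B0 L in auto)
  with bound show thesis
    using that unfolding X_def by blast
qed

end

section \<open>From a coherent dyadic system to zero-based matrix units\<close>

lemma coherent_dyadic_units:
  assumes tr: "tracial_algebra M \<tau>" and masa: "masa M \<A>" and dy: "coherent_dyadic_system M \<A> u p"
  defines "v \<equiv> \<lambda>k i j. dyadic_unit u p k (Suc i) (Suc j)"
  shows "dyadic_units M \<tau> v" and "k \<ge> 1 \<Longrightarrow> dyadic_embedding u p k = dyadic_units.emb v k"
    and "k \<ge> 1 \<Longrightarrow> i < 2 ^ k \<Longrightarrow> v k i i = p k (Suc i)" and "k \<ge> 1 \<Longrightarrow> i < 2 ^ k \<Longrightarrow> v k i i \<in> \<A>"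
proof -
  interpret tracial_algebra M \<tau>
    by (rule tr)
  have units: "matrix_units (2 ^ k) (dyadic_unit u p k)"
    and diag: "\<And>j. j \<in> {1..2 ^ k} \<Longrightarrow> dyadic_unit u p k j j = p k j"
    and coh: "\<And>i j. i \<in> {1..2 ^ k} \<Longrightarrow> j \<in> {1..2 ^ k} \<Longrightarrow>
      dyadic_unit u p (k+1) (2*i-1) (2*j-1) + dyadic_unit u p (k+1) (2*i) (2*j) = dyadic_unit u p k i j"
    and mem: "\<And>i. i \<in> {1..2 ^ k} \<Longrightarrow> u k i \<in> M \<and> p k i \<in> \<A>"
    if "k \<ge> 1" for k
    using dy that unfolding coherent_dyadic_system_def normalizer_def by auto
  have \<A>M: "\<A> \<subseteq> M"
    using masa by (simp add: masa_def)
  show "dyadic_units M \<tau> v"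
  proof
    fix k i j :: nat
    assume k: "k \<ge> 1"
    note U = units[OF k, unfolded matrix_units_def]
    show "(\<Sum>i<2 ^ k. v k i i) = 1"
      using U by (simp add: v_def sum.atLeast1_atMost_eq)
    assume i: "i < 2 ^ k"
    assume j: "j < 2 ^ k"
    show "v k i j \<in> M"
      using mem[OF k, of "Suc i"] mem[OF k, of "Suc j"] mem[OF k, of 1] i j \<A>M
      by (auto simp: v_def dyadic_unit_def intro!: M_mult M_adj)
    show "adj (v k i j) = v k j i"
      using U i j by (simp add: v_def)
    \<comment> \<open>The one-based odd index \<open>2 * Suc i - 1\<close> is
      \<open>Suc (2 * i)\<close>, hence the zero-based even index \<open>2 * i\<close>.\<close>
    show "v (Suc k) (2 * i) (2 * j) + v (Suc k) (Suc (2 * i)) (Suc (2 * j)) = v k i j"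
      using coh[OF k, of "Suc i" "Suc j"] i j by (simp add: v_def)
    show "v k i j * v k r s = (if j = r then v k i s else 0)" if "r < 2 ^ k" "s < 2 ^ k" for r s
      using U i j that by (simp add: v_def)
  qed
  then interpret dyadic_units M \<tau> v .
  show "dyadic_embedding u p k = emb k" if "k \<ge> 1"
    unfolding dyadic_embedding_def emb_def by (simp add: v_def sum.atLeast1_atMost_eq)
  show eq: "v k i i = p k (Suc i)" if "k \<ge> 1" "i < 2 ^ k"
    using diag[OF that(1), of "Suc i"] that(2) by (simp add: v_def)
  show "v k i i \<in> \<A>" if "k \<ge> 1" "i < 2 ^ k"
    using mem[OF that(1), of "Suc i"] that(2) eq[OF that] by simp
qed

section \<open>The expectation of the limit, and the spectral measure of the associated
  operator\<close>

context dyadic_units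
begin

text \<open>The expectations of the iterates are the diagonal operators of their diagonals. That
  \<A> is the double commutant of some set \<open>G\<close> makes it strongly closed and unital, as
  required for their limit to be the expectation of \<open>a\<close>.\<close>

lemma cond_exp_iter_limit:
  fixes f :: "real \<Rightarrow> complex"
  assumes k: "k \<ge> 1" and A: "A \<in> carrier_mat (2 ^ k) (2 ^ k)" and lim: "strong_lim (iter k A) a"
    and E: "trace_preserving_cond_exp M \<tau> \<A> E"
    and \<A>: "star_subalgebra \<A>" "\<A> \<subseteq> M" "\<And>a b. a \<in> \<A> \<Longrightarrow> b \<in> \<A> \<Longrightarrow> a * b = b * a"
      "commutant (commutant G) = \<A>"
    and v\<A>: "\<And>k i. k \<ge> 1 \<Longrightarrow> i < 2 ^ k \<Longrightarrow> v k i i \<in> \<A>"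
    and f: "f \<in> borel_measurable borel" and lin: "diag_linear f k A"
  shows "has_spectral_integral dyadic_pvm f (E a)"
proof -
  let ?C = "\<lambda>n. mat_iter k A (Suc n)"
  define c where "c n i = ?C n $$ (i, i)" for n i
  \<comment> \<open>A crude bound for the finitely many initial gaps: the sum stands in for the
    maximum.\<close>
  define \<delta> where "\<delta> = (\<Sum>q<2 ^ (k - 1). cmod (blk A q q 1 1 - blk A q q 0 0))"
  have kn: "k + n \<ge> 1" for n
    using k by simp
  note C = mat_iter_Suc_carrier[OF k A]
  have gap: "diag_gap (\<delta> / 2 ^ n) (k + n) (?C n)" for n
  proof (induction n)
    case 0
    have "cmod (blk A q q 1 1 - blk A q q 0 0) \<le> \<delta>" if "q < 2 ^ (k - 1)" for q
      unfolding \<delta>_def using that by (intro member_le_sum) auto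
    then show ?case
      by (simp add: diag_gap_def)
  next
    case (Suc n)
    show ?case
      using diag_gap_rot_step[OF kn C Suc] mat_iter_Suc[of "Suc n" k A]
      by (simp add: mult.commute del: mat_iter.simps)
  qed
  have lin': "diag_linear f (k + n) (?C n)" for n
  proof (induction n)
    case (Suc n)
    show ?case
      using diag_linear_rot_step[OF kn C Suc] mat_iter_Suc[of "Suc n" k A]
      by (simp del: mat_iter.simps)
  qed (simp add: lin)
  have approx: "cmod (f t - c n i) \<le> \<delta> / 2 ^ n" if "i < 2 ^ (k + n)" "t \<in> dyadic_ivl (k + n) i" for n i t
    using diag_linear_approx[OF kn lin' gap that(1)] that(2) by (simp add: c_def dyadic_ivl_def)
  have \<epsilon>: "(\<lambda>n. \<delta> / 2 ^ n) \<longlonglongrightarrow> 0"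
    using tendsto_mult_right_zero[OF LIMSEQ_power_zero[of "1 / 2 :: real"], of \<delta>] by (simp add: power_divide)
  obtain T L where T: "strong_lim (\<lambda>n. diag_op (k + n) (c n)) T" "\<And>n. op_bound L (diag_op (k + n) (c n))"
    using diag_op_converges[where f = f and c = c, OF k approx \<epsilon>] by blast
  have E_iter: "E (iter k A n) = diag_op (k + n) (c n)" for n
    unfolding iter_def c_def by (rule cond_exp_emb[OF E kn v\<A>[OF kn] \<A>(3)])
  have "E S \<in> \<A>" if "S \<in> M" for S
    using E that by (simp add: trace_preserving_cond_exp_def)
  then have "diag_op (k + n) (c n) \<in> commutant (commutant G)" for n
    unfolding E_iter[symmetric] \<A>(4) using iter_M[OF k] by blast
  then have T\<A>: "T \<in> \<A>"
    using strong_lim_commutant[OF T(1)] \<A>(4) by blast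
  obtain K where K: "\<And>n. op_bound K (iter k A n)"
    using iter_op_bound[OF k A] by blast
  have one: "1 \<in> \<A>"
    unfolding \<A>(4)[symmetric] by (simp add: commutant_def)
  have "E a = T"
    by (rule cond_exp_strong_lim[OF E \<A>(1,2) one lim iter_M[OF k] K _ T\<A>, where L = L])
      (simp_all add: E_iter T)
  then show ?thesis
    using has_spectral_integral_dyadic[where c = c, OF k f approx \<epsilon> T(1)] by simp
qed

text \<open>The coefficients are the right end points of the dyadic intervals, since the zero-based
  \<open>i\<close> stands for the projection with index \<open>Suc i\<close>; they differ from the
  identity function by at most the length of the interval.\<close>

lemma spectral_measure_dyadic_pvm:
  assumes x: "strong_lim (\<lambda>k. diag_op (Suc k) (\<lambda>i. complex_of_real (real (Suc i) / 2 ^ Suc k))) x"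
  shows "spectral_measure x dyadic_pvm"
  unfolding spectral_measure_def
proof
  show "has_spectral_integral dyadic_pvm complex_of_real x"
  proof (rule has_spectral_integral_dyadic[where k = 1 and \<epsilon> = "\<lambda>n. 1 / 2 ^ Suc n"])
    show "strong_lim (\<lambda>n. diag_op (1 + n) (\<lambda>i. complex_of_real (real (Suc i) / 2 ^ Suc n))) x"
      using x by simp
    show "cmod (complex_of_real t - complex_of_real (real (Suc i) / 2 ^ Suc n)) \<le> 1 / 2 ^ Suc n"
      if "t \<in> dyadic_ivl (1 + n) i" for n i t
    proof -
      define r h :: real where "r = real i / 2 ^ Suc n" and "h = 1 / 2 ^ Suc n"
      have rh: "(real i + 1) / 2 ^ Suc n = r + h" "real (Suc i) / 2 ^ Suc n = r + h"
        by (simp_all add: r_def h_def add_divide_distrib)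
      have "r \<le> t" "t < r + h"
        using that rh(1) unfolding dyadic_ivl_eq r_def by auto
      then have "\<bar>t - real (Suc i) / 2 ^ Suc n\<bar> \<le> 1 / 2 ^ Suc n"
        unfolding rh(2) h_def[symmetric] by linarith
      then show ?thesis
        unfolding of_real_diff[symmetric] norm_of_real .
    qed
    show "(\<lambda>n. 1 / 2 ^ Suc n) \<longlonglongrightarrow> (0 :: real)"
      using LIMSEQ_Suc[OF LIMSEQ_power_zero[of "1 / 2 :: real"]] by (simp add: power_divide)
  qed auto
qed (rule projection_valued_measure_dyadic_pvm)

end

theorem theorem3p6:
  fixes M \<A> :: "'h::chilbert cop set" and \<tau> :: "'h cop \<Rightarrow> complex"
    and E :: "'h cop \<Rightarrow> 'h cop" and u p :: "nat \<Rightarrow> nat \<Rightarrow> 'h cop" and x :: "'h cop"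
    and k :: nat and A :: "complex mat" and a_seq :: "nat \<Rightarrow> 'h cop"
  defines "\<pi> \<equiv> dyadic_embedding u p"
  assumes "II1_factor M" and "separable_predual M" and "faithful_normal_trace M \<tau>"
    and "semiregular_masa M \<A>" and "trace_preserving_cond_exp M \<tau> \<A> E"
    and "coherent_dyadic_system M \<A> u p" and "associated_operator p x"
    and "k \<ge> 1" and "A \<in> carrier_mat (2^k) (2^k)"
    and "a_seq 1 = \<pi> k A"
    and "\<And>n. n \<ge> 1 \<Longrightarrow> a_seq (n+1) = \<pi> (k+n) (mat_iter k A (n+1))"
  shows "(\<forall>n\<ge>1. a_seq (n+1) =
        \<pi> (k+n) (Wmat (n+k-1)) * \<pi> (k+n) (tensor (1\<^sub>m 2) (mat_iter k A n))
          * adj (\<pi> (k+n) (Wmat (n+k-1))))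
    \<and> (\<exists>a\<in>M. strong_lim a_seq a
      \<and> (mat_projection A \<longrightarrow> projection a)
      \<and> (mat_self_adjoint A \<longrightarrow> self_adjoint a)
      \<and> (mat_positive A \<longrightarrow> positive_op a)
      \<and> (\<forall>(d :: nat \<Rightarrow> complex) (f :: real \<Rightarrow> complex).
            (\<forall>j\<in>{1..2^k}. A $$ (j-1, j-1) = d j) \<longrightarrow>
            f \<in> borel_measurable borel \<longrightarrow>
            (\<forall>j\<in>{1..2^(k-1)}. \<forall>t\<in>{real (j-1) / 2^(k-1) ..< real j / 2^(k-1)}.
               f t = d (2*j-1)
                 + 2^(k-1) * complex_of_real (t - real (j-1) / 2^(k-1)) * (d (2*j) - d (2*j-1))) \<longrightarrow>
            has_borel_calculus x f (E a))
      \<and> (\<forall>B \<in> carrier_mat (2^k) (2^k). \<forall>b.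
            strong_lim (\<lambda>n. \<pi> (n+k-1) (mat_iter k B n)) b \<longrightarrow>
            (norm2 \<tau> (b - a))\<^sup>2 = 1 / 2^k * (frobenius_norm (B - A))\<^sup>2))"
proof -
  define v where "v = (\<lambda>k i j. dyadic_unit u p k (Suc i) (Suc j))"
  have masa: "masa M \<A>"
    using assms by (simp add: semiregular_masa_def)
  have tr: "tracial_algebra M \<tau>"
    using assms by (simp add: tracial_algebra_def II1_factor_def factor_def)
  note D = coherent_dyadic_units[OF tr masa \<open>coherent_dyadic_system M \<A> u p\<close>, folded v_def]
  interpret dyadic_units M \<tau> v
    by (rule D(1))
  have v: "v k i i \<in> \<A>" "v k i i = p k (Suc i)" if "k \<ge> 1" "i < 2 ^ k" for k i
    using D(3,4)[OF that] by (simp_all add: v_def)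
  have \<pi>: "\<pi> l = emb l" if "l \<ge> 1" for l
    unfolding \<pi>_def by (rule D(2)[OF that])
  note k = \<open>k \<ge> 1\<close> and A = \<open>A \<in> carrier_mat (2^k) (2^k)\<close>
  have a_seq: "a_seq (Suc n) = iter k A n" for n
  proof (cases n)
    case 0
    then show ?thesis
      using assms(11) \<pi>[OF k] by (simp add: iter_0)
  next
    case (Suc m)
    then show ?thesis
      using assms(12)[of n] \<pi>[of "k + n"] k by (simp add: iter_def del: mat_iter.simps)
  qed
  \<comment> \<open>The term at \<open>n = 0\<close> is built from dummy values; a strong limit does
    not depend on it, so the sequence may be shifted.\<close>
  have iter_lim: "strong_lim (\<lambda>n. \<pi> (n + k - 1) (mat_iter k B n)) b \<longleftrightarrow> strong_lim (iter k B) b" for B b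
  proof -
    have "\<pi> (Suc n + k - 1) (mat_iter k B (Suc n)) = iter k B n" for n
      using \<pi>[of "k + n"] k by (simp add: iter_def add.commute del: mat_iter.simps)
    then show ?thesis
      by (subst strong_lim_Suc) simp
  qed
  have rec: "a_seq (n+1) = \<pi> (k+n) (Wmat (n+k-1)) * \<pi> (k+n) (tensor (1\<^sub>m 2) (mat_iter k A n))
      * adj (\<pi> (k+n) (Wmat (n+k-1)))" if n: "n \<ge> 1" for n
  proof -
    define N where "N = k + n - 1"
    have N: "N \<ge> 1" "k + n = Suc N" "n + k - 1 = N"
      using k n by (auto simp: N_def)
    have C: "mat_iter k A n \<in> carrier_mat (2 ^ N) (2 ^ N)"
      using mat_iter_carrier[OF k A n] by (simp add: N_def)
    have "iter k A n = emb (Suc N) (rot_step N (mat_iter k A n))"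
      unfolding iter_def mat_iter_Suc[OF n] N(2) diff_Suc_1 ..
    then have "a_seq (n + 1) = emb (Suc N) (rot_step N (mat_iter k A n))"
      unfolding Suc_eq_plus1[symmetric] a_seq .
    then show ?thesis
      unfolding N(2,3) \<pi>[of "Suc N", simplified] emb_tensor[OF N(1) C] emb_rot_step[OF N(1) C] .
  qed
  obtain a where a: "a \<in> M" "strong_lim (iter k A) a"
    by (rule iter_converges[OF k A])
  have a_lim: "strong_lim a_seq a"
    using a(2) by (subst strong_lim_Suc) (simp add: a_seq)
  have "has_borel_calculus x f (E a)"
    if d: "\<forall>j\<in>{1..2^k}. A $$ (j-1, j-1) = d j" and f: "f \<in> borel_measurable borel"
      and lin: "\<forall>j\<in>{1..2^(k-1)}. \<forall>t\<in>{real (j-1) / 2^(k-1) ..< real j / 2^(k-1)}.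
               f t = d (2*j-1)
                 + 2^(k-1) * complex_of_real (t - real (j-1) / 2^(k-1)) * (d (2*j) - d (2*j-1))"
    for d :: "nat \<Rightarrow> complex" and f :: "real \<Rightarrow> complex"
  proof -
    have two: "(2 :: nat) ^ k = 2 * 2 ^ (k - 1)"
      using k by (simp flip: power_Suc)
    have lin': "diag_linear f k A"
      unfolding diag_linear_def
    proof (intro allI impI)
      fix q :: nat and t :: real
      assume q: "q < 2 ^ (k - 1)" and t: "real q \<le> 2 ^ (k - 1) * t" "2 ^ (k - 1) * t < real q + 1"
      have "t \<in> {real (Suc q - 1) / 2 ^ (k - 1) ..< real (Suc q) / 2 ^ (k - 1)}"
        using t by (auto simp: field_simps)
      then have "f t = d (2 * Suc q - 1)
          + 2^(k-1) * complex_of_real (t - real (Suc q - 1) / 2^(k-1)) * (d (2 * Suc q) - d (2 * Suc q - 1))"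
        using lin q by (intro bspec[OF bspec[OF lin]]) auto
      moreover have "d (2 * Suc q - 1) = blk A q q 0 0" "d (2 * Suc q) = blk A q q 1 1"
        using d[rule_format, of "2 * Suc q - 1"] d[rule_format, of "2 * Suc q"] q two
        by (simp_all add: blk_def)
      moreover have "2^(k-1) * complex_of_real (t - real (Suc q - 1) / 2^(k-1)) =
          complex_of_real (2 ^ (k - 1) * t - real q)"
        by (simp add: right_diff_distrib)
      ultimately show "f t = blk A q q 0 0
          + complex_of_real (2 ^ (k - 1) * t - real q) * (blk A q q 1 1 - blk A q q 0 0)"
        by simp
    qed
    have \<A>: "star_subalgebra \<A>" "\<A> \<subseteq> M" "\<And>a b. a \<in> \<A> \<Longrightarrow> b \<in> \<A> \<Longrightarrow> a * b = b * a"
      using masa by (auto simp: masa_def abelian_star_subalgebra_def)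
    have gen: "commutant (commutant {p k j | k j. k \<ge> 1 \<and> j \<in> {1..2^k}}) = \<A>"
      using \<open>coherent_dyadic_system M \<A> u p\<close> by (simp add: coherent_dyadic_system_def)
    have "has_spectral_integral dyadic_pvm f (E a)"
      by (rule cond_exp_iter_limit[OF k A a(2) assms(6) \<A> gen v(1) f lin'])
    moreover have "diag_op (Suc n) (\<lambda>i. complex_of_real (real (Suc i) / 2 ^ Suc n)) =
        (\<Sum>i=1..2^Suc n. complex_of_real (real i / 2^Suc n) *\<^sub>C p (Suc n) i)" for n
      unfolding diag_op_def One_nat_def sum.atLeast1_atMost_eq using v(2)[of "Suc n"]
      by (intro sum.cong refl) auto
    \<comment> \<open>The sequence defining \<open>x\<close> begins at the dummy level 0; the shift
      by one leads to the levels at which matrix units are given.\<close>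
    then have "spectral_measure x dyadic_pvm"
      using \<open>associated_operator p x\<close> unfolding associated_operator_def
      by (intro spectral_measure_dyadic_pvm) (subst (asm) strong_lim_Suc, simp)
    ultimately show ?thesis
      unfolding has_borel_calculus_def by blast
  qed
  moreover have "(norm2 \<tau> (b - a))\<^sup>2 = 1 / 2^k * (frobenius_norm (B - A))\<^sup>2"
    if "B \<in> carrier_mat (2^k) (2^k)" "strong_lim (\<lambda>n. \<pi> (n+k-1) (mat_iter k B n)) b" for B b
    using norm2_iter_limit[OF k A that(1) a(2) that(2)[unfolded iter_lim]] by simp
  ultimately show ?thesis
    using rec a(1) a_lim iter_preserves[OF k A a(2)] by blast
qed

end
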